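(* Let $(M,g)$ be a semi-Riemannian manifold and let $H$ be an embedded $C^{2}$ hypersurface in $M$ (not necessarily non-degenerate). Let $p\in H$ and let $U$ be a neighborhood of $p$ in $H$. Then $H$ is infinitesimally convex in $U$ if and only if $H$ is locally convex in $U$.
   Context: Standing regularity: $M$ has a differentiable structure of class at least $C^2$, and the metric $g$ is differentiable with locally Lipschitz differential (so its Christoffel symbols are locally Lipschitz). $\nabla$ is the Levi-Civita connection of $g$ and $\exp$ its exponential map. $H$ is a hypersurface, i.e. an embedded submanifold of codimension one; the tensor induced on $H$ by $g$ may be degenerate at some points. Hessian: for a $C^2$ function $\phi$, $H_\phi=\nabla(\mathrm{d}\phi)$; in coordinates $(H_\phi)_x(u,v)=\frac{\partial^2\phi}{\partial x^i\partial x^j}(x)u^iv^j-\frac{\partial\phi}{\partial x^l}(x)\Gamma^l_{ij}(x)u^iv^j$. Infinitesimal convexity: $H$ is infinitesimally convex in the open subset $U\subset H$ if there exist an open subset $\tilde U$ of $M$ and a $C^2$ function $\phi\colon\tilde U\to\mathbb{R}$ such that $U=\tilde U\cap H=\phi^{-1}(0)$, $0$ is a regular value of $\phi$, and $H_\phi$ is semidefinite on $TU$ with one and the same sign, i.e. either $(H_\phi)_x(v,v)\le 0$ for all $x\in U$, $v\in T_xH$, or $(H_\phi)_x(v,v)\ge 0$ for all $x\in U$, $v\in T_xH$. Local convexity: $H$ is locally convex in $U$ if there exist an open subset $\tilde U$ of $M$ and a $C^2$ function $\phi\colon\tilde U\to\mathbb{R}$ such that $U=\tilde U\cap H=\phi^{-1}(0)$,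 $0$ is a regular value of $\phi$, and, for one of the two sides $S=\{x\in\tilde U:\phi(x)\le 0\}$ or $S=\{x\in\tilde U:\phi(x)\ge 0\}$ (the same for all points of $U$), every $x\in U$ has the following property: there is a neighborhood $O$ of $0$ in $T_xH$ such that $\exp_x(O)\subset S$ (i.e. the geodesics issuing from $x$ tangentially to $H$ are locally contained in $S$). *)

theory Defs
  imports "HOL-Analysis.Analysis"
begin

section \<open>Differentiability on open subsets of Euclidean space\<close>

definition C2_on :: "'a::real_normed_vector set \<Rightarrow> ('a \<Rightarrow> 'b::real_normed_vector) \<Rightarrow> bool" where
  "C2_on S f \<longleftrightarrow>
     (\<exists>(f' :: 'a \<Rightarrow> 'a \<Rightarrow>\<^sub>L 'b) (f'' :: 'a \<Rightarrow> 'a \<Rightarrow>\<^sub>L ('a \<Rightarrow>\<^sub>L 'b)).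
        (\<forall>x\<in>S. (f has_derivative blinfun_apply (f' x)) (at x)) \<and>
        (\<forall>x\<in>S. (f' has_derivative blinfun_apply (f'' x)) (at x)) \<and>
        continuous_on S f'')"

text \<open>Functions that are differentiable with locally Lipschitz differential.\<close>

definition C11_on :: "'a::real_normed_vector set \<Rightarrow> ('a \<Rightarrow> 'b::real_normed_vector) \<Rightarrow> bool" where
  "C11_on S f \<longleftrightarrow>
     (\<exists>f' :: 'a \<Rightarrow> 'a \<Rightarrow>\<^sub>L 'b.
        (\<forall>x\<in>S. (f has_derivative blinfun_apply (f' x)) (at x)) \<and>
        (\<forall>x\<in>S. \<exists>r>0. \<exists>L. L-lipschitz_on (S \<inter> ball x r) f'))"

definition partial :: "'n \<Rightarrow> (real^'n \<Rightarrow> real) \<Rightarrow> real^'n \<Rightarrow> real" where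
  "partial i f z = frechet_derivative f (at z) (axis i 1)"


section \<open>Manifolds given by an atlas\<close>

text \<open>The manifold is the whole (Hausdorff) type \<open>'m\<close>. A chart is a pair of a domain and a
  coordinate map; the values of the map outside the domain are irrelevant.\<close>

type_synonym ('m, 'n) chart = "'m set \<times> ('m \<Rightarrow> real^'n)"

abbreviation cdom :: "('m, 'n) chart \<Rightarrow> 'm set" where "cdom c \<equiv> fst c"
abbreviation crd :: "('m, 'n) chart \<Rightarrow> 'm \<Rightarrow> real^'n" where "crd c \<equiv> snd c"
abbreviation cinv :: "('m, 'n) chart \<Rightarrow> real^'n \<Rightarrow> 'm" where
  "cinv c \<equiv> inv_into (fst c) (snd c)"

definition is_chart :: "('m::t2_space, 'n::finite) chart \<Rightarrow> bool" where
  "is_chart c \<longleftrightarrow> open (cdom c) \<and> open (crd c ` cdom c) \<and>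
     homeomorphism (cdom c) (crd c ` cdom c) (crd c) (cinv c)"

definition transition :: "('m, 'n) chart \<Rightarrow> ('m, 'n) chart \<Rightarrow> real^'n \<Rightarrow> real^'n" where
  "transition c d = crd d \<circ> cinv c"

definition C2_compatible :: "('m::t2_space, 'n::finite) chart \<Rightarrow> ('m, 'n) chart \<Rightarrow> bool" where
  "C2_compatible c d \<longleftrightarrow>
     C2_on (crd c ` (cdom c \<inter> cdom d)) (transition c d) \<and>
     C2_on (crd d ` (cdom c \<inter> cdom d)) (transition d c)"

text \<open>The atlas is not assumed to be maximal; it may for instance be smooth.\<close>

definition C2_atlas :: "('m::t2_space, 'n::finite) chart set \<Rightarrow> bool" where
  "C2_atlas A \<longleftrightarrow> (\<forall>c\<in>A. is_chart c) \<and> (\<Union>c\<in>A. cdom c) = UNIV \<and>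
     (\<forall>c\<in>A. \<forall>d\<in>A. C2_compatible c d)"

definition charts_at :: "('m, 'n) chart set \<Rightarrow> 'm \<Rightarrow> ('m, 'n) chart set" where
  "charts_at A x = {c \<in> A. x \<in> cdom c}"

definition C2_function_on ::
  "('m::t2_space, 'n::finite) chart set \<Rightarrow> 'm set \<Rightarrow> ('m \<Rightarrow> real) \<Rightarrow> bool" where
  "C2_function_on A V \<phi> \<longleftrightarrow> (\<forall>c\<in>A. C2_on (crd c ` (cdom c \<inter> V)) (\<phi> \<circ> cinv c))"


section \<open>Tangent vectors\<close>

text \<open>A tangent vector at \<open>x\<close> is the family of its component vectors in the charts of the atlas
  around \<open>x\<close>, related by the differentials of the transition maps (and set to \<open>0\<close> at all
  other arguments, so that equality of tangent vectors is equality of functions). The vector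
  space operations are the pointwise ones and the topology is the one induced by the product
  topology, which any chart identifies with that of \<open>real^'n\<close>.\<close>

type_synonym ('m, 'n) tvec = "('m, 'n) chart \<Rightarrow> real^'n"

definition jacobian ::
  "('m, 'n::finite) chart \<Rightarrow> ('m, 'n) chart \<Rightarrow> 'm \<Rightarrow> real^'n \<Rightarrow> real^'n" where
  "jacobian c d x = frechet_derivative (transition c d) (at (crd c x))"

definition tangent_space ::
  "('m::t2_space, 'n::finite) chart set \<Rightarrow> 'm \<Rightarrow> ('m, 'n) tvec set" where
  "tangent_space A x =
     {v. (\<forall>c\<in>charts_at A x. \<forall>d\<in>charts_at A x. v d = jacobian c d x (v c)) \<and>
         (\<forall>c. c \<notin> charts_at A x \<longrightarrow> v c = 0)}"

text \<open>The tangent vector at \<open>x\<close> with components \<open>a\<close> in the chart \<open>c\<close>.\<close>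

definition tvec_of ::
  "('m, 'n::finite) chart set \<Rightarrow> ('m, 'n) chart \<Rightarrow> 'm \<Rightarrow> real^'n \<Rightarrow> ('m, 'n) tvec" where
  "tvec_of A c x a = (\<lambda>d. if d \<in> charts_at A x then jacobian c d x a else 0)"

definition has_velocity ::
  "('m::t2_space, 'n::finite) chart set \<Rightarrow> (real \<Rightarrow> 'm) \<Rightarrow> real \<Rightarrow> ('m, 'n) tvec \<Rightarrow> bool" where
  "has_velocity A \<alpha> t v \<longleftrightarrow> v \<in> tangent_space A (\<alpha> t) \<and>
     (\<forall>c\<in>charts_at A (\<alpha> t). ((crd c \<circ> \<alpha>) has_vector_derivative v c) (at t))"

definition C1_curve_on ::
  "('m::t2_space, 'n::finite) chart set \<Rightarrow> real set \<Rightarrow> (real \<Rightarrow> 'm) \<Rightarrow> bool" where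
  "C1_curve_on A I \<alpha> \<longleftrightarrow> continuous_on I \<alpha> \<and>
     (\<forall>c\<in>A. (crd c \<circ> \<alpha>) C1_differentiable_on {t\<in>I. \<alpha> t \<in> cdom c})"


section \<open>Semi-Riemannian metrics\<close>

type_synonym ('m, 'n) metric = "'m \<Rightarrow> ('m, 'n) tvec \<Rightarrow> ('m, 'n) tvec \<Rightarrow> real"

definition metric_form ::
  "('m, 'n::finite) chart set \<Rightarrow> ('m, 'n) metric \<Rightarrow> ('m, 'n) chart \<Rightarrow> 'm \<Rightarrow>
   real^'n \<Rightarrow> real^'n \<Rightarrow> real" where
  "metric_form A g c x a b = g x (tvec_of A c x a) (tvec_of A c x b)"

text \<open>The matrix of components \<open>g\<^sub>i\<^sub>j\<close> in the chart \<open>c\<close>, as a function of the coordinates.\<close>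

definition metric_matrix ::
  "('m, 'n::finite) chart set \<Rightarrow> ('m, 'n) metric \<Rightarrow> ('m, 'n) chart \<Rightarrow> real^'n \<Rightarrow> real^'n^'n" where
  "metric_matrix A g c z = (\<chi> i j. metric_form A g c (cinv c z) (axis i 1) (axis j 1))"

definition form_index :: "(real^'n \<Rightarrow> real^'n \<Rightarrow> real) \<Rightarrow> nat" where
  "form_index B = (GREATEST k. \<exists>W. subspace W \<and> dim W = k \<and> (\<forall>w\<in>W. w \<noteq> 0 \<longrightarrow> B w w < 0))"

definition semi_riemannian ::
  "('m::t2_space, 'n::finite) chart set \<Rightarrow> ('m, 'n) metric \<Rightarrow> bool" where
  "semi_riemannian A g \<longleftrightarrow>
     C2_atlas A \<and>
     (\<forall>x. \<forall>c\<in>charts_at A x.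
        bilinear (metric_form A g c x) \<and>
        (\<forall>a b. metric_form A g c x a b = metric_form A g c x b a) \<and>
        (\<forall>a. (\<forall>b. metric_form A g c x a b = 0) \<longrightarrow> a = 0)) \<and>
     (\<exists>\<nu>. \<forall>x. \<forall>c\<in>charts_at A x. form_index (metric_form A g c x) = \<nu>) \<and>
     (\<forall>c\<in>A. \<forall>i j. C11_on (crd c ` cdom c) (\<lambda>z. metric_matrix A g c z $ i $ j))"

text \<open>Christoffel symbols of the Levi-Civita connection:
  \<open>\<Gamma>\<^sup>l\<^sub>i\<^sub>j = 1/2 g\<^sup>l\<^sup>m (\<partial>\<^sub>i g\<^sub>j\<^sub>m + \<partial>\<^sub>j g\<^sub>i\<^sub>m - \<partial>\<^sub>m g\<^sub>i\<^sub>j)\<close>.\<close>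

definition christoffel ::
  "('m, 'n::finite) chart set \<Rightarrow> ('m, 'n) metric \<Rightarrow> ('m, 'n) chart \<Rightarrow>
   'n \<Rightarrow> 'n \<Rightarrow> 'n \<Rightarrow> real^'n \<Rightarrow> real" where
  "christoffel A g c l i j z =
     1 / 2 * (\<Sum>m\<in>UNIV. matrix_inv (metric_matrix A g c z) $ l $ m *
       (partial i (\<lambda>w. metric_matrix A g c w $ j $ m) z +
        partial j (\<lambda>w. metric_matrix A g c w $ i $ m) z -
        partial m (\<lambda>w. metric_matrix A g c w $ i $ j) z))"

text \<open>The Hessian \<open>\<nabla>(d\<phi>)\<close> at \<open>x\<close>, in the chart \<open>c\<close> around \<open>x\<close>; its value on tangent vectors
  does not depend on \<open>c\<close>.\<close>

definition hessian ::
  "('m, 'n::finite) chart set \<Rightarrow> ('m, 'n) metric \<Rightarrow> ('m, 'n) chart \<Rightarrow> ('m \<Rightarrow> real) \<Rightarrow> 'm \<Rightarrow>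
   ('m, 'n) tvec \<Rightarrow> ('m, 'n) tvec \<Rightarrow> real" where
  "hessian A g c \<phi> x u v =
     (\<Sum>i\<in>UNIV. \<Sum>j\<in>UNIV. partial i (partial j (\<phi> \<circ> cinv c)) (crd c x) * u c $ i * v c $ j) -
     (\<Sum>i\<in>UNIV. \<Sum>j\<in>UNIV. \<Sum>l\<in>UNIV.
        partial l (\<phi> \<circ> cinv c) (crd c x) * christoffel A g c l i j (crd c x) * u c $ i * v c $ j)"

text \<open>Geodesics on an open interval \<open>I\<close>; \<open>y\<close> is the coordinate velocity in the chart \<open>c\<close>.\<close>

definition geodesic_on ::
  "('m::t2_space, 'n::finite) chart set \<Rightarrow> ('m, 'n) metric \<Rightarrow> real set \<Rightarrow> (real \<Rightarrow> 'm) \<Rightarrow> bool" where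
  "geodesic_on A g I \<gamma> \<longleftrightarrow> continuous_on I \<gamma> \<and>
     (\<forall>c\<in>A. \<exists>y :: real \<Rightarrow> real^'n. \<forall>t\<in>I. \<gamma> t \<in> cdom c \<longrightarrow>
        ((crd c \<circ> \<gamma>) has_vector_derivative y t) (at t) \<and>
        (y has_vector_derivative
          (\<chi> l. - (\<Sum>i\<in>UNIV. \<Sum>j\<in>UNIV. christoffel A g c l i j (crd c (\<gamma> t)) * y t $ i * y t $ j)))
          (at t))"

text \<open>\<open>exp_reaches A g x v q\<close>: the geodesic with initial velocity \<open>v\<close> at \<open>x\<close> is defined up to
  time \<open>1\<close>, where it reaches \<open>q\<close>.\<close>

definition exp_reaches ::
  "('m::t2_space, 'n::finite) chart set \<Rightarrow> ('m, 'n) metric \<Rightarrow> 'm \<Rightarrow> ('m, 'n) tvec \<Rightarrow> 'm \<Rightarrow> bool" where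
  "exp_reaches A g x v q \<longleftrightarrow>
     (\<exists>I \<gamma>. open I \<and> is_interval I \<and> {0..1} \<subseteq> I \<and> geodesic_on A g I \<gamma> \<and>
        \<gamma> 0 = x \<and> has_velocity A \<gamma> 0 v \<and> \<gamma> 1 = q)"

definition exp_domain ::
  "('m::t2_space, 'n::finite) chart set \<Rightarrow> ('m, 'n) metric \<Rightarrow> 'm \<Rightarrow> ('m, 'n) tvec set" where
  "exp_domain A g x = {v. \<exists>q. exp_reaches A g x v q}"

definition exp_map ::
  "('m::t2_space, 'n::finite) chart set \<Rightarrow> ('m, 'n) metric \<Rightarrow> 'm \<Rightarrow> ('m, 'n) tvec \<Rightarrow> 'm" where
  "exp_map A g x v = (THE q. exp_reaches A g x v q)"


section \<open>Hypersurfaces and convexity\<close>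

text \<open>Embedded \<open>C\<^sup>2\<close> submanifolds of codimension one, by slice charts; the slice charts are
  \<open>C\<^sup>2\<close>-compatible with the atlas but need not belong to it.\<close>

definition C2_hypersurface :: "('m::t2_space, 'n::finite) chart set \<Rightarrow> 'm set \<Rightarrow> bool" where
  "C2_hypersurface A H \<longleftrightarrow>
     (\<forall>x\<in>H. \<exists>c k. is_chart c \<and> (\<forall>d\<in>A. C2_compatible c d) \<and> x \<in> cdom c \<and>
        crd c ` (cdom c \<inter> H) = {z \<in> crd c ` cdom c. z $ k = 0})"

text \<open>The tangent space of \<open>H\<close> at \<open>x\<close>, as a subset of the one of \<open>M\<close>: the velocities of the
  \<open>C\<^sup>1\<close> curves in \<open>H\<close> through \<open>x\<close>.\<close>

definition hyper_tangent_space ::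
  "('m::t2_space, 'n::finite) chart set \<Rightarrow> 'm set \<Rightarrow> 'm \<Rightarrow> ('m, 'n) tvec set" where
  "hyper_tangent_space A H x =
     {v. \<exists>\<epsilon>>0. \<exists>\<alpha>. C1_curve_on A {-\<epsilon><..<\<epsilon>} \<alpha> \<and> \<alpha> ` {-\<epsilon><..<\<epsilon>} \<subseteq> H \<and>
        \<alpha> 0 = x \<and> has_velocity A \<alpha> 0 v}"

definition nhd_in :: "'a::topological_space set \<Rightarrow> 'a \<Rightarrow> 'a set \<Rightarrow> bool" where
  "nhd_in X x N \<longleftrightarrow> N \<subseteq> X \<and> (\<exists>W. openin (top_of_set X) W \<and> x \<in> W \<and> W \<subseteq> N)"

definition zero_regular_value ::
  "('m::t2_space, 'n::finite) chart set \<Rightarrow> 'm set \<Rightarrow> ('m \<Rightarrow> real) \<Rightarrow> bool" where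
  "zero_regular_value A V \<phi> \<longleftrightarrow>
     (\<forall>x\<in>V. \<phi> x = 0 \<longrightarrow>
        (\<forall>c\<in>charts_at A x. frechet_derivative (\<phi> \<circ> cinv c) (at (crd c x)) \<noteq> (\<lambda>_. 0)))"

text \<open>\<open>\<phi>\<close> is regarded as a function on \<open>V\<close> only.\<close>

definition defining_function ::
  "('m::t2_space, 'n::finite) chart set \<Rightarrow> 'm set \<Rightarrow> 'm set \<Rightarrow> 'm set \<Rightarrow> ('m \<Rightarrow> real) \<Rightarrow> bool" where
  "defining_function A H U V \<phi> \<longleftrightarrow> open V \<and> C2_function_on A V \<phi> \<and>
     U = V \<inter> H \<and> U = {x\<in>V. \<phi> x = 0} \<and> zero_regular_value A V \<phi>"

definition infinitesimally_convex ::
  "('m::t2_space, 'n::finite) chart set \<Rightarrow> ('m, 'n) metric \<Rightarrow> 'm set \<Rightarrow> 'm set \<Rightarrow> bool" where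
  "infinitesimally_convex A g H U \<longleftrightarrow>
     (\<exists>V \<phi>. defining_function A H U V \<phi> \<and>
        ((\<forall>x\<in>U. \<forall>v\<in>hyper_tangent_space A H x. \<forall>c\<in>charts_at A x. hessian A g c \<phi> x v v \<le> 0) \<or>
         (\<forall>x\<in>U. \<forall>v\<in>hyper_tangent_space A H x. \<forall>c\<in>charts_at A x. hessian A g c \<phi> x v v \<ge> 0)))"

definition exp_locally_in ::
  "('m::t2_space, 'n::finite) chart set \<Rightarrow> ('m, 'n) metric \<Rightarrow> 'm set \<Rightarrow> 'm \<Rightarrow> 'm set \<Rightarrow> bool" where
  "exp_locally_in A g H x S \<longleftrightarrow>
     (\<exists>N. nhd_in (hyper_tangent_space A H x) (\<lambda>_. 0) N \<and>
        N \<subseteq> exp_domain A g x \<and> exp_map A g x ` N \<subseteq> S)"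

definition locally_convex ::
  "('m::t2_space, 'n::finite) chart set \<Rightarrow> ('m, 'n) metric \<Rightarrow> 'm set \<Rightarrow> 'm set \<Rightarrow> bool" where
  "locally_convex A g H U \<longleftrightarrow>
     (\<exists>V \<phi>. defining_function A H U V \<phi> \<and>
        ((\<forall>x\<in>U. exp_locally_in A g H x {y\<in>V. \<phi> y \<le> 0}) \<or>
         (\<forall>x\<in>U. exp_locally_in A g H x {y\<in>V. \<phi> y \<ge> 0})))"

end

theory Submission
  imports Defs
begin

text \<open>Inside \<open>V\<close> the hypersurface is the level set \<open>\<phi> = 0\<close>, and along a geodesic \<open>\<gamma>\<close> the second
  derivative of \<open>\<phi> \<circ> \<gamma>\<close> is the Hessian of \<open>\<phi>\<close> on \<open>\<gamma>'\<close>. If the geodesics tangent to \<open>H\<close> stay on one side,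
  then \<open>\<phi> \<circ> \<gamma>\<close> has an extremum at \<open>0\<close>, so the Hessian is semidefinite on the tangent space.

  Conversely, the Hessian of \<open>\<phi>\<close> is merely continuous, so its sign on \<open>H\<close> says nothing quantitative
  about its values at the points of \<open>\<gamma>\<close>, which lie off \<open>H\<close>. Instead, \<open>\<gamma>\<close> is moved back to \<open>H\<close> in a chart by
  a translation: \<open>\<beta> = \<gamma> - r e\<close>, where \<open>e\<close> is a fixed vector transverse to \<open>H\<close> and \<open>r\<close> is a real function.
  Differentiating \<open>\<phi> (\<beta>) = 0\<close> twice expresses \<open>r''\<close> by the Hessian on the tangent vector \<open>\<beta>'\<close> of \<open>H\<close>
  and by the difference of the Christoffel terms at \<open>\<beta>\<close> and \<open>\<gamma>\<close>. The latter is Lipschitz, whence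
  \<open>r'' \<le> C (\<bar>r\<bar> + \<bar>r'\<bar>)\<close> with \<open>r\<close> and \<open>r'\<close> vanishing at \<open>0\<close>, and this forces \<open>r \<le> 0\<close> for a short time.\<close>

section \<open>Locally Lipschitz functions\<close>

text \<open>A constant coordinate vector \<open>e\<close> takes over: being constant, it adds only a
  multiple of \<open>e\<close> to the second derivative of \<beta>. Local convexity asks for a whole
  neighbourhood of 0 in the tangent space. Hence radii and times have to be uniform in the initial
  velocity; homogeneity of the geodesic equation then trades a short time for a small velocity at
  time 1. The value of \<open>exp\<close> is singled out by uniqueness among curves that solve the
  geodesic equation in every chart. This calls for uniqueness across charts and for covariance of
  the equation under transition maps of class C^2. Both implications hold for one and the same
  defining function; a factor \<sigma> equal to 1 or -1 covers both sides at once.\<close>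

definition loc_lip :: "'a::metric_space set \<Rightarrow> ('a \<Rightarrow> 'b::metric_space) \<Rightarrow> bool" where
  "loc_lip S f \<longleftrightarrow> (\<forall>x\<in>S. \<exists>r>0. \<exists>L. L-lipschitz_on (S \<inter> ball x r) f)"

lemma loc_lip_common:
  assumes "loc_lip S f" "loc_lip S g" "x \<in> S"
  obtains r L M where "r > 0" "L-lipschitz_on (S \<inter> ball x r) f" "M-lipschitz_on (S \<inter> ball x r) g"
proof -
  obtain r L where r: "r > 0" "L-lipschitz_on (S \<inter> ball x r) f"
    using assms unfolding loc_lip_def by blast
  obtain q M where q: "q > 0" "M-lipschitz_on (S \<inter> ball x q) g"
    using assms unfolding loc_lip_def by blast
  show thesis
  proof
    show "min r q > 0" using r q by simp
    show "L-lipschitz_on (S \<inter> ball x (min r q)) f"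
      by (rule lipschitz_on_subset[OF r(2)]) auto
    show "M-lipschitz_on (S \<inter> ball x (min r q)) g"
      by (rule lipschitz_on_subset[OF q(2)]) auto
  qed
qed

lemma loc_lip_const: "loc_lip S (\<lambda>x. c)"
  unfolding loc_lip_def using lipschitz_on_constant zero_less_one by blast

lemma lipschitz_imp_loc_lip: "L-lipschitz_on S f \<Longrightarrow> loc_lip S f"
  unfolding loc_lip_def by (meson inf_le1 lipschitz_on_subset zero_less_one)

lemma loc_lip_subset:
  assumes "loc_lip S f" "T \<subseteq> S"
  shows "loc_lip T f"
  unfolding loc_lip_def
proof
  fix x assume "x \<in> T"
  then obtain r L where "r > 0" "L-lipschitz_on (S \<inter> ball x r) f"
    using assms unfolding loc_lip_def by blast
  then show "\<exists>r>0. \<exists>L. L-lipschitz_on (T \<inter> ball x r) f"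
    using assms(2) lipschitz_on_subset[of L "S \<inter> ball x r" f "T \<inter> ball x r"] by blast
qed

lemma loc_lip_cong: "(\<And>x. x \<in> S \<Longrightarrow> f x = g x) \<Longrightarrow> loc_lip S f \<longleftrightarrow> loc_lip S g"
  unfolding loc_lip_def by (intro ball_cong ex_cong1 conj_cong refl lipschitz_on_cong) auto

lemma loc_lip_add:
  fixes f g :: "'a::metric_space \<Rightarrow> 'b::real_normed_vector"
  assumes "loc_lip S f" "loc_lip S g"
  shows "loc_lip S (\<lambda>x. f x + g x)"
  unfolding loc_lip_def
proof
  fix x assume "x \<in> S"
  then obtain r L M where "r > 0" "L-lipschitz_on (S \<inter> ball x r) f" "M-lipschitz_on (S \<inter> ball x r) g"
    using loc_lip_common[OF assms] by blast
  then show "\<exists>r>0. \<exists>L. L-lipschitz_on (S \<inter> ball x r) (\<lambda>x. f x + g x)"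
    using lipschitz_on_add by blast
qed

lemma loc_lip_minus:
  fixes f :: "'a::metric_space \<Rightarrow> 'b::real_normed_vector"
  shows "loc_lip S f \<Longrightarrow> loc_lip S (\<lambda>x. - f x)"
  unfolding loc_lip_def by simp

lemma loc_lip_diff:
  fixes f g :: "'a::metric_space \<Rightarrow> 'b::real_normed_vector"
  shows "loc_lip S f \<Longrightarrow> loc_lip S g \<Longrightarrow> loc_lip S (\<lambda>x. f x - g x)"
  using loc_lip_add[of S f "\<lambda>x. - g x"] loc_lip_minus[of S g] by simp

lemma loc_lip_sum:
  fixes f :: "'i \<Rightarrow> 'a::metric_space \<Rightarrow> 'b::real_normed_vector"
  assumes "\<And>i. i \<in> I \<Longrightarrow> loc_lip S (f i)"
  shows "loc_lip S (\<lambda>x. \<Sum>i\<in>I. f i x)"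
  using assms by (induction I rule: infinite_finite_induct) (auto intro: loc_lip_const loc_lip_add)

lemma lipschitz_on_bound_near:
  fixes f :: "'a::metric_space \<Rightarrow> 'b::real_normed_vector"
  assumes "L-lipschitz_on (S \<inter> ball x r) f" "x \<in> S" "y \<in> S \<inter> ball x r"
  shows "norm (f y) \<le> norm (f x) + L * r"
proof -
  have "r > 0" using assms(3) zero_le_dist[of x y] by (metis IntE mem_ball order_le_less_trans)
  then have "norm (f y - f x) \<le> L * dist y x"
    using lipschitz_onD[OF assms(1), of y x] assms by (simp add: dist_norm)
  also have "\<dots> \<le> L * r"
    using assms lipschitz_on_nonneg[OF assms(1)] by (auto intro!: mult_left_mono simp: dist_commute)
  finally show ?thesis using norm_triangle_sub[of "f y" "f x"] by simp
qed

text \<open>A product needs bounds on its factors, and a Lipschitz function is bounded on a ball of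
  finite radius. This is why the local notion is closed under products, and with them under
  determinants.\<close>

lemma loc_lip_mult:
  fixes f g :: "'a::metric_space \<Rightarrow> real"
  assumes "loc_lip S f" "loc_lip S g"
  shows "loc_lip S (\<lambda>x. f x * g x)"
  unfolding loc_lip_def
proof
  fix x assume x: "x \<in> S"
  then obtain r L M where r: "r > 0" and L: "L-lipschitz_on (S \<inter> ball x r) f"
    and M: "M-lipschitz_on (S \<inter> ball x r) g"
    using loc_lip_common[OF assms] by blast
  define a where "a = norm (f x) + L * r"
  define b where "b = norm (g x) + M * r"
  have pos: "0 \<le> a" "0 \<le> b" "0 \<le> L" "0 \<le> M"
    using lipschitz_on_nonneg[OF L] lipschitz_on_nonneg[OF M] r by (auto simp: a_def b_def)
  have "(a * M + b * L)-lipschitz_on (S \<inter> ball x r) (\<lambda>x. f x * g x)"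
  proof (rule lipschitz_onI)
    fix u v assume u: "u \<in> S \<inter> ball x r" and v: "v \<in> S \<inter> ball x r"
    have fu: "\<bar>f u\<bar> \<le> a" and gv: "\<bar>g v\<bar> \<le> b"
      using lipschitz_on_bound_near[OF L x u] lipschitz_on_bound_near[OF M x v]
      by (auto simp: a_def b_def)
    have "f u * g u - f v * g v = f u * (g u - g v) + g v * (f u - f v)" by algebra
    also have "\<bar>\<dots>\<bar> \<le> \<bar>f u\<bar> * \<bar>g u - g v\<bar> + \<bar>g v\<bar> * \<bar>f u - f v\<bar>"
      by (metis abs_mult abs_triangle_ineq)
    also have "\<dots> \<le> a * (M * dist u v) + b * (L * dist u v)"
      using lipschitz_onD[OF L u v] lipschitz_onD[OF M u v] fu gv pos
      by (intro add_mono mult_mono) (auto simp: dist_real_def)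
    finally show "dist (f u * g u) (f v * g v) \<le> (a * M + b * L) * dist u v"
      by (simp add: dist_real_def algebra_simps)
  qed (use pos in auto)
  with r show "\<exists>r>0. \<exists>L. L-lipschitz_on (S \<inter> ball x r) (\<lambda>x. f x * g x)" by blast
qed

lemma loc_lip_prod:
  fixes f :: "'i \<Rightarrow> 'a::metric_space \<Rightarrow> real"
  assumes "\<And>i. i \<in> I \<Longrightarrow> loc_lip S (f i)"
  shows "loc_lip S (\<lambda>x. \<Prod>i\<in>I. f i x)"
  using assms by (induction I rule: infinite_finite_induct) (auto intro: loc_lip_const loc_lip_mult)

lemma loc_lip_imp_continuous_on: "loc_lip S f \<Longrightarrow> continuous_on S f"
proof -
  assume f: "loc_lip S f"
  show ?thesis
  proof (rule continuous_on_eq_continuous_within[THEN iffD2], rule ballI)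
    fix x assume x: "x \<in> S"
    then obtain r L where r: "r > 0" "L-lipschitz_on (S \<inter> ball x r) f"
      using f unfolding loc_lip_def by blast
    then have "continuous (at x within (S \<inter> ball x r)) f"
      using lipschitz_on_continuous_within x by (metis Int_iff centre_in_ball)
    then show "continuous (at x within S) f"
      using at_within_nhd[of x "ball x r" "S \<inter> ball x r" S] r x by (simp add: inf.assoc)
  qed
qed

lemma loc_lip_inverse:
  fixes f :: "'a::metric_space \<Rightarrow> real"
  assumes f: "loc_lip S f" and nz: "\<And>x. x \<in> S \<Longrightarrow> f x \<noteq> 0"
  shows "loc_lip S (\<lambda>x. inverse (f x))"
  unfolding loc_lip_def
proof
  fix x assume x: "x \<in> S"
  then obtain r L where r: "r > 0" and L: "L-lipschitz_on (S \<inter> ball x r) f"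
    using f unfolding loc_lip_def by blast
  \<comment> \<open>By continuity \<bar>f\<bar> stays above half its central value on a smaller
    ball, where taking inverses multiplies the Lipschitz constant by at most
    \<open>1 / m^2\<close>.\<close>
  define m where "m = \<bar>f x\<bar> / 2"
  have m: "m > 0" using nz[OF x] by (simp add: m_def)
  have "continuous (at x within S) f"
    using loc_lip_imp_continuous_on[OF f] x by (simp add: continuous_on_eq_continuous_within)
  then obtain d where d: "d > 0" "\<And>y. y \<in> S \<Longrightarrow> dist y x < d \<Longrightarrow> dist (f y) (f x) < m"
    using m unfolding continuous_within_eps_delta by blast
  define q where "q = min r d"
  have q: "q > 0" using r d by (simp add: q_def)
  have low: "m \<le> \<bar>f y\<bar>" if "y \<in> S \<inter> ball x q" for y
    using d(2)[of y] that abs_triangle_ineq2[of "f x" "f y"]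
    by (auto simp: q_def dist_commute dist_real_def m_def)
  have "(L / m^2)-lipschitz_on (S \<inter> ball x q) (\<lambda>x. inverse (f x))"
  proof (rule lipschitz_onI)
    fix u v assume u: "u \<in> S \<inter> ball x q" and v: "v \<in> S \<inter> ball x q"
    have "\<bar>inverse (f u) - inverse (f v)\<bar> = \<bar>f v - f u\<bar> / (\<bar>f u\<bar> * \<bar>f v\<bar>)"
    proof -
      have "inverse (f u) - inverse (f v) = (f v - f u) / (f u * f v)"
        using nz u v by (simp add: field_simps)
      then show ?thesis by (simp add: abs_mult)
    qed
    also have "\<dots> \<le> (L * dist u v) / (m * m)"
      using lipschitz_onD[OF L, of u v] low[OF u] low[OF v] m u v lipschitz_on_nonneg[OF L]
      by (intro frac_le mult_mono) (auto simp: q_def dist_real_def abs_minus_commute)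
    finally show "dist (inverse (f u)) (inverse (f v)) \<le> L / m^2 * dist u v"
      by (simp add: dist_real_def power2_eq_square)
  qed (use lipschitz_on_nonneg[OF L] in auto)
  with q show "\<exists>r>0. \<exists>L. L-lipschitz_on (S \<inter> ball x r) (\<lambda>x. inverse (f x))" by blast
qed

lemma loc_lip_compose:
  assumes f: "loc_lip S f" and g: "loc_lip T g" and sub: "f ` S \<subseteq> T"
  shows "loc_lip S (\<lambda>x. g (f x))"
  unfolding loc_lip_def
proof
  fix x assume x: "x \<in> S"
  then obtain r L where r: "r > 0" and L: "L-lipschitz_on (S \<inter> ball x r) f"
    using f unfolding loc_lip_def by blast
  obtain q M where q: "q > 0" and M: "M-lipschitz_on (T \<inter> ball (f x) q) g"
    using g sub x unfolding loc_lip_def by blast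
  have "continuous (at x within S) f"
    using loc_lip_imp_continuous_on[OF f] x by (simp add: continuous_on_eq_continuous_within)
  then obtain d where d: "d > 0" "\<And>y. y \<in> S \<Longrightarrow> dist y x < d \<Longrightarrow> dist (f y) (f x) < q"
    using q unfolding continuous_within_eps_delta by blast
  have "(M * L)-lipschitz_on (S \<inter> ball x (min r d)) (\<lambda>x. g (f x))"
  proof (rule lipschitz_on_compose2[where f=f and g=g])
    show "L-lipschitz_on (S \<inter> ball x (min r d)) f"
      by (rule lipschitz_on_subset[OF L]) auto
    show "M-lipschitz_on (f ` (S \<inter> ball x (min r d))) g"
      by (rule lipschitz_on_subset[OF M]) (use sub d(2) in \<open>auto simp: dist_commute\<close>)
  qed
  with r d show "\<exists>r>0. \<exists>L. L-lipschitz_on (S \<inter> ball x r) (\<lambda>x. g (f x))"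
    by (meson min_less_iff_conj)
qed

section \<open>Vectors, determinants and inverse matrices\<close>

lemma loc_lip_vec:
  fixes f :: "'a::metric_space \<Rightarrow> real^'n"
  assumes "\<And>i. loc_lip S (\<lambda>x. f x $ i)"
  shows "loc_lip S f"
proof -
  have eq: "(\<lambda>x. \<Sum>i\<in>UNIV. f x $ i *\<^sub>R axis i 1) = f"
    by (simp add: basis_expansion fun_eq_iff flip: scalar_mult_eq_scaleR)
  have "loc_lip S (\<lambda>x. f x $ i *\<^sub>R (axis i 1::real^'n))" for i
  proof (rule loc_lip_compose[OF assms[of i], of UNIV])
    have "1-lipschitz_on UNIV (\<lambda>y. y *\<^sub>R (axis i 1::real^'n))"
      by (rule lipschitz_onI) (auto simp: dist_norm simp flip: scaleR_diff_left)
    then show "loc_lip UNIV (\<lambda>y. y *\<^sub>R (axis i 1::real^'n))" by (rule lipschitz_imp_loc_lip)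
  qed auto
  then have "loc_lip S (\<lambda>x. \<Sum>i\<in>UNIV. f x $ i *\<^sub>R (axis i 1::real^'n))" by (rule loc_lip_sum)
  then show ?thesis unfolding eq .
qed

lemma loc_lip_det:
  fixes f :: "'a::metric_space \<Rightarrow> real^'n^'n"
  assumes "\<And>i j. loc_lip S (\<lambda>x. f x $ i $ j)"
  shows "loc_lip S (\<lambda>x. det (f x))"
  unfolding det_def by (intro loc_lip_sum loc_lip_mult loc_lip_const loc_lip_prod assms)

text \<open>Cramer's rule turns each entry of the inverse into a rational function of the entries of
  \<open>A\<close> with denominator \<open>det A\<close>, so that regularity of the inverse follows
  from that of products and reciprocals.\<close>

lemma matrix_inv_cramer:
  fixes A :: "real^'n^'n"
  assumes "invertible A"
  shows "matrix_inv A $ l $ m =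
    det (\<chi> i j. if j = l then axis m 1 $ i else A $ i $ j) / det A"
proof -
  have "A ** matrix_inv A = mat 1"
    using assms unfolding invertible_def matrix_inv_def by (metis (mono_tags, lifting) someI_ex)
  then have "A *v (matrix_inv A *v axis m 1) = axis m 1"
    by (simp add: matrix_vector_mul_assoc)
  then have "matrix_inv A *v axis m 1 = (\<chi> k. det (\<chi> i j. if j = k then axis m 1 $ i else A $ i $ j) / det A)"
    using cramer invertible_det_nz assms by blast
  then have "(matrix_inv A *v axis m 1) $ l = det (\<chi> i j. if j = l then axis m 1 $ i else A $ i $ j) / det A"
    by simp
  then show ?thesis by (simp add: matrix_vector_mult_basis column_def)
qed

lemma loc_lip_matrix_inv:
  fixes f :: "'a::metric_space \<Rightarrow> real^'n^'n"
  assumes f: "\<And>i j. loc_lip S (\<lambda>x. f x $ i $ j)" and inv: "\<And>x. x \<in> S \<Longrightarrow> invertible (f x)"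
  shows "loc_lip S (\<lambda>x. matrix_inv (f x) $ l $ m)"
proof -
  have "loc_lip S (\<lambda>x. det (\<chi> i j. if j = l then axis m 1 $ i else f x $ i $ j) * inverse (det (f x)))"
  proof (intro loc_lip_mult loc_lip_inverse loc_lip_det f)
    show "loc_lip S (\<lambda>x. (\<chi> i j. if j = l then axis m 1 $ i else f x $ i $ j) $ i $ j)" for i j
      using f loc_lip_const by (cases "j = l") auto
  qed (use inv invertible_det_nz in blast)
  then show ?thesis
    using inv matrix_inv_cramer[of "f _" l m]
    by (subst loc_lip_cong[where g="\<lambda>x. det (\<chi> i j. if j = l then axis m 1 $ i else f x $ i $ j) * inverse (det (f x))"])
       (auto simp: divide_inverse)
qed

section \<open>Ordinary differential equations\<close>

text \<open>Picard iteration is carried out for the globally Lipschitz vector field obtained by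
  composing \<open>f\<close> with the projection to the ball.\<close>

theorem picard_lindelof_uniform:
  fixes f :: "'a::euclidean_space \<Rightarrow> 'a"
  assumes R: "R > 0" and f: "L-lipschitz_on (cball x0 R) f"
  obtains \<delta> where "\<delta> > 0"
    and "\<And>x1. x1 \<in> cball x0 (R / 2) \<Longrightarrow> \<exists>u. u 0 = x1 \<and>
      (\<forall>t\<in>{-\<delta><..<\<delta>}. u t \<in> cball x0 R \<and> (u has_vector_derivative f (u t)) (at t))"
proof -
  define P where "P = closest_point (cball x0 R)"
  define F where "F = (\<lambda>x. f (P x))"
  have ne: "cball x0 R \<noteq> {}" "convex (cball x0 R)" "closed (cball x0 R)" using R by auto
  have P_in: "P x \<in> cball x0 R" for x
    unfolding P_def using closest_point_in_set ne by metis
  have L0: "L \<ge> 0" using f lipschitz_on_nonneg by blast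
  have F_lip: "dist (F x) (F y) \<le> L * dist x y" for x y
  proof -
    have "dist (F x) (F y) \<le> L * dist (P x) (P y)"
      unfolding F_def by (rule lipschitz_onD[OF f P_in P_in])
    also have "\<dots> \<le> L * dist x y"
      unfolding P_def using L0 closest_point_lipschitz[OF ne(2,3,1)] by (intro mult_left_mono) auto
    finally show ?thesis .
  qed
  have F_cont: "continuous_on UNIV F"
    using F_lip L0 lipschitz_on_continuous_on[of L UNIV F] by (auto simp: lipschitz_on_def)
  define M where "M = norm (f x0) + L * R"
  have FM: "norm (F x) \<le> M" for x
  proof -
    have "norm (F x - f x0) \<le> L * dist (P x) x0"
      using lipschitz_onD[OF f P_in[of x], of x0] R by (simp add: F_def dist_norm)
    also have "\<dots> \<le> L * R" using P_in[of x] L0 by (intro mult_left_mono) (auto simp: dist_commute)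
    finally show ?thesis unfolding M_def using norm_triangle_sub[of "F x" "f x0"] by simp
  qed
  have M0: "M \<ge> 0" using FM norm_ge_zero order_trans by blast
  \<comment> \<open>The first bound makes the Picard operator a contraction with factor 1/2, the
    second keeps its values within \<open>R / 2\<close> of the initial point. The factor 3 needed in
    both comes from \<open>K u (cl t)\<close>, an integral over time at most
    \<open>2 * \<delta>\<close>, and \<open>K u 0\<close>, one over time \<delta>. Adding 1 to
    \<open>L\<close> and \<open>M\<close> avoids division by zero.\<close>
  define \<delta> where "\<delta> = min (1 / (6 * (L + 1))) (R / (6 * (M + 1)))"
  have \<delta>: "\<delta> > 0" using L0 M0 R by (simp add: \<delta>_def)
  have \<delta>L: "3 * \<delta> * L \<le> 1/2"
  proof -
    have "\<delta> * L \<le> (1 / (6 * (L + 1))) * (L + 1)" using L0 \<delta> by (intro mult_mono) (auto simp: \<delta>_def)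
    also have "\<dots> = 1/6" using L0 by (simp add: field_simps)
    finally show ?thesis by simp
  qed
  have \<delta>M: "3 * \<delta> * M \<le> R / 2"
  proof -
    have "\<delta> * M \<le> (R / (6 * (M + 1))) * (M + 1)" using M0 \<delta> R by (intro mult_mono) (auto simp: \<delta>_def)
    also have "\<dots> = R/6" using M0 by (simp add: field_simps)
    finally show ?thesis by simp
  qed
  \<comment> \<open>Freezing the time outside the interval lets the Picard operator act on bounded
    continuous functions on the whole line, a complete space.\<close>
  define cl where "cl = (\<lambda>t::real. max (-\<delta>) (min \<delta> t))"
  have cl: "cl t \<in> {-\<delta>..\<delta>}" for t using \<delta> by (auto simp: cl_def)
  have cl_cont: "continuous_on UNIV cl" unfolding cl_def by (intro continuous_intros)
  show thesis
  proof (rule that[OF \<delta>])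
    fix x1 assume x1: "x1 \<in> cball x0 (R / 2)"
    \<comment> \<open>The integral starts at \<open>-\<delta>\<close> since an integral over
      \<open>{0..s}\<close> would be 0 for negative \<open>s\<close>; subtracting
      \<open>K u 0\<close> in \<open>T\<close> moves the base point back to time 0.\<close>
    define K where "K = (\<lambda>u s. integral {-\<delta>..s} (\<lambda>t. F (u t)))"
    define T where "T = (\<lambda>u t. x1 + K u (cl t) - K u 0)"
    have int: "(\<lambda>t. F (u t)) integrable_on {-\<delta>..s}" if "continuous_on UNIV u" for u s
      using that F_cont continuous_on_compose2[of UNIV F UNIV u]
      by (intro integrable_continuous_real) (meson continuous_on_subset subset_UNIV top_greatest)
    have Kb: "norm (K u s) \<le> M * (2 * \<delta>)" if "continuous_on UNIV u" "s \<in> {-\<delta>..\<delta>}" for u s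
    proof -
      have "norm (K u s) \<le> M * (s - (-\<delta>))"
        unfolding K_def using that int[OF that(1), of s] FM F_cont
        by (intro integral_bound) (auto intro!: continuous_on_compose2[OF F_cont] continuous_on_subset[OF that(1)])
      also have "\<dots> \<le> M * (2 * \<delta>)" using that M0 by (intro mult_left_mono) auto
      finally show ?thesis .
    qed
    have K0b: "norm (K u 0) \<le> M * \<delta>" if "continuous_on UNIV u" for u
    proof -
      have "norm (K u 0) \<le> M * (0 - (-\<delta>))"
        unfolding K_def using that int[OF that(1), of 0] FM F_cont \<delta>
        by (intro integral_bound) (auto intro!: continuous_on_compose2[OF F_cont] continuous_on_subset[OF that(1)])
      then show ?thesis by simp
    qed
    have Tb: "norm (T u t - x1) \<le> R / 2" if "continuous_on UNIV u" for u t
      using Kb[OF that cl, of t] K0b[OF that] norm_triangle_ineq4[of "K u (cl t)" "K u 0"] \<delta>M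
      by (simp add: T_def algebra_simps)
    have KD: "(K u has_vector_derivative F (u s)) (at s within {-\<delta>..\<delta>})"
      if "continuous_on UNIV u" "s \<in> {-\<delta>..\<delta>}" for u s
      unfolding K_def using that
      by (intro integral_has_vector_derivative)
         (auto intro!: continuous_on_compose2[OF F_cont] continuous_on_subset[OF that(1)])
    have Tcont: "continuous_on UNIV (T u)" if "continuous_on UNIV u" for u
    proof -
      have "continuous_on {-\<delta>..\<delta>} (K u)"
        using KD[OF that] has_vector_derivative_continuous continuous_on_eq_continuous_within by blast
      then have "continuous_on UNIV (\<lambda>t. K u (cl t))"
        using continuous_on_compose2[of "{-\<delta>..\<delta>}" "K u" UNIV cl] cl_cont cl by blast
      then show ?thesis unfolding T_def by (intro continuous_intros)
    qed
    have Tbc: "T u \<in> bcontfun" if "continuous_on UNIV u" for u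
    proof (rule bcontfun_normI[OF Tcont[OF that], of "norm x1 + R/2"])
      show "norm (T u t) \<le> norm x1 + R / 2" for t
        using Tb[OF that, of t] norm_triangle_sub[of "T u t" x1] by simp
    qed
    define G where "G = (\<lambda>w :: real \<Rightarrow>\<^sub>C 'a. Bcontfun (T (apply_bcontfun w)))"
    have Gapp: "apply_bcontfun (G w) = T (apply_bcontfun w)" for w
      unfolding G_def using Tbc[of "apply_bcontfun w"] by (simp add: Bcontfun_inverse)
    have "\<exists>!w. G w = w"
    proof (rule banach_fix_type[of "1/2"])
      show "\<forall>v w. dist (G v) (G w) \<le> 1/2 * dist v w"
      proof (intro allI)
        fix v w :: "real \<Rightarrow>\<^sub>C 'a"
        have cv: "continuous_on UNIV (apply_bcontfun v)" "continuous_on UNIV (apply_bcontfun w)"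
          by auto
        have Kd: "norm (K v s - K w s) \<le> L * dist v w * (s + \<delta>)" if "s \<in> {-\<delta>..\<delta>}" for s
        proof -
          have "K v s - K w s = integral {-\<delta>..s} (\<lambda>t. F (v t) - F (w t))"
            unfolding K_def using int cv by (subst integral_diff) auto
          also have "norm \<dots> \<le> L * dist v w * (s - (-\<delta>))"
          proof (rule integral_bound)
            show "continuous_on {-\<delta>..s} (\<lambda>t. F (v t) - F (w t))"
              by (intro continuous_intros continuous_on_compose2[OF F_cont] continuous_on_subset[OF cv(1)]
                   continuous_on_subset[OF cv(2)]) auto
            fix t assume "t \<in> {-\<delta>..s}"
            have "norm (F (v t) - F (w t)) \<le> L * dist (v t) (w t)"
              using F_lip[of "v t" "w t"] by (simp add: dist_norm)
            also have "\<dots> \<le> L * dist v w" using L0 dist_bounded[of v t w] by (intro mult_left_mono) auto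
            finally show "norm (F (v t) - F (w t)) \<le> L * dist v w" .
          qed (use that in auto)
          finally show ?thesis by simp
        qed
        show "dist (G v) (G w) \<le> 1/2 * dist v w"
        proof (rule dist_bound)
          fix t
          have "dist (G v t) (G w t) = norm ((K v (cl t) - K w (cl t)) - (K v 0 - K w 0))"
            unfolding Gapp T_def dist_norm by (simp add: algebra_simps)
          also have "\<dots> \<le> norm (K v (cl t) - K w (cl t)) + norm (K v 0 - K w 0)"
            by (rule norm_triangle_ineq4)
          also have "\<dots> \<le> L * dist v w * (cl t + \<delta>) + L * dist v w * (0 + \<delta>)"
            using Kd[OF cl[of t]] Kd[of 0] \<delta> by (intro add_mono) auto
          also have "\<dots> \<le> L * dist v w * (2 * \<delta>) + L * dist v w * \<delta>"
            using cl[of t] L0 by (intro add_mono mult_left_mono) auto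
          also have "\<dots> = (3 * \<delta> * L) * dist v w" by (simp add: algebra_simps)
          also have "\<dots> \<le> 1/2 * dist v w" using \<delta>L by (intro mult_right_mono) auto
          finally show "dist (G v t) (G w t) \<le> 1/2 * dist v w" .
        qed
      qed
    qed auto
    then obtain w where w: "G w = w" by blast
    define u where "u = apply_bcontfun w"
    have uT: "u t = T u t" for t using Gapp[of w] w by (metis u_def)
    have uc: "continuous_on UNIV u" by (simp add: u_def)
    have ux: "dist x1 (u t) \<le> R/2" for t using Tb[OF uc, of t] uT[of t] by (simp add: dist_norm norm_minus_commute)
    \<comment> \<open>The solution moves by at most \<open>R / 2\<close> from a point of the half
      ball, so it never leaves the ball and the projection acts on it as the identity.\<close>
    have u_in: "u t \<in> cball x0 R" for t
      using ux[of t] x1 dist_triangle[of x0 "u t" x1] by simp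
    have Fu: "F (u t) = f (u t)" for t
      unfolding F_def P_def using closest_point_self[OF u_in[of t]] by simp
    show "\<exists>u. u 0 = x1 \<and>
      (\<forall>t\<in>{-\<delta><..<\<delta>}. u t \<in> cball x0 R \<and> (u has_vector_derivative f (u t)) (at t))"
    proof (intro exI[of _ u] conjI ballI u_in)
      have "cl 0 = 0" using \<delta> by (simp add: cl_def)
      then show "u 0 = x1" using uT[of 0] by (simp add: T_def)
      fix t assume t: "t \<in> {-\<delta><..<\<delta>}"
      have "(K u has_vector_derivative F (u t)) (at t within {-\<delta><..<\<delta>})"
        using KD[OF uc, of t] t by (auto intro: has_vector_derivative_within_subset)
      then have "((\<lambda>s. x1 + K u s - K u 0) has_vector_derivative F (u t)) (at t within {-\<delta><..<\<delta>})"
        by (auto intro!: derivative_eq_intros)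
      then have "(u has_vector_derivative F (u t)) (at t within {-\<delta><..<\<delta>})"
        by (rule has_vector_derivative_transform[rotated 2]) (use t in \<open>auto simp: uT[of _] T_def cl_def\<close>)
      then show "(u has_vector_derivative f (u t)) (at t)"
        using t by (simp only: Fu at_within_open[of t] open_greaterThanLessThan)
    qed
  qed
qed

text \<open>The derivative of the squared norm is at most \<open>2 * L\<close> times the squared
  norm in absolute value. The weight \<open>exp (-2 * L * t)\<close> therefore makes it
  nonincreasing after \<open>t0\<close>, and \<open>exp (2 * L * t)\<close> makes it nondecreasing
  before \<open>t0\<close>; squaring avoids differentiating the norm at zeros of
  \<open>w\<close>.\<close>

lemma gronwall_zero:
  fixes w w' :: "real \<Rightarrow> 'a::real_inner"
  assumes w: "\<And>t. t \<in> {a<..<b} \<Longrightarrow> (w has_vector_derivative w' t) (at t)"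
    and bound: "\<And>t. t \<in> {a<..<b} \<Longrightarrow> norm (w' t) \<le> L * norm (w t)"
    and t0: "t0 \<in> {a<..<b}" "w t0 = 0" and t: "t \<in> {a<..<b}"
  shows "w t = 0"
proof -
  have W: "((\<lambda>t. w t \<bullet> w t) has_real_derivative 2 * (w s \<bullet> w' s)) (at s)" if "s \<in> {a<..<b}" for s
    unfolding has_real_derivative_iff_has_vector_derivative
    using w[OF that] unfolding has_vector_derivative_def
    by (auto intro!: derivative_eq_intros simp: fun_eq_iff algebra_simps inner_commute)
  have b: "\<bar>w s \<bullet> w' s\<bar> \<le> L * (w s \<bullet> w s)" if "s \<in> {a<..<b}" for s
  proof -
    have "\<bar>w s \<bullet> w' s\<bar> \<le> norm (w s) * norm (w' s)" by (rule Cauchy_Schwarz_ineq2)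
    also have "\<dots> \<le> norm (w s) * (L * norm (w s))" using bound[OF that] by (intro mult_left_mono) auto
    finally show ?thesis by (simp add: power2_norm_eq_inner[symmetric] power2_eq_square mult_ac)
  qed
  have "w t \<bullet> w t \<le> 0"
  proof (cases "t0 \<le> t")
    case True
    have "exp (-2 * L * t) * (w t \<bullet> w t) \<le> exp (-2 * L * t0) * (w t0 \<bullet> w t0)"
    proof (rule DERIV_nonpos_imp_nonincreasing[OF True])
      fix s assume "t0 \<le> s" "s \<le> t"
      then have s: "s \<in> {a<..<b}" using t0 t by auto
      have "((\<lambda>s. exp (-2 * L * s) * (w s \<bullet> w s)) has_real_derivative
          exp (-2 * L * s) * (2 * (w s \<bullet> w' s) - 2 * (L * (w s \<bullet> w s)))) (at s)"
        by (auto intro!: derivative_eq_intros W[OF s] simp: algebra_simps)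
      moreover have "exp (-2 * L * s) * (2 * (w s \<bullet> w' s) - 2 * (L * (w s \<bullet> w s))) \<le> 0"
        using b[OF s] by (intro mult_nonneg_nonpos) auto
      ultimately show "\<exists>y. ((\<lambda>s. exp (-2 * L * s) * (w s \<bullet> w s)) has_real_derivative y) (at s) \<and> y \<le> 0"
        by blast
    qed
    then show ?thesis using t0 by (simp add: mult_le_0_iff not_le order.strict_implies_not_eq)
  next
    case False
    then have "t \<le> t0" by simp
    then have "exp (2 * L * t) * (w t \<bullet> w t) \<le> exp (2 * L * t0) * (w t0 \<bullet> w t0)"
    proof (rule DERIV_nonneg_imp_nondecreasing)
      fix s assume "t \<le> s" "s \<le> t0"
      then have s: "s \<in> {a<..<b}" using t0 t by auto
      have "((\<lambda>s. exp (2 * L * s) * (w s \<bullet> w s)) has_real_derivative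
          exp (2 * L * s) * (2 * (w s \<bullet> w' s) + 2 * (L * (w s \<bullet> w s)))) (at s)"
        by (auto intro!: derivative_eq_intros W[OF s] simp: algebra_simps)
      moreover have "exp (2 * L * s) * (2 * (w s \<bullet> w' s) + 2 * (L * (w s \<bullet> w s))) \<ge> 0"
        using b[OF s] by (intro mult_nonneg_nonneg) auto
      ultimately show "\<exists>y. ((\<lambda>s. exp (2 * L * s) * (w s \<bullet> w s)) has_real_derivative y) (at s) \<and> 0 \<le> y"
        by blast
    qed
    then show ?thesis using t0 by (simp add: mult_le_0_iff not_le order.strict_implies_not_eq)
  qed
  then show ?thesis by (metis inner_eq_zero_iff inner_ge_zero order_antisym)
qed

text \<open>A function that falls to a minimum \<open>- m\<close> cannot climb back to \<open>0\<close> in a short time, since its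
  velocity then stays of the order of \<open>m\<close> times the elapsed time.\<close>

lemma nonpos_of_second_derivative_bound:
  fixes r r' r'' :: "real \<Rightarrow> real"
  assumes r: "\<And>t. t \<in> {0..<\<epsilon>} \<Longrightarrow> (r has_real_derivative r' t) (at t)"
    and r': "\<And>t. t \<in> {0..<\<epsilon>} \<Longrightarrow> (r' has_real_derivative r'' t) (at t)"
    and bound: "\<And>t. t \<in> {0..<\<epsilon>} \<Longrightarrow> r'' t \<le> C * (\<bar>r t\<bar> + \<bar>r' t\<bar>)"
    and C: "C \<ge> 0" and small: "\<epsilon> * C * (1 + \<epsilon>) \<le> 1 / 4"
    and init: "r 0 = 0" "r' 0 = 0" and s: "s \<in> {0..<\<epsilon>}"
  shows "r s \<le> 0"
proof (rule ccontr)
  assume "\<not> r s \<le> 0"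
  then have pos: "r s > 0" by simp
  have s0: "0 \<le> s" "s < \<epsilon>" using s by auto
  have contr: "continuous_on {u..v} r" "continuous_on {u..v} r'" if "0 \<le> u" "v < \<epsilon>" for u v
    using that by (auto intro!: continuous_at_imp_continuous_on DERIV_isCont[OF r] DERIV_isCont[OF r'])
  obtain a where a: "a \<in> {0..s}" "\<And>t. t \<in> {0..s} \<Longrightarrow> r a \<le> r t"
    using continuous_attains_inf[of "{0..s}" r] contr[of 0 s] s0 by auto
  define m where "m = - r a"
  have m: "m \<ge> 0" using a(2)[of 0] init s0 by (simp add: m_def)
  have as: "a < s" using a m pos by (cases "a = s") (auto simp: m_def)
  have "r' a = 0"
  proof (cases "a = 0")
    case False
    then have "0 < a" using a by simp
    show ?thesis
    proof (rule DERIV_local_min[of r "r' a" a "min a (s - a)"])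
      show "\<forall>y. \<bar>a - y\<bar> < min a (s - a) \<longrightarrow> r a \<le> r y"
        by (auto simp: abs_less_iff intro!: a(2))
    qed (use r[of a] \<open>0 < a\<close> as s0 in auto)
  qed (use init in simp)
  obtain b where b: "b \<in> {a..s}" "\<And>t. t \<in> {a..s} \<Longrightarrow> r' t \<le> r' b"
    using continuous_attains_sup[of "{a..s}" r'] contr[of a s] s0 a as by auto
  define k where "k = r' b"
  have k: "k \<ge> 0" using b(2)[of a] as \<open>r' a = 0\<close> by (simp add: k_def)
  have up: "r t \<le> - m + k * (t - a)" if t: "t \<in> {a..s}" for t
  proof (cases "t = a")
    case False
    then have "a < t" using that by simp
    obtain z where z: "a < z" "z < t" "r t - r a = (t - a) * r' z"
    proof -
      have "\<And>x. a \<le> x \<Longrightarrow> x \<le> t \<Longrightarrow> (r has_real_derivative r' x) (at x)"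
        using a t s0 by (intro r) auto
      from MVT2[OF \<open>a < t\<close> this] show thesis using that by blast
    qed
    have "r' z \<le> k" using b(2)[of z] z that by (simp add: k_def)
    then have "(t - a) * r' z \<le> (t - a) * k" using \<open>a < t\<close> by (intro mult_left_mono) auto
    then show ?thesis using z by (simp add: m_def algebra_simps)
  qed (simp add: m_def)
  have e0: "\<epsilon> > 0" "s - a \<le> \<epsilon>" using s0 a by auto
  have kb: "k \<le> \<epsilon> * C * (m + k * \<epsilon> + k)"
  proof (cases "k = 0")
    case True
    then show ?thesis using e0 C m by simp
  next
    case False
    \<comment> \<open>The bound on \<open>r''\<close> is one-sided, so \<open>r'\<close> may become
      very negative between \<open>a\<close> and \<open>b\<close>, and then \<bar>r'\<bar> is not
      bounded by \<open>k\<close>. Past the last point \<open>c\<close> with a nonpositive value of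
      \<open>r'\<close>, it lies between 0 and \<open>k\<close>, and climbing from there to
      \<open>k\<close> already costs what is claimed.\<close>
    define Z where "Z = {t \<in> {a..b}. r' t \<le> 0}"
    have "Z = {a..b} \<inter> r' -` {..0}" by (auto simp: Z_def)
    moreover have "closed ({a..b} \<inter> r' -` {..0})"
      using contr[of a b] a b s0 by (intro continuous_closed_preimage) auto
    ultimately have "compact Z"
      by (simp add: compact_eq_bounded_closed bounded_Int)
    moreover have "a \<in> Z" using b \<open>r' a = 0\<close> by (simp add: Z_def)
    ultimately obtain c where c: "c \<in> Z" "\<And>t. t \<in> Z \<Longrightarrow> t \<le> c"
      using compact_attains_sup[of Z] by blast
    have "c < b" using c(1) False k by (cases "c = b") (auto simp: Z_def k_def)
    moreover have "\<And>t. c \<le> t \<Longrightarrow> t \<le> b \<Longrightarrow> (r' has_real_derivative r'' t) (at t)"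
      using c(1) a b s0 by (intro r') (auto simp: Z_def)
    ultimately obtain x where x: "c < x" "x < b" "r' b - r' c = (b - c) * r'' x"
      using MVT2[of c b r' r''] by blast
    have xab: "x \<in> {a..b}" "x \<in> {a..s}" "x \<in> {0..s}" "x \<in> {0..<\<epsilon>}"
      using x c(1) a b s0 by (auto simp: Z_def)
    have "x \<notin> Z" using c(2)[of x] x by auto
    then have "\<bar>r' x\<bar> \<le> k" using xab b(2)[of x] by (auto simp: Z_def k_def)
    moreover have "\<bar>r x\<bar> \<le> m + k * \<epsilon>"
    proof -
      have "k * (x - a) \<le> k * \<epsilon>" using k xab a e0 by (intro mult_left_mono) auto
      then show ?thesis using up[OF xab(2)] a(2)[OF xab(3)] m k e0 by (simp add: m_def abs_le_iff)
    qed
    ultimately have "C * (\<bar>r x\<bar> + \<bar>r' x\<bar>) \<le> C * (m + k * \<epsilon> + k)"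
      using C by (intro mult_left_mono) auto
    then have "r'' x \<le> C * (m + k * \<epsilon> + k)" using bound[OF xab(4)] by linarith
    then have "(b - c) * r'' x \<le> (b - c) * (C * (m + k * \<epsilon> + k))" using \<open>c < b\<close> by (intro mult_left_mono) auto
    also have "\<dots> \<le> \<epsilon> * (C * (m + k * \<epsilon> + k))"
      using c(1) a b s0 C m k e0 by (intro mult_right_mono) (auto simp: Z_def)
    finally show ?thesis using x(3) c(1) by (simp add: k_def Z_def mult.assoc)
  qed
  have eC: "0 \<le> \<epsilon> * C" using e0 C by simp
  \<comment> \<open>In \<open>kb\<close> the terms that contain \<open>k\<close> add up to at most
    \<open>k / 4\<close> and are absorbed on the left. The resulting bound on \<open>k\<close> gives
    \<open>k * \<epsilon> \<le> m\<close>, which is too little to climb from \<open>- m\<close> to a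
    positive value.\<close>
  have "k * (\<epsilon> * C * (1 + \<epsilon>)) \<le> k * (1 / 4)" using small k by (intro mult_left_mono)
  then have k1: "k \<le> 4 / 3 * (\<epsilon> * C * m)" using kb by (simp add: algebra_simps)
  have "\<epsilon> * C * \<epsilon> \<le> 1 / 4" using small eC by (simp add: algebra_simps)
  then have "(\<epsilon> * C * \<epsilon>) * m \<le> 1 / 4 * m" using m by (intro mult_right_mono)
  moreover have "k * \<epsilon> \<le> 4 / 3 * (\<epsilon> * C * m) * \<epsilon>" using k1 e0 by (intro mult_right_mono) auto
  ultimately have "k * \<epsilon> \<le> m" using m by (simp add: algebra_simps)
  moreover have "k * (s - a) \<le> k * \<epsilon>" using e0 k by (intro mult_left_mono)
  moreover have "r s \<le> - m + k * (s - a)" using as by (intro up) simp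
  ultimately show False using pos by linarith
qed

section \<open>Symmetry of second derivatives\<close>

text \<open>Both \<open>F'' z u v\<close> and \<open>F'' z v u\<close> are limits of the second difference quotient.\<close>

lemma second_difference_mvt:
  fixes F :: "'a::real_normed_vector \<Rightarrow> 'b::real_inner"
  assumes d: "\<And>x. x \<in> ball z d \<Longrightarrow> (F has_derivative blinfun_apply (F' x)) (at x)"
    and d2: "\<And>x. x \<in> ball z d \<Longrightarrow> (F' has_derivative blinfun_apply (F'' x)) (at x)"
    and t: "t > 0" "t * (norm u + norm v) < d"
  obtains x where "x \<in> ball z d"
    and "(F (z + t *\<^sub>R u + t *\<^sub>R v) - F (z + t *\<^sub>R u) - F (z + t *\<^sub>R v) + F z) \<bullet> w
       = t\<^sup>2 * (blinfun_apply (blinfun_apply (F'' x) v) u \<bullet> w)"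
proof -
  have inb: "z + a *\<^sub>R u + b *\<^sub>R v \<in> ball z d" if "a \<in> {0..t}" "b \<in> {0..t}" for a b
  proof -
    have "norm (a *\<^sub>R u + b *\<^sub>R v) \<le> a * norm u + b * norm v"
      using norm_triangle_ineq[of "a *\<^sub>R u" "b *\<^sub>R v"] that by simp
    also have "\<dots> \<le> t * norm u + t * norm v" using that by (intro add_mono mult_right_mono) auto
    finally have "norm (a *\<^sub>R u + b *\<^sub>R v) < d" using t by (simp add: algebra_simps)
    then show ?thesis using norm_minus_cancel[of "a *\<^sub>R u + b *\<^sub>R v"] by (simp add: dist_norm add.assoc)
  qed
  have D1: "((\<lambda>s. F (z + s *\<^sub>R u + b *\<^sub>R v) \<bullet> w) has_real_derivative F' (z + a *\<^sub>R u + b *\<^sub>R v) u \<bullet> w) (at a)"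
    if "a \<in> {0..t}" "b \<in> {0..t}" for a b
    unfolding has_field_derivative_def
  proof -
    have "((\<lambda>s. F (z + s *\<^sub>R u + b *\<^sub>R v)) has_derivative (\<lambda>h. F' (z + a *\<^sub>R u + b *\<^sub>R v) (h *\<^sub>R u))) (at a)"
      by (rule has_derivative_compose[where f="\<lambda>s. z + s *\<^sub>R u + b *\<^sub>R v" and g=F, OF _ d[OF inb[OF that]]])
         (auto intro!: derivative_eq_intros)
    then show "((\<lambda>s. F (z + s *\<^sub>R u + b *\<^sub>R v) \<bullet> w) has_derivative (*) (F' (z + a *\<^sub>R u + b *\<^sub>R v) u \<bullet> w)) (at a)"
      by (auto intro!: derivative_eq_intros simp: fun_eq_iff blinfun.bilinear_simps)
  qed
  have D2: "((\<lambda>s. F' (z + a *\<^sub>R u + s *\<^sub>R v) u \<bullet> w) has_real_derivative F'' (z + a *\<^sub>R u + b *\<^sub>R v) v u \<bullet> w) (at b)"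
    if "a \<in> {0..t}" "b \<in> {0..t}" for a b
  proof -
    have "((\<lambda>s. F' (z + a *\<^sub>R u + s *\<^sub>R v)) has_derivative (\<lambda>h. F'' (z + a *\<^sub>R u + b *\<^sub>R v) (h *\<^sub>R v))) (at b)"
      by (rule has_derivative_compose[where f="\<lambda>s. z + a *\<^sub>R u + s *\<^sub>R v" and g=F', OF _ d2[OF inb[OF that]]])
         (auto intro!: derivative_eq_intros)
    then show ?thesis
      unfolding has_field_derivative_def
      by (auto intro!: derivative_eq_intros simp: fun_eq_iff blinfun.bilinear_simps)
  qed
  \<comment> \<open>The mean value theorem gives an equality only for real functions, hence the
    pairing with \<open>w\<close>. It is applied twice: to the difference in direction
    \<open>v\<close> as a function of the position along \<open>u\<close>, and then to its
    derivative.\<close>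
  define g where "g = (\<lambda>s. F (z + s *\<^sub>R u + t *\<^sub>R v) \<bullet> w - F (z + s *\<^sub>R u + 0 *\<^sub>R v) \<bullet> w)"
  obtain a where a: "0 < a" "a < t"
    "g t - g 0 = (t - 0) * (F' (z + a *\<^sub>R u + t *\<^sub>R v) u \<bullet> w - F' (z + a *\<^sub>R u + 0 *\<^sub>R v) u \<bullet> w)"
  proof -
    have "\<And>s. 0 \<le> s \<Longrightarrow> s \<le> t \<Longrightarrow> (g has_real_derivative (F' (z + s *\<^sub>R u + t *\<^sub>R v) u \<bullet> w - F' (z + s *\<^sub>R u + 0 *\<^sub>R v) u \<bullet> w)) (at s)"
      unfolding g_def using t by (intro DERIV_diff D1) auto
    from MVT2[OF t(1) this] show thesis using that by blast
  qed
  obtain b where b: "0 < b" "b < t"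
    "F' (z + a *\<^sub>R u + t *\<^sub>R v) u \<bullet> w - F' (z + a *\<^sub>R u + 0 *\<^sub>R v) u \<bullet> w = (t - 0) * (F'' (z + a *\<^sub>R u + b *\<^sub>R v) v u \<bullet> w)"
  proof -
    have "\<And>s. 0 \<le> s \<Longrightarrow> s \<le> t \<Longrightarrow> ((\<lambda>s. F' (z + a *\<^sub>R u + s *\<^sub>R v) u \<bullet> w) has_real_derivative F'' (z + a *\<^sub>R u + s *\<^sub>R v) v u \<bullet> w) (at s)"
      using a by (intro D2) auto
    from MVT2[OF t(1) this] show thesis using that by blast
  qed
  show thesis
  proof (rule that)
    show "z + a *\<^sub>R u + b *\<^sub>R v \<in> ball z d" using a b by (intro inb) auto
    have "(F (z + t *\<^sub>R u + t *\<^sub>R v) - F (z + t *\<^sub>R u) - F (z + t *\<^sub>R v) + F z) \<bullet> w = g t - g 0"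
      by (simp add: g_def inner_diff_left inner_add_left)
    then show "(F (z + t *\<^sub>R u + t *\<^sub>R v) - F (z + t *\<^sub>R u) - F (z + t *\<^sub>R v) + F z) \<bullet> w
       = t\<^sup>2 * (F'' (z + a *\<^sub>R u + b *\<^sub>R v) v u \<bullet> w)"
      using a(3) b(3) by (simp add: power2_eq_square)
  qed
qed

text \<open>It is applied to transition maps: in the transformation law of the geodesic equation,
  terms with the two orders of the arguments must cancel.\<close>

lemma second_derivative_symmetric:
  fixes F :: "'a::real_normed_vector \<Rightarrow> 'b::real_inner"
  assumes S: "open S" "z \<in> S"
    and d: "\<And>x. x \<in> S \<Longrightarrow> (F has_derivative blinfun_apply (F' x)) (at x)"
    and d2: "\<And>x. x \<in> S \<Longrightarrow> (F' has_derivative blinfun_apply (F'' x)) (at x)"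
    and cont: "continuous_on S F''"
  shows "blinfun_apply (blinfun_apply (F'' z) u) v = blinfun_apply (blinfun_apply (F'' z) v) u"
proof -
  have "(F'' z u v - F'' z v u) \<bullet> w = 0" for w
  proof (rule ccontr)
    assume ne: "(F'' z u v - F'' z v u) \<bullet> w \<noteq> 0"
    define h where "h = (\<lambda>x a b. F'' x a b \<bullet> w)"
    define e where "e = \<bar>h z u v - h z v u\<bar> / 2"
    have e: "e > 0" using ne by (simp add: e_def h_def inner_diff_left)
    have hc: "isCont (\<lambda>x. h x a b) z" for a b
      using cont S unfolding h_def
      by (auto intro!: continuous_intros simp: continuous_on_eq_continuous_at)
    obtain r where r: "r > 0" "ball z r \<subseteq> S" using S open_contains_ball by blast
    obtain d1 where d1: "d1 > 0" "\<And>x. dist x z < d1 \<Longrightarrow> dist (h x u v) (h z u v) < e"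
      using hc[of u v] e unfolding continuous_at_eps_delta by blast
    obtain d2' where d2': "d2' > 0" "\<And>x. dist x z < d2' \<Longrightarrow> dist (h x v u) (h z v u) < e"
      using hc[of v u] e unfolding continuous_at_eps_delta by blast
    define q where "q = min r (min d1 d2')"
    have q: "q > 0" using r d1 d2' by (simp add: q_def)
    \<comment> \<open>Small enough for the parallelogram spanned by \<open>t *\<^sub>R u\<close> and
      \<open>t *\<^sub>R v\<close> to stay in the ball; the 1 in the denominator covers the case
      that both vectors vanish.\<close>
    define t where "t = q / (2 * (norm u + norm v + 1))"
    have n: "norm u + norm v + 1 > 0" by (simp add: add_nonneg_pos)
    have t: "t > 0" using q n by (simp add: t_def)
    have "t * (norm u + norm v) \<le> t * (norm u + norm v + 1)" using t by (intro mult_left_mono) auto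
    also have "\<dots> = q / 2" using n by (simp add: t_def field_simps)
    finally have tq: "t * (norm u + norm v) < q" using q by simp
    have qS: "x \<in> S" if "x \<in> ball z q" for x using that r by (auto simp: q_def)
    obtain x where x: "x \<in> ball z q" "(F (z + t *\<^sub>R u + t *\<^sub>R v) - F (z + t *\<^sub>R u) - F (z + t *\<^sub>R v) + F z) \<bullet> w = t\<^sup>2 * h x v u"
      using second_difference_mvt[of z q F F' F'' t u v w] d d2 qS t tq unfolding h_def by metis
    obtain y where y: "y \<in> ball z q" "(F (z + t *\<^sub>R v + t *\<^sub>R u) - F (z + t *\<^sub>R v) - F (z + t *\<^sub>R u) + F z) \<bullet> w = t\<^sup>2 * h y u v"
      using second_difference_mvt[of z q F F' F'' t v u w] d d2 qS t tq unfolding h_def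
      by (metis add.commute)
    have "z + t *\<^sub>R v + t *\<^sub>R u = z + t *\<^sub>R u + t *\<^sub>R v" by (simp add: add_ac)
    then have "t\<^sup>2 * h x v u = t\<^sup>2 * h y u v"
      using x(2) y(2) by (simp only: inner_diff_left inner_add_left algebra_simps)
    then have "h x v u = h y u v" using t by simp
    moreover have "\<bar>h x v u - h z v u\<bar> < e" "\<bar>h y u v - h z u v\<bar> < e"
      using d1(2)[of y] d2'(2)[of x] x(1) y(1) by (auto simp: q_def dist_commute dist_real_def)
    ultimately have "\<bar>h z u v - h z v u\<bar> < e + e" by linarith
    then show False by (simp add: e_def)
  qed
  then show ?thesis by (metis inner_eq_zero_iff right_minus_eq)
qed

section \<open>The implicit height over a level set\<close>

text \<open>This is an implicit function theorem with quantitative and sign information. Near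
  \<open>z0\<close> the derivative of \<open>F\<close> along \<open>e\<close> is at least 1/2, so
  the intermediate value theorem finds a zero on each nearby line parallel to \<open>e\<close>, and
  monotonicity compares its parameter \<rho> with the value of \<open>F\<close>, in sign as well as
  in size. The derivative of \<rho> is expressed at the foot point
  \<open>z - \<rho> z *\<^sub>R e\<close>, where it can later be differentiated along a
  curve.\<close>

lemma implicit_height:
  fixes F :: "'a::euclidean_space \<Rightarrow> real" and F' :: "'a \<Rightarrow> 'a \<Rightarrow>\<^sub>L real"
  assumes S: "open S" "z0 \<in> S"
    and d: "\<And>x. x \<in> S \<Longrightarrow> (F has_derivative blinfun_apply (F' x)) (at x)"
    and cont: "continuous_on S F'"
    and F0: "F z0 = 0" and e: "blinfun_apply (F' z0) e = 1"
  obtains R K \<rho> where "R > 0" "K > 0"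
    "\<And>z. z \<in> ball z0 R \<Longrightarrow> z - \<rho> z *\<^sub>R e \<in> S \<and> F (z - \<rho> z *\<^sub>R e) = 0 \<and>
        blinfun_apply (F' (z - \<rho> z *\<^sub>R e)) e \<ge> 1 / 2 \<and> norm (F' (z - \<rho> z *\<^sub>R e)) \<le> K \<and>
        \<bar>\<rho> z\<bar> \<le> K * dist z0 z \<and> (F z \<le> 0 \<longleftrightarrow> \<rho> z \<le> 0) \<and> (F z = 0 \<longrightarrow> \<rho> z = 0)"
    "\<And>z. z \<in> ball z0 R \<Longrightarrow> (\<rho> has_derivative (\<lambda>h. blinfun_apply (F' (z - \<rho> z *\<^sub>R e)) h /
        blinfun_apply (F' (z - \<rho> z *\<^sub>R e)) e)) (at z)"
proof -
  define K0 where "K0 = norm (F' z0) + 1"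
  have K0: "K0 > 0" "K0 \<ge> 1" by (auto simp: K0_def add_nonneg_pos)
  \<comment> \<open>The first bound on the variation of \<open>F'\<close> yields
    \<open>norm (F' x) \<le> K0\<close>; the second keeps \<open>F' x e\<close> within 1/2 of its
    value 1 at \<open>z0\<close>.\<close>
  define c where "c = min 1 (1 / (2 * (norm e + 1)))"
  have ne: "norm e + 1 > 0" by (simp add: add_nonneg_pos)
  then have c: "c > 0" unfolding c_def by simp
  have "isCont F' z0" using cont S by (simp add: continuous_on_eq_continuous_at)
  then obtain r1 where r1: "r1 > 0" "\<And>x. dist x z0 < r1 \<Longrightarrow> dist (F' x) (F' z0) < c"
    using c unfolding continuous_at_eps_delta by blast
  obtain r2 where r2: "r2 > 0" "ball z0 r2 \<subseteq> S" using S open_contains_ball by blast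
  define r where "r = min r1 r2"
  have r: "r > 0" "ball z0 r \<subseteq> S" using r1 r2 by (auto simp: r_def)
  have dc: "norm (F' x - F' z0) < c" if "x \<in> ball z0 r" for x
    using r1(2)[of x] that by (auto simp: r_def dist_commute dist_norm norm_minus_commute)
  have FK: "norm (F' x) \<le> K0" if "x \<in> ball z0 r" for x
    using dc[OF that] norm_triangle_sub[of "F' x" "F' z0"] by (simp add: K0_def c_def)
  have Fe: "F' x e \<ge> 1 / 2" if "x \<in> ball z0 r" for x
  proof -
    have "\<bar>F' x e - F' z0 e\<bar> \<le> norm (F' x - F' z0) * norm e"
      using norm_blinfun[of "F' x - F' z0" e] by (simp add: blinfun.diff_left)
    also have "\<dots> \<le> c * (norm e + 1)" using dc[OF that] c by (intro mult_mono) auto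
    also have "\<dots> \<le> (1 / (2 * (norm e + 1))) * (norm e + 1)"
      using ne by (intro mult_right_mono) (auto simp: c_def)
    also have "\<dots> = 1 / 2" using ne by (simp add: field_simps)
    finally show ?thesis using e unfolding abs_le_iff by linarith
  qed
  define R2 where "R2 = r / (2 * (norm e + 1))"
  have R2: "R2 > 0" using r ne by (simp add: R2_def)
  have R2e: "R2 * norm e \<le> r / 2"
  proof -
    have "R2 * norm e \<le> R2 * (norm e + 1)" using R2 by (intro mult_left_mono) auto
    also have "\<dots> = r / 2" using ne by (simp add: R2_def field_simps)
    finally show ?thesis .
  qed
  \<comment> \<open>The bound \<open>r / 2\<close> leaves room for the translation by at most
    \<open>R2 *\<^sub>R e\<close>. The other one makes \<bar>F z\<bar> at most
    \<open>R2 / 4\<close>, less than the change \<open>R2 / 2\<close> that \<open>F\<close>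
    undergoes along \<open>e\<close> on either side, which forces a zero.\<close>
  define R where "R = min (r / 2) (R2 / (4 * K0))"
  have R: "R > 0" using r R2 K0 by (simp add: R_def)
  have inb: "z - s *\<^sub>R e \<in> ball z0 r" if "z \<in> ball z0 R" "s \<in> {-R2..R2}" for z s
  proof -
    have "\<bar>s\<bar> * norm e \<le> R2 * norm e" using that by (intro mult_right_mono) auto
    then have "norm (s *\<^sub>R e) \<le> r / 2" using R2e by simp
    moreover have "dist z0 z < r / 2" using that by (simp add: R_def)
    moreover have "dist z0 (z - s *\<^sub>R e) \<le> dist z0 z + norm (s *\<^sub>R e)"
      using dist_triangle[of z0 "z - s *\<^sub>R e" z] by (simp add: dist_norm)
    ultimately show ?thesis by simp
  qed
  have FL: "\<bar>F x - F y\<bar> \<le> K0 * norm (x - y)" if "x \<in> ball z0 r" "y \<in> ball z0 r" for x y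
  proof -
    have "norm (F x - F y) \<le> K0 * norm (x - y)"
      using d r FK that
      by (intro differentiable_bound[OF convex_ball, of z0 r F "\<lambda>x. blinfun_apply (F' x)"])
         (auto intro!: has_derivative_at_withinI[OF d] simp flip: norm_blinfun.rep_eq)
    then show ?thesis by simp
  qed
  have mono: "F (z - s *\<^sub>R e) - F (z - s' *\<^sub>R e) \<ge> (s' - s) / 2"
    if z: "z \<in> ball z0 R" and s: "s \<in> {-R2..R2}" "s' \<in> {-R2..R2}" "s \<le> s'" for z s s'
  proof (cases "s = s'")
    case False
    then have "s < s'" using s by simp
    have "\<And>x. s \<le> x \<Longrightarrow> x \<le> s' \<Longrightarrow> ((\<lambda>s. F (z - s *\<^sub>R e)) has_real_derivative - F' (z - x *\<^sub>R e) e) (at x)"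
    proof -
      fix x assume "s \<le> x" "x \<le> s'"
      then have "z - x *\<^sub>R e \<in> S" using inb[OF z, of x] s r by auto
      then have "((\<lambda>s. F (z - s *\<^sub>R e)) has_derivative (\<lambda>h. F' (z - x *\<^sub>R e) (- (h *\<^sub>R e)))) (at x)"
        by (intro has_derivative_compose[where f="\<lambda>s. z - s *\<^sub>R e" and g=F, OF _ d])
           (auto intro!: derivative_eq_intros)
      then show "((\<lambda>s. F (z - s *\<^sub>R e)) has_real_derivative - F' (z - x *\<^sub>R e) e) (at x)"
        unfolding has_field_derivative_def
        by (auto elim!: has_derivative_eq_rhs simp: fun_eq_iff blinfun.bilinear_simps)
    qed
    from MVT2[OF \<open>s < s'\<close> this] obtain x where x: "s < x" "x < s'"
      "F (z - s' *\<^sub>R e) - F (z - s *\<^sub>R e) = (s' - s) * (- F' (z - x *\<^sub>R e) e)" by blast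
    have "F' (z - x *\<^sub>R e) e \<ge> 1 / 2" using x s by (intro Fe inb z) auto
    then have "(s' - s) * F' (z - x *\<^sub>R e) e \<ge> (s' - s) * (1 / 2)" using s by (intro mult_left_mono) auto
    then show ?thesis using x(3) by simp
  qed simp
  have zero_in: "0 \<in> {-R2..R2}" using R2 by simp
  have Rr: "z \<in> ball z0 r" if "z \<in> ball z0 R" for z using inb[OF that zero_in] by simp
  have "\<exists>s. s \<in> {-R2..R2} \<and> F (z - s *\<^sub>R e) = 0" if z: "z \<in> ball z0 R" for z
  proof -
    have "\<bar>F z\<bar> \<le> K0 * norm (z - z0)" using FL[of z z0] Rr[OF z] F0 r by simp
    also have "\<dots> \<le> K0 * (R2 / (4 * K0))"
      using z K0 by (intro mult_left_mono) (auto simp: R_def dist_norm norm_minus_commute)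
    also have "\<dots> = R2 / 4" using K0 by simp
    finally have Fz: "\<bar>F z\<bar> \<le> R2 / 4" .
    have "F (z - R2 *\<^sub>R e) \<le> 0" using mono[OF z zero_in, of R2] R2 Fz by auto
    moreover have "0 \<le> F (z - (-R2) *\<^sub>R e)" using mono[OF z, of "-R2" 0] R2 Fz by auto
    moreover have "continuous_on {-R2..R2} (\<lambda>s. F (z - s *\<^sub>R e))"
    proof (rule continuous_on_compose2[of "ball z0 r" F])
      show "continuous_on (ball z0 r) F"
        using d r has_derivative_continuous by (intro continuous_at_imp_continuous_on) blast
    qed (use inb[OF z] in \<open>auto intro!: continuous_intros\<close>)
    ultimately show ?thesis
      using IVT2'[of "\<lambda>s. F (z - s *\<^sub>R e)" R2 0 "-R2"] R2 by auto
  qed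
  then obtain \<rho> where \<rho>: "\<And>z. z \<in> ball z0 R \<Longrightarrow> \<rho> z \<in> {-R2..R2}"
    "\<And>z. z \<in> ball z0 R \<Longrightarrow> F (z - \<rho> z *\<^sub>R e) = 0" by metis
  have \<rho>F: "\<bar>\<rho> z\<bar> \<le> 2 * \<bar>F z\<bar>" "F z \<le> 0 \<longleftrightarrow> \<rho> z \<le> 0" if z: "z \<in> ball z0 R" for z
  proof -
    have "F z \<ge> \<rho> z / 2" if "\<rho> z \<ge> 0" using mono[OF z zero_in \<rho>(1)[OF z] that] \<rho>(2)[OF z] by simp
    moreover have "F z \<le> \<rho> z / 2" if "\<rho> z \<le> 0" using mono[OF z \<rho>(1)[OF z] zero_in that] \<rho>(2)[OF z] by simp
    ultimately show "\<bar>\<rho> z\<bar> \<le> 2 * \<bar>F z\<bar>" "F z \<le> 0 \<longleftrightarrow> \<rho> z \<le> 0" by linarith+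
  qed
  \<comment> \<open>A Lipschitz bound has to precede differentiability: it converts the
    linearisation error of \<open>F\<close>, measured by the distance of foot points, into one
    measured by the distance of \<open>y\<close> and \<open>z\<close>.\<close>
  have \<rho>L: "\<bar>\<rho> z' - \<rho> z\<bar> \<le> 2 * K0 * norm (z' - z)" if z: "z \<in> ball z0 R" "z' \<in> ball z0 R" for z z'
  proof -
    have "\<bar>\<rho> z' - \<rho> z\<bar> / 2 \<le> \<bar>F (z' - \<rho> z *\<^sub>R e) - F (z' - \<rho> z' *\<^sub>R e)\<bar>"
      using mono[OF z(2) \<rho>(1)[OF z(1)] \<rho>(1)[OF z(2)]] mono[OF z(2) \<rho>(1)[OF z(2)] \<rho>(1)[OF z(1)]]
      by (cases "\<rho> z \<le> \<rho> z'") auto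
    also have "\<dots> = \<bar>F (z' - \<rho> z *\<^sub>R e) - F (z - \<rho> z *\<^sub>R e)\<bar>" using \<rho>(2) z by simp
    also have "\<dots> \<le> K0 * norm (z' - z)" using FL[OF inb[OF z(2) \<rho>(1)[OF z(1)]] inb[OF z(1) \<rho>(1)[OF z(1)]]] by simp
    finally show ?thesis by simp
  qed
  show thesis
  proof (rule that[of R "2 * K0" \<rho>])
    fix z assume z: "z \<in> ball z0 R"
    let ?w = "z - \<rho> z *\<^sub>R e"
    have w: "?w \<in> ball z0 r" using inb \<rho>(1) z by blast
    have "\<bar>\<rho> z\<bar> \<le> 2 * K0 * dist z0 z"
      using FL[OF Rr[OF z], of z0] F0 r \<rho>F(1)[OF z] by (simp add: dist_norm norm_minus_commute)
    then show "?w \<in> S \<and> F ?w = 0 \<and> F' ?w e \<ge> 1 / 2 \<and> norm (F' ?w) \<le> 2 * K0 \<and>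
        \<bar>\<rho> z\<bar> \<le> 2 * K0 * dist z0 z \<and> (F z \<le> 0 \<longleftrightarrow> \<rho> z \<le> 0) \<and> (F z = 0 \<longrightarrow> \<rho> z = 0)"
      using w r Fe[OF w] FK[OF w] K0 \<rho>F[OF z] \<rho>(2)[OF z] by auto
    define D where "D = F' ?w e"
    have D: "D \<ge> 1 / 2" using Fe[OF w] by (simp add: D_def)
    have dw: "(F has_derivative blinfun_apply (F' ?w)) (at ?w)" using d w r by blast
    define c1 where "c1 = 1 + 2 * K0 * norm e"
    have c1: "c1 > 0" using K0 by (simp add: c1_def add_pos_nonneg)
    show "(\<rho> has_derivative (\<lambda>h. F' ?w h / F' ?w e)) (at z)"
      unfolding has_derivative_at_alt
    proof (intro conjI allI impI)
      show "bounded_linear (\<lambda>h. F' ?w h / F' ?w e)"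
        by (rule bounded_linear_compose[OF bounded_linear_divide blinfun.bounded_linear_right])
      fix \<epsilon> :: real assume \<epsilon>: "\<epsilon> > 0"
      \<comment> \<open>\<open>c1\<close> is a Lipschitz constant of the foot point map, and the
        factor 2 pays for the division by \<open>D \<ge> 1 / 2\<close>.\<close>
      define \<epsilon>' where "\<epsilon>' = \<epsilon> / (2 * c1)"
      have "\<epsilon>' > 0" using \<epsilon> c1 by (simp add: \<epsilon>'_def)
      then obtain q where q: "q > 0" "\<And>y. norm (y - ?w) < q \<Longrightarrow> norm (F y - F ?w - F' ?w (y - ?w)) \<le> \<epsilon>' * norm (y - ?w)"
        using dw unfolding has_derivative_at_alt by blast
      define p where "p = min (q / c1) (R - dist z0 z)"
      have p: "p > 0" using q c1 z by (simp add: p_def)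
      show "\<exists>d>0. \<forall>y. norm (y - z) < d \<longrightarrow> norm (\<rho> y - \<rho> z - F' ?w (y - z) / F' ?w e) \<le> \<epsilon> * norm (y - z)"
      proof (intro exI[of _ p] conjI p allI impI)
        fix y assume y: "norm (y - z) < p"
        have "dist z0 y \<le> dist z0 z + norm (y - z)"
          using dist_triangle[of z0 y z] by (simp add: dist_norm norm_minus_commute)
        then have yR: "y \<in> ball z0 R" using y by (simp add: p_def)
        let ?v = "y - \<rho> y *\<^sub>R e"
        have vw: "?v - ?w = (y - z) - (\<rho> y - \<rho> z) *\<^sub>R e" by (simp add: algebra_simps)
        have "norm (?v - ?w) \<le> norm (y - z) + \<bar>\<rho> y - \<rho> z\<bar> * norm e"
          unfolding vw using norm_triangle_ineq4[of "y - z" "(\<rho> y - \<rho> z) *\<^sub>R e"] by simp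
        also have "\<dots> \<le> norm (y - z) + (2 * K0 * norm (y - z)) * norm e"
          using \<rho>L[OF z yR] by (intro add_left_mono mult_right_mono) auto
        also have "\<dots> = c1 * norm (y - z)" by (simp add: c1_def algebra_simps)
        finally have nv: "norm (?v - ?w) \<le> c1 * norm (y - z)" .
        have "c1 * norm (y - z) < c1 * (q / c1)" using y c1 by (intro mult_strict_left_mono) (auto simp: p_def)
        then have "norm (?v - ?w) < q" using nv c1 by simp
        \<comment> \<open>Both foot points are zeros of \<open>F\<close>, so only the linear term
          remains; it contains \<open>\<rho> y - \<rho> z\<close> with the coefficient
          \<open>D\<close>.\<close>
        from q(2)[OF this] have "\<bar>F' ?w (?v - ?w)\<bar> \<le> \<epsilon>' * norm (?v - ?w)"
          using \<rho>(2) z yR by simp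
        also have "\<dots> \<le> \<epsilon>' * (c1 * norm (y - z))" using nv \<open>\<epsilon>' > 0\<close> by (intro mult_left_mono) auto
        also have "\<dots> = \<epsilon> / 2 * norm (y - z)" using c1 by (simp add: \<epsilon>'_def)
        finally have A: "\<bar>F' ?w (y - z) - (\<rho> y - \<rho> z) * D\<bar> \<le> \<epsilon> / 2 * norm (y - z)"
          unfolding vw by (simp add: blinfun.bilinear_simps D_def)
        have "\<rho> y - \<rho> z - F' ?w (y - z) / D = - ((F' ?w (y - z) - (\<rho> y - \<rho> z) * D) / D)"
          using D by (simp add: field_simps)
        then have "\<bar>\<rho> y - \<rho> z - F' ?w (y - z) / D\<bar> = \<bar>F' ?w (y - z) - (\<rho> y - \<rho> z) * D\<bar> / D"
          using D by (simp add: abs_divide)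
        also have "\<dots> \<le> (\<epsilon> / 2 * norm (y - z)) / (1 / 2)" using A D \<epsilon> by (intro frac_le) auto
        finally show "norm (\<rho> y - \<rho> z - F' ?w (y - z) / F' ?w e) \<le> \<epsilon> * norm (y - z)"
          by (simp add: D_def)
      qed
    qed
  qed (use R K0 in auto)
qed

section \<open>Curves near a level set\<close>

lemma vector_derivative_of_real_composition:
  fixes F :: "'a::real_normed_vector \<Rightarrow> real"
  assumes "(F has_derivative F') (at (c t))" "(c has_vector_derivative v) (at t)"
  shows "((\<lambda>s. F (c s)) has_real_derivative F' v) (at t)"
proof -
  have "bounded_linear F'" using assms(1) has_derivative_bounded_linear by blast
  then have "F' (h *\<^sub>R v) = F' v * h" for h by (simp add: linear_simps)
  with has_derivative_compose[OF assms(2)[unfolded has_vector_derivative_def] assms(1)]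
  show ?thesis unfolding has_field_derivative_def by (auto elim!: has_derivative_eq_rhs simp: fun_eq_iff)
qed

lemma vector_derivative_composition:
  assumes "(F has_derivative F') (at (c t))" "(c has_vector_derivative v) (at t)"
  shows "((\<lambda>s. F (c s)) has_vector_derivative F' v) (at t)"
proof -
  have "bounded_linear F'" using assms(1) has_derivative_bounded_linear by blast
  then have "F' (h *\<^sub>R v) = h *\<^sub>R F' v" for h by (simp add: linear_simps)
  with has_derivative_compose[OF assms(2)[unfolded has_vector_derivative_def] assms(1)]
  show ?thesis unfolding has_vector_derivative_def by (auto elim!: has_derivative_eq_rhs simp: fun_eq_iff)
qed

lemma has_vector_derivative_blinfun_apply:
  assumes "(f has_vector_derivative f') (at t)" "(g has_vector_derivative g') (at t)"
  shows "((\<lambda>s. blinfun_apply (f s) (g s)) has_vector_derivative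
     blinfun_apply (f t) g' + blinfun_apply f' (g t)) (at t)"
  using blinfun.has_vector_derivative[OF assms] by simp

text \<open>The analytic core, stated in a vector space for an arbitrary second-order equation with
  acceleration \<open>- Q\<close>. The hypothesis \<open>conv\<close> speaks only of zeros of
  \<open>F\<close> and tangent vectors, so it is used at the translated pair
  \<open>(\<beta> t, \<beta>' t)\<close>, and the Lipschitz condition on \<open>Q\<close> pays for
  the passage from \<open>(\<gamma> t, y t)\<close>. The radius and the time depend on
  \<open>z0\<close> but not on the curve, as a neighbourhood of initial velocities requires.\<close>

lemma spray_curves_below_convex_level_set:
  fixes F :: "'a::euclidean_space \<Rightarrow> real" and F' :: "'a \<Rightarrow> 'a \<Rightarrow>\<^sub>L real"
    and F'' :: "'a \<Rightarrow> 'a \<Rightarrow>\<^sub>L ('a \<Rightarrow>\<^sub>L real)" and Q :: "'a \<times> 'a \<Rightarrow> 'a"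
  assumes S: "open S" "z0 \<in> S"
    and d: "\<And>x. x \<in> S \<Longrightarrow> (F has_derivative blinfun_apply (F' x)) (at x)"
    and d2: "\<And>x. x \<in> S \<Longrightarrow> (F' has_derivative blinfun_apply (F'' x)) (at x)"
    and F0: "F z0 = 0" and nz: "F' z0 \<noteq> 0"
    and Q: "loc_lip (S \<times> UNIV) Q"
    and conv: "\<And>z v. z \<in> S \<Longrightarrow> F z = 0 \<Longrightarrow> blinfun_apply (F' z) v = 0 \<Longrightarrow>
      blinfun_apply (blinfun_apply (F'' z) v) v \<le> blinfun_apply (F' z) (Q (z, v))"
  obtains R \<delta> where "R > 0" "\<delta> > 0"
    "\<And>\<gamma> y \<epsilon> s. \<epsilon> \<le> \<delta> \<Longrightarrow>
      (\<And>t. t \<in> {-\<epsilon><..<\<epsilon>} \<Longrightarrow> (\<gamma> has_vector_derivative y t) (at t) \<and>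
        (y has_vector_derivative - Q (\<gamma> t, y t)) (at t) \<and> (\<gamma> t, y t) \<in> cball (z0, 0) R) \<Longrightarrow>
      \<gamma> 0 = z0 \<Longrightarrow> blinfun_apply (F' z0) (y 0) = 0 \<Longrightarrow> s \<in> {0..<\<epsilon>} \<Longrightarrow> F (\<gamma> s) \<le> 0"
proof -
  obtain e0 where "F' z0 e0 \<noteq> 0" using nz by (metis blinfun_eqI zero_blinfun.rep_eq)
  then obtain e where e: "F' z0 e = 1"
    by (metis blinfun.scaleR_right real_scaleR_def left_inverse)
  have "continuous_on S F'"
    using d2 has_derivative_continuous by (intro continuous_at_imp_continuous_on) blast
  from implicit_height[OF S d this F0 e] obtain R1 K \<rho> where R1: "R1 > 0" and K: "K > 0"
    and \<rho>: "\<And>z. z \<in> ball z0 R1 \<Longrightarrow> z - \<rho> z *\<^sub>R e \<in> S \<and> F (z - \<rho> z *\<^sub>R e) = 0 \<and>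
        F' (z - \<rho> z *\<^sub>R e) e \<ge> 1 / 2 \<and> norm (F' (z - \<rho> z *\<^sub>R e)) \<le> K \<and>
        \<bar>\<rho> z\<bar> \<le> K * dist z0 z \<and> (F z \<le> 0 \<longleftrightarrow> \<rho> z \<le> 0) \<and> (F z = 0 \<longrightarrow> \<rho> z = 0)"
    and \<rho>d: "\<And>z. z \<in> ball z0 R1 \<Longrightarrow> (\<rho> has_derivative (\<lambda>h. F' (z - \<rho> z *\<^sub>R e) h /
        F' (z - \<rho> z *\<^sub>R e) e)) (at z)"
    by blast
  obtain q L where q: "q > 0" and L: "L-lipschitz_on ((S \<times> UNIV) \<inter> ball (z0, 0) q) Q"
    using Q S unfolding loc_lip_def by (meson SigmaI UNIV_I)
  have L0: "L \<ge> 0" using L lipschitz_on_nonneg by blast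
  \<comment> \<open>The translated pair lies within \<open>R * N\<close> of \<open>(z0, 0)\<close>:
    the curve contributes \<open>R\<close>, and the shifts by \<open>r\<close> and
    \<open>r'\<close>, at most \<open>K * R\<close> and \<open>2 * K * R\<close>, contribute
    \<open>3 * K * R * norm e\<close>. Both pairs must lie in the ball where \<open>Q\<close> is
    Lipschitz.\<close>
  define N where "N = 2 + 3 * K * norm e"
  have N: "N \<ge> 2" using K by (simp add: N_def)
  obtain rS where rS: "rS > 0" "ball z0 rS \<subseteq> S" using S open_contains_ball by blast
  define R where "R = Min {R1 / 2, q / (2 * N), q / 3, rS / 2}"
  have R: "R > 0" "R < R1" "R * N < q" "R < q" "R < rS"
  proof -
    show "R > 0" "R < R1" "R < q" "R < rS" using R1 q N rS by (auto simp: R_def)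
    have "R * N \<le> q / (2 * N) * N" using N by (intro mult_right_mono) (auto simp: R_def)
    also have "\<dots> < q" using N q by simp
    finally show "R * N < q" .
  qed
  \<comment> \<open>\<open>K\<close> bounds \<open>F'\<close>, \<open>L * norm e\<close> turns the
    shifts \<open>r\<close> and \<open>r'\<close> into a change of \<open>Q\<close>, and the factor
    2 comes from dividing by \<open>F' (\<beta> t) e \<ge> 1 / 2\<close>.\<close>
  define C where "C = 2 * (K * L * norm e)"
  have C: "C \<ge> 0" using K L0 by (simp add: C_def)
  \<comment> \<open>With \<epsilon> at most 1 the factor \<open>1 + \<epsilon>\<close> is at most 2,
    which leaves \<open>\<epsilon> * C \<le> 1 / 8\<close> to be ensured.\<close>
  define \<delta> where "\<delta> = min 1 (1 / (8 * (C + 1)))"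
  have \<delta>: "\<delta> > 0" "\<delta> \<le> 1" using C by (auto simp: \<delta>_def)
  have \<delta>C: "\<epsilon> * C * (1 + \<epsilon>) \<le> 1 / 4" if "0 \<le> \<epsilon>" "\<epsilon> \<le> \<delta>" for \<epsilon>
  proof -
    have "\<epsilon> \<le> 1" using that \<delta>(2) by simp
    have "\<epsilon> * C * (1 + \<epsilon>) \<le> (1 / (8 * (C + 1))) * (C + 1) * 2"
      using that C \<open>\<epsilon> \<le> 1\<close> by (intro mult_mono) (auto simp: \<delta>_def)
    also have "\<dots> = 1 / 4" using C by (simp add: field_simps)
    finally show ?thesis .
  qed
  show thesis
  proof (rule that[OF R(1) \<delta>(1)])
    fix \<gamma> y \<epsilon> s
    assume \<epsilon>: "\<epsilon> \<le> \<delta>"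
      and sol: "\<And>t. t \<in> {-\<epsilon><..<\<epsilon>} \<Longrightarrow> (\<gamma> has_vector_derivative y t) (at t) \<and>
        (y has_vector_derivative - Q (\<gamma> t, y t)) (at t) \<and> (\<gamma> t, y t) \<in> cball (z0, 0) R"
      and init: "\<gamma> 0 = z0" "F' z0 (y 0) = 0" and s: "s \<in> {0..<\<epsilon>}"
    define r where "r = (\<lambda>t. \<rho> (\<gamma> t))"
    define \<beta> where "\<beta> = (\<lambda>t. \<gamma> t - r t *\<^sub>R e)"
    define r' where "r' = (\<lambda>t. F' (\<beta> t) (y t) / F' (\<beta> t) e)"
    define \<beta>' where "\<beta>' = (\<lambda>t. y t - r' t *\<^sub>R e)"
    have bnd: "dist z0 (\<gamma> t) \<le> R" "norm (y t) \<le> R" "\<gamma> t \<in> ball z0 R1" if "t \<in> {-\<epsilon><..<\<epsilon>}" for t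
    proof -
      have "dist (z0, 0) (\<gamma> t, y t) \<le> R" using sol[OF that] by simp
      then show "dist z0 (\<gamma> t) \<le> R" "norm (y t) \<le> R"
        using dist_fst_le[of "(z0, 0)" "(\<gamma> t, y t)"] dist_snd_le[of "(z0, 0)" "(\<gamma> t, y t)"] by auto
      then show "\<gamma> t \<in> ball z0 R1" using R by simp
    qed
    have B: "\<beta> t \<in> S" "F (\<beta> t) = 0" "F' (\<beta> t) e \<ge> 1 / 2" "norm (F' (\<beta> t)) \<le> K" "\<bar>r t\<bar> \<le> K * R"
      if "t \<in> {-\<epsilon><..<\<epsilon>}" for t
    proof -
      have "K * dist z0 (\<gamma> t) \<le> K * R" using bnd[OF that] K by (intro mult_left_mono) auto
      then show "\<beta> t \<in> S" "F (\<beta> t) = 0" "F' (\<beta> t) e \<ge> 1 / 2" "norm (F' (\<beta> t)) \<le> K" "\<bar>r t\<bar> \<le> K * R"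
        using \<rho>[OF bnd(3)[OF that]] by (auto simp: \<beta>_def r_def)
    qed
    have rd: "(r has_real_derivative r' t) (at t)" if "t \<in> {-\<epsilon><..<\<epsilon>}" for t
      using vector_derivative_of_real_composition[where c=\<gamma> and t=t, OF \<rho>d[OF bnd(3)[OF that]]] sol[OF that]
      by (auto simp: r_def r'_def \<beta>_def)
    have bd: "(\<beta> has_vector_derivative \<beta>' t) (at t)" if "t \<in> {-\<epsilon><..<\<epsilon>}" for t
      unfolding \<beta>_def \<beta>'_def using sol[OF that] rd[OF that]
      by (auto intro!: derivative_eq_intros)
    have Fb: "((\<lambda>t. F' (\<beta> t)) has_vector_derivative F'' (\<beta> t) (\<beta>' t)) (at t)" if "t \<in> {-\<epsilon><..<\<epsilon>}" for t
      using vector_derivative_composition[where c=\<beta> and t=t, OF d2[OF B(1)[OF that]] bd[OF that]] .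
    have tang: "F' (\<beta> t) (\<beta>' t) = 0" if "t \<in> {-\<epsilon><..<\<epsilon>}" for t
      using B(3)[OF that] by (simp add: \<beta>'_def r'_def blinfun.bilinear_simps)
    \<comment> \<open>No second derivative of \<rho> enters: \<open>r'\<close> is a quotient of
      expressions in \<open>F'\<close> at \<beta> and in \<open>y\<close>, and both \<beta> and
      \<open>y\<close> are already known to be differentiable.\<close>
    have "\<exists>D. (r' has_real_derivative D) (at t)" if "t \<in> {-\<epsilon><..<\<epsilon>}" for t
    proof -
      have "((\<lambda>t. F' (\<beta> t) (y t)) has_real_derivative
         F' (\<beta> t) (- Q (\<gamma> t, y t)) + F'' (\<beta> t) (\<beta>' t) (y t)) (at t)"
        unfolding has_real_derivative_iff_has_vector_derivative
        using has_vector_derivative_blinfun_apply[OF Fb[OF that]] sol[OF that] by blast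
      moreover have "((\<lambda>t. F' (\<beta> t) e) has_real_derivative F'' (\<beta> t) (\<beta>' t) e) (at t)"
        unfolding has_real_derivative_iff_has_vector_derivative
        using has_vector_derivative_blinfun_apply[OF Fb[OF that] has_vector_derivative_const, of e]
        by (simp add: blinfun.bilinear_simps)
      moreover have "F' (\<beta> t) e \<noteq> 0" using B(3)[OF that] by auto
      ultimately show ?thesis unfolding r'_def using DERIV_divide by blast
    qed
    then obtain r'' where r'd: "\<And>t. t \<in> {-\<epsilon><..<\<epsilon>} \<Longrightarrow> (r' has_real_derivative r'' t) (at t)"
      by metis
    \<comment> \<open>This is \<open>tang\<close> differentiated once more. Since \<open>e\<close>
      is constant, \<beta>' has the derivative
      \<open>- Q (\<gamma> t, y t) - r'' t *\<^sub>R e\<close>, with \<open>Q\<close> still taken on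
      the original curve.\<close>
    have eq: "F'' (\<beta> t) (\<beta>' t) (\<beta>' t) = F' (\<beta> t) (Q (\<gamma> t, y t)) + r'' t * F' (\<beta> t) e"
      if "t \<in> {-\<epsilon><..<\<epsilon>}" for t
    proof -
      have "(\<beta>' has_vector_derivative - Q (\<gamma> t, y t) - r'' t *\<^sub>R e) (at t)"
        unfolding \<beta>'_def using sol[OF that] r'd[OF that] by (auto intro!: derivative_eq_intros)
      from has_vector_derivative_blinfun_apply[OF Fb[OF that] this]
      have "((\<lambda>t. F' (\<beta> t) (\<beta>' t)) has_vector_derivative
        F' (\<beta> t) (- Q (\<gamma> t, y t) - r'' t *\<^sub>R e) + F'' (\<beta> t) (\<beta>' t) (\<beta>' t)) (at t)" .
      moreover have "((\<lambda>t. F' (\<beta> t) (\<beta>' t)) has_vector_derivative 0) (at t)"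
        by (rule has_vector_derivative_transform_within_open[of "\<lambda>_. 0" _ _ "{-\<epsilon><..<\<epsilon>}"])
           (use that tang in auto)
      ultimately have "F' (\<beta> t) (- Q (\<gamma> t, y t) - r'' t *\<^sub>R e) + F'' (\<beta> t) (\<beta>' t) (\<beta>' t) = 0"
        using vector_derivative_unique_at by blast
      then show ?thesis by (simp add: blinfun.bilinear_simps)
    qed
    have "r s \<le> 0"
    proof (rule nonpos_of_second_derivative_bound[where r=r and r'=r' and r''=r'' and C=C and \<epsilon>=\<epsilon>])
      show "\<epsilon> * C * (1 + \<epsilon>) \<le> 1 / 4" using \<delta>C s \<epsilon> by auto
      show "r 0 = 0" using \<rho>[of z0] R1 F0 init by (simp add: r_def)
      then show "r' 0 = 0" using init by (simp add: r'_def \<beta>_def)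
      fix t assume "t \<in> {0..<\<epsilon>}"
      then have t: "t \<in> {-\<epsilon><..<\<epsilon>}" by auto
      show "(r has_real_derivative r' t) (at t)" "(r' has_real_derivative r'' t) (at t)"
        using rd r'd t by auto
      have r'b: "\<bar>r' t\<bar> \<le> 2 * K * R"
      proof -
        have "\<bar>F' (\<beta> t) (y t)\<bar> \<le> norm (F' (\<beta> t)) * norm (y t)" using norm_blinfun[of "F' (\<beta> t)" "y t"] by simp
        also have "\<dots> \<le> K * R" using B(4)[OF t] bnd(2)[OF t] K by (intro mult_mono) auto
        finally have "\<bar>F' (\<beta> t) (y t)\<bar> / F' (\<beta> t) e \<le> K * R / (1 / 2)"
          using B(3)[OF t] K R by (intro frac_le) auto
        then show ?thesis using B(3)[OF t] by (simp add: r'_def abs_divide)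
      qed
      have diff: "(\<beta> t, \<beta>' t) - (\<gamma> t, y t) = (- r t *\<^sub>R e, - r' t *\<^sub>R e)"
        by (simp add: \<beta>_def \<beta>'_def)
      have nd: "norm ((\<beta> t, \<beta>' t) - (\<gamma> t, y t)) \<le> (\<bar>r t\<bar> + \<bar>r' t\<bar>) * norm e"
        unfolding diff using norm_Pair_le[of "- r t *\<^sub>R e" "- r' t *\<^sub>R e"] by (simp add: algebra_simps)
      have "(\<gamma> t, y t) \<in> cball (z0, 0) R" using sol[OF t] by simp
      then have in1: "(\<gamma> t, y t) \<in> ball (z0, 0) q" using R by simp
      have "(\<bar>r t\<bar> + \<bar>r' t\<bar>) * norm e \<le> (K * R + 2 * K * R) * norm e"
        using B(5)[OF t] r'b by (intro mult_right_mono) auto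
      then have "dist (\<gamma> t, y t) (\<beta> t, \<beta>' t) \<le> 3 * K * R * norm e"
        using nd dist_commute[of "(\<gamma> t, y t)" "(\<beta> t, \<beta>' t)"] dist_norm[of "(\<beta> t, \<beta>' t)" "(\<gamma> t, y t)"]
        by (simp add: algebra_simps)
      then have "dist (z0, 0) (\<beta> t, \<beta>' t) \<le> R + 3 * K * R * norm e"
        using \<open>(\<gamma> t, y t) \<in> cball (z0, 0) R\<close> dist_triangle[of "(z0, 0)" "(\<beta> t, \<beta>' t)" "(\<gamma> t, y t)"]
        unfolding mem_cball by linarith
      also have "\<dots> \<le> R * N" using R by (simp add: N_def algebra_simps)
      finally have in2: "(\<beta> t, \<beta>' t) \<in> ball (z0, 0) q" using R by simp
      have \<gamma>S: "\<gamma> t \<in> S" using bnd(1)[OF t] R rS by auto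
      have "r'' t * F' (\<beta> t) e \<le> F' (\<beta> t) (Q (\<beta> t, \<beta>' t)) - F' (\<beta> t) (Q (\<gamma> t, y t))"
        using conv[OF B(1)[OF t] B(2)[OF t] tang[OF t]] eq[OF t] by simp
      also have "\<dots> = F' (\<beta> t) (Q (\<beta> t, \<beta>' t) - Q (\<gamma> t, y t))" by (simp add: blinfun.bilinear_simps)
      also have "\<dots> \<le> norm (F' (\<beta> t)) * norm (Q (\<beta> t, \<beta>' t) - Q (\<gamma> t, y t))"
        using norm_blinfun[of "F' (\<beta> t)"] by (metis abs_le_D1 real_norm_def)
      also have "\<dots> \<le> K * (L * norm ((\<beta> t, \<beta>' t) - (\<gamma> t, y t)))"
        using B(1,4)[OF t] \<gamma>S in1 in2 K by (intro mult_mono lipschitz_on_normD[OF L]) auto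
      also have "\<dots> \<le> K * (L * ((\<bar>r t\<bar> + \<bar>r' t\<bar>) * norm e))"
        using nd K L0 by (intro mult_left_mono) auto
      also have "\<dots> = C * (\<bar>r t\<bar> + \<bar>r' t\<bar>) / 2" by (simp add: C_def algebra_simps)
      finally have le: "r'' t * F' (\<beta> t) e \<le> C * (\<bar>r t\<bar> + \<bar>r' t\<bar>) / 2" .
      \<comment> \<open>Replacing the coefficient \<open>F' (\<beta> t) e\<close> by its lower bound
        is legitimate only for positive \<open>r''\<close>; otherwise the claim is trivial.\<close>
      show "r'' t \<le> C * (\<bar>r t\<bar> + \<bar>r' t\<bar>)"
      proof (cases "r'' t \<le> 0")
        case True
        then show ?thesis using C by (meson add_nonneg_nonneg abs_ge_zero mult_nonneg_nonneg order_trans)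
      next
        case False
        then have "r'' t * (1 / 2) \<le> r'' t * F' (\<beta> t) e" using B(3)[OF t] by (intro mult_left_mono) auto
        then show ?thesis using le by linarith
      qed
    qed (use C s in auto)
    then show "F (\<gamma> s) \<le> 0" using \<rho>[OF bnd(3)[of s]] s by (auto simp: r_def)
  qed
qed

text \<open>The line through \<open>z0\<close> with direction \<open>v\<close> is moved into the
  level set along \<open>e\<close>. Since \<open>v\<close> is annihilated by \<open>F' z0\<close>,
  the correction has derivative 0 at time 0 and the initial velocity is kept. Continuity of \<beta>'
  is recorded because tangent vectors of \<open>H\<close> are velocities of C^1 curves.\<close>

lemma curve_in_level_set:
  fixes F :: "'a::euclidean_space \<Rightarrow> real" and F' :: "'a \<Rightarrow> 'a \<Rightarrow>\<^sub>L real"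
  assumes S: "open S" "z0 \<in> S"
    and d: "\<And>x. x \<in> S \<Longrightarrow> (F has_derivative blinfun_apply (F' x)) (at x)"
    and cont: "continuous_on S F'"
    and F0: "F z0 = 0" and nz: "F' z0 \<noteq> 0" and v: "blinfun_apply (F' z0) v = 0"
  obtains \<epsilon> \<beta> \<beta>' where "\<epsilon> > 0" "\<beta> 0 = z0" "\<beta>' 0 = v" "continuous_on {-\<epsilon><..<\<epsilon>} \<beta>'"
    "\<And>t. t \<in> {-\<epsilon><..<\<epsilon>} \<Longrightarrow> \<beta> t \<in> S \<and> F (\<beta> t) = 0 \<and> (\<beta> has_vector_derivative \<beta>' t) (at t)"
proof -
  obtain e0 where "F' z0 e0 \<noteq> 0" using nz by (metis blinfun_eqI zero_blinfun.rep_eq)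
  then obtain e where e: "F' z0 e = 1"
    by (metis blinfun.scaleR_right real_scaleR_def left_inverse)
  from implicit_height[OF S d cont F0 e] obtain R K \<rho> where R: "R > 0" and "K > 0"
    and \<rho>: "\<And>z. z \<in> ball z0 R \<Longrightarrow> z - \<rho> z *\<^sub>R e \<in> S \<and> F (z - \<rho> z *\<^sub>R e) = 0 \<and>
        F' (z - \<rho> z *\<^sub>R e) e \<ge> 1 / 2 \<and> norm (F' (z - \<rho> z *\<^sub>R e)) \<le> K \<and>
        \<bar>\<rho> z\<bar> \<le> K * dist z0 z \<and> (F z \<le> 0 \<longleftrightarrow> \<rho> z \<le> 0) \<and> (F z = 0 \<longrightarrow> \<rho> z = 0)"
    and \<rho>d: "\<And>z. z \<in> ball z0 R \<Longrightarrow> (\<rho> has_derivative (\<lambda>h. F' (z - \<rho> z *\<^sub>R e) h /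
        F' (z - \<rho> z *\<^sub>R e) e)) (at z)"
    by blast
  define \<epsilon> where "\<epsilon> = R / (norm v + 1)"
  have nv: "norm v + 1 > 0" by (simp add: add_nonneg_pos)
  have \<epsilon>: "\<epsilon> > 0" using R nv by (simp add: \<epsilon>_def)
  have inb: "z0 + t *\<^sub>R v \<in> ball z0 R" if "t \<in> {-\<epsilon><..<\<epsilon>}" for t
  proof -
    have "\<bar>t\<bar> * norm v \<le> \<bar>t\<bar> * (norm v + 1)" by (intro mult_left_mono) auto
    also have "\<dots> < \<epsilon> * (norm v + 1)" using that nv by (intro mult_strict_right_mono) auto
    also have "\<dots> = R" using nv by (simp add: \<epsilon>_def)
    finally show ?thesis by (simp add: dist_norm)
  qed
  define \<beta> where "\<beta> = (\<lambda>t. z0 + t *\<^sub>R v - \<rho> (z0 + t *\<^sub>R v) *\<^sub>R e)"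
  define \<beta>' where "\<beta>' = (\<lambda>t. v - (F' (\<beta> t) v / F' (\<beta> t) e) *\<^sub>R e)"
  have bd: "(\<beta> has_vector_derivative \<beta>' t) (at t)" if "t \<in> {-\<epsilon><..<\<epsilon>}" for t
  proof -
    have 1: "((\<lambda>t. z0 + t *\<^sub>R v) has_vector_derivative v) (at t)"
      by (auto intro!: derivative_eq_intros)
    have "((\<lambda>t. \<rho> (z0 + t *\<^sub>R v)) has_real_derivative F' (\<beta> t) v / F' (\<beta> t) e) (at t)"
      unfolding \<beta>_def by (rule vector_derivative_of_real_composition[where c="\<lambda>t. z0 + t *\<^sub>R v" and t=t, OF \<rho>d[OF inb[OF that]] 1])
    then show ?thesis unfolding \<beta>'_def
      by (subst \<beta>_def, intro derivative_eq_intros 1) (auto simp: has_real_derivative_iff_has_vector_derivative)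
  qed
  have B: "\<beta> t \<in> S" "F (\<beta> t) = 0" "F' (\<beta> t) e \<ge> 1 / 2" if "t \<in> {-\<epsilon><..<\<epsilon>}" for t
    using \<rho>[OF inb[OF that]] by (auto simp: \<beta>_def)
  have b0: "\<beta> 0 = z0" using \<rho>[of z0] R F0 by (simp add: \<beta>_def)
  show thesis
  proof (rule that[of \<epsilon> \<beta> \<beta>', OF \<epsilon> b0])
    show "\<beta>' 0 = v" using b0 v by (simp add: \<beta>'_def)
    have "continuous_on {-\<epsilon><..<\<epsilon>} \<beta>"
      using bd has_vector_derivative_continuous by (intro continuous_at_imp_continuous_on) blast
    then have "continuous_on {-\<epsilon><..<\<epsilon>} (\<lambda>t. F' (\<beta> t))"
      by (rule continuous_on_compose2[OF cont]) (use B in auto)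
    moreover have "F' (\<beta> t) e \<noteq> 0" if "t \<in> {-\<epsilon><..<\<epsilon>}" for t using B(3)[OF that] by auto
    ultimately show "continuous_on {-\<epsilon><..<\<epsilon>} \<beta>'"
      unfolding \<beta>'_def by (intro continuous_intros) auto
  qed (use bd B in auto)
qed

section \<open>Charts and tangent vectors\<close>

lemma C2_onE:
  assumes "C2_on S f"
  obtains f' f'' where
    "\<And>x. x \<in> S \<Longrightarrow> (f has_derivative blinfun_apply (f' x)) (at x)"
    "\<And>x. x \<in> S \<Longrightarrow> (f' has_derivative blinfun_apply (f'' x)) (at x)"
    "continuous_on S f''" "continuous_on S f'"
proof -
  obtain f' f'' where f: "\<forall>x\<in>S. (f has_derivative blinfun_apply (f' x)) (at x)"
    "\<forall>x\<in>S. (f' has_derivative blinfun_apply (f'' x)) (at x)" "continuous_on S f''"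
    using assms unfolding C2_on_def by blast
  have "continuous_on S f'"
    using f(2) has_derivative_continuous by (intro continuous_at_imp_continuous_on) blast
  with f that show thesis by blast
qed

context
  fixes c :: "('m::t2_space, 'n::finite) chart"
  assumes c: "is_chart c"
begin

lemma chart_open_dom: "open (cdom c)" and chart_open_image: "open (crd c ` cdom c)"
  using c by (auto simp: is_chart_def)

lemma chart_cinv_crd [simp]: "x \<in> cdom c \<Longrightarrow> cinv c (crd c x) = x"
  using c by (auto simp: is_chart_def homeomorphism_def)

lemma chart_crd_cinv: "z \<in> crd c ` cdom c \<Longrightarrow> crd c (cinv c z) = z"
  using c by (auto simp: is_chart_def homeomorphism_def)

lemma chart_cinv_in: "z \<in> crd c ` cdom c \<Longrightarrow> cinv c z \<in> cdom c"
  using c by (auto simp: is_chart_def homeomorphism_def)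

lemma chart_continuous: "continuous_on (cdom c) (crd c)" "continuous_on (crd c ` cdom c) (cinv c)"
  using c by (auto simp: is_chart_def homeomorphism_def)

lemma chart_image_Int: "crd c ` (cdom c \<inter> V) = {z \<in> crd c ` cdom c. cinv c z \<in> V}"
  using chart_cinv_in by force

lemma chart_open_image_Int: "open V \<Longrightarrow> open (crd c ` (cdom c \<inter> V))"
  using continuous_open_preimage[OF chart_continuous(2) chart_open_image]
  unfolding chart_image_Int by (simp add: vimage_def Int_def)

lemma chart_eventually_in: "isCont \<alpha> t \<Longrightarrow> \<alpha> t \<in> cdom c \<Longrightarrow> \<forall>\<^sub>F s in nhds t. \<alpha> s \<in> cdom c"
  for \<alpha> :: "real \<Rightarrow> 'm"
  using chart_open_dom by (auto simp: isCont_def tendsto_at_iff_tendsto_nhds dest!: topological_tendstoD)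

end

lemma inner_matrix_vector_mult:
  fixes B :: "real^'n^'n"
  shows "a \<bullet> (B *v b) = (\<Sum>i\<in>UNIV. \<Sum>j\<in>UNIV. B $ i $ j * a $ i * b $ j)"
  by (simp add: inner_vec_def matrix_vector_mult_def sum_distrib_left mult_ac)

lemma linear_axis_expansion:
  assumes "linear f"
  shows "f a = (\<Sum>i\<in>UNIV. a $ i *\<^sub>R f (axis i 1))"
proof -
  have "f (\<Sum>i\<in>UNIV. a $ i *\<^sub>R axis i 1) = (\<Sum>i\<in>UNIV. a $ i *\<^sub>R f (axis i 1))"
    using assms by (simp add: linear_sum linear_scale)
  then show ?thesis by (simp add: basis_expansion flip: scalar_mult_eq_scaleR)
qed

text \<open>The coordinate form of the geodesic spray: geodesics satisfy x'' = - spray (x, x').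
  Position and velocity form one argument, so that Lipschitz continuity on phase space can be stated
  at once.\<close>

definition spray ::
  "('m::t2_space, 'n::finite) chart set \<Rightarrow> ('m, 'n) metric \<Rightarrow> ('m, 'n) chart \<Rightarrow>
   (real^'n) \<times> (real^'n) \<Rightarrow> real^'n" where
  "spray A g c p = (\<chi> l. \<Sum>i\<in>UNIV. \<Sum>j\<in>UNIV. christoffel A g c l i j (fst p) * snd p $ i * snd p $ j)"

text \<open>The derivative in direction \<open>h\<close> of the metric on the fixed coordinate
  vectors \<open>a\<close> and \<open>b\<close>. It is not tensorial, since \<open>a\<close> and
  \<open>b\<close> are constant in one chart only.\<close>

definition metric_deriv ::
  "('m::t2_space, 'n::finite) chart set \<Rightarrow> ('m, 'n) metric \<Rightarrow> ('m, 'n) chart \<Rightarrow> real^'n \<Rightarrow>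
   real^'n \<Rightarrow> real^'n \<Rightarrow> real^'n \<Rightarrow> real" where
  "metric_deriv A g c z h a b = (\<Sum>i\<in>UNIV. \<Sum>j\<in>UNIV.
     frechet_derivative (\<lambda>w. metric_matrix A g c w $ i $ j) (at z) h * a $ i * b $ j)"

locale semi_riemannian_manifold =
  fixes A :: "('m::t2_space, 'n::finite) chart set" and g :: "('m, 'n) metric"
  assumes semi_riemannian: "semi_riemannian A g"
begin

lemma atlas: "C2_atlas A"
  using semi_riemannian by (simp add: semi_riemannian_def)

lemma chart: "c \<in> A \<Longrightarrow> is_chart c"
  using atlas by (simp add: C2_atlas_def)

lemma charts_at_nonempty: obtains c where "c \<in> A" "x \<in> cdom c"
  using atlas unfolding C2_atlas_def by (metis UNIV_I UN_E)

lemma transition_C2: "c \<in> A \<Longrightarrow> d \<in> A \<Longrightarrow> C2_on (crd c ` (cdom c \<inter> cdom d)) (transition c d)"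
  using atlas by (simp add: C2_atlas_def C2_compatible_def)

lemma jacobian_has_derivative:
  assumes "c \<in> A" "d \<in> A" "x \<in> cdom c" "x \<in> cdom d"
  shows "(transition c d has_derivative jacobian c d x) (at (crd c x))"
proof -
  have "crd c x \<in> crd c ` (cdom c \<inter> cdom d)" using assms by blast
  then have "transition c d differentiable at (crd c x)"
    using C2_onE[OF transition_C2[OF assms(1,2)]] unfolding differentiable_def by metis
  then show ?thesis unfolding jacobian_def by (simp add: frechet_derivative_works)
qed

lemma jacobian_linear:
  "c \<in> A \<Longrightarrow> d \<in> A \<Longrightarrow> x \<in> cdom c \<Longrightarrow> x \<in> cdom d \<Longrightarrow> linear (jacobian c d x)"
  using jacobian_has_derivative has_derivative_linear by blast

lemma transition_crd: "c \<in> A \<Longrightarrow> x \<in> cdom c \<Longrightarrow> transition c d (crd c x) = crd d x"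
  by (simp add: transition_def chart_cinv_crd[OF chart])

lemma jacobian_chain:
  assumes c: "c \<in> A" "x \<in> cdom c" and d: "d \<in> A" "x \<in> cdom d" and e: "e \<in> A" "x \<in> cdom e"
  shows "jacobian d e x (jacobian c d x a) = jacobian c e x a"
proof -
  let ?S = "crd c ` (cdom c \<inter> cdom d)"
  have S: "open ?S" "crd c x \<in> ?S"
    using chart_open_image_Int[OF chart[OF c(1)] chart_open_dom[OF chart[OF d(1)]]] c d by auto
  have "((\<lambda>z. transition d e (transition c d z)) has_derivative
      (\<lambda>a. jacobian d e x (jacobian c d x a))) (at (crd c x))"
    by (rule has_derivative_compose[OF jacobian_has_derivative])
       (use c d e jacobian_has_derivative[OF d(1) e(1) d(2) e(2)] in \<open>auto simp: transition_crd\<close>)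
  moreover have "transition d e (transition c d z) = transition c e z" if "z \<in> ?S" for z
    using that c d by (auto simp: transition_crd)
  ultimately have "(transition c e has_derivative (\<lambda>a. jacobian d e x (jacobian c d x a))) (at (crd c x))"
    using has_derivative_transform_within_open S by blast
  then show ?thesis
    using has_derivative_unique jacobian_has_derivative[OF c(1) e(1) c(2) e(2)] by metis
qed

lemma jacobian_self: "c \<in> A \<Longrightarrow> x \<in> cdom c \<Longrightarrow> jacobian c c x a = a"
proof -
  assume c: "c \<in> A" "x \<in> cdom c"
  have "((\<lambda>z. z) has_derivative (\<lambda>a. a)) (at (crd c x))" by (rule has_derivative_ident)
  then have "(transition c c has_derivative (\<lambda>a. a)) (at (crd c x))"
    by (rule has_derivative_transform_within_open[OF _ chart_open_image[OF chart[OF c(1)]]])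
       (use c in \<open>auto simp: transition_crd\<close>)
  then show ?thesis using has_derivative_unique jacobian_has_derivative[OF c(1) c(1) c(2) c(2)] by metis
qed

lemma tvec_of_self: "c \<in> A \<Longrightarrow> x \<in> cdom c \<Longrightarrow> tvec_of A c x a c = a"
  by (simp add: tvec_of_def charts_at_def jacobian_self)

lemma tvec_of_in_tangent_space: "c \<in> A \<Longrightarrow> x \<in> cdom c \<Longrightarrow> tvec_of A c x a \<in> tangent_space A x"
  by (auto simp: tangent_space_def tvec_of_def charts_at_def jacobian_chain)

lemma tangent_vector_eq:
  assumes "c \<in> A" "x \<in> cdom c" "v \<in> tangent_space A x"
  shows "tvec_of A c x (v c) = v"
proof
  fix d
  have "v d = jacobian c d x (v c)" if "d \<in> charts_at A x"
    using assms that unfolding tangent_space_def charts_at_def by blast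
  moreover have "v d = 0" if "d \<notin> charts_at A x"
    using assms(3) that unfolding tangent_space_def by blast
  ultimately show "tvec_of A c x (v c) d = v d" by (simp add: tvec_of_def)
qed

lemma tvec_of_jacobian:
  "c \<in> A \<Longrightarrow> d \<in> A \<Longrightarrow> x \<in> cdom c \<Longrightarrow> x \<in> cdom d \<Longrightarrow> tvec_of A d x (jacobian c d x a) = tvec_of A c x a"
  by (auto simp: tvec_of_def charts_at_def fun_eq_iff jacobian_chain)

lemma tangent_space_scaleR:
  assumes "v \<in> tangent_space A x"
  shows "(\<lambda>d. r *\<^sub>R v d) \<in> tangent_space A x"
proof -
  have "r *\<^sub>R v d = jacobian c d x (r *\<^sub>R v c)" if "c \<in> charts_at A x" "d \<in> charts_at A x" for c d
  proof -
    have "v d = jacobian c d x (v c)"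
      using assms that unfolding tangent_space_def by blast
    then show ?thesis
      using linear_scale[OF jacobian_linear[of c d x]] that by (simp add: charts_at_def)
  qed
  moreover have "r *\<^sub>R v c = 0" if "c \<notin> charts_at A x" for c
  proof -
    have "v c = 0" using assms that unfolding tangent_space_def by blast
    then show ?thesis by simp
  qed
  ultimately show ?thesis unfolding tangent_space_def by blast
qed

text \<open>A velocity has to be right in all charts around the point; the chain rule for the
  transition maps reduces this to a single chart.\<close>

lemma velocity_of_chart_curve:
  assumes c: "c \<in> A" "\<alpha> t \<in> cdom c" and cont: "isCont \<alpha> t"
    and a: "((crd c \<circ> \<alpha>) has_vector_derivative a) (at t)"
  shows "has_velocity A \<alpha> t (tvec_of A c (\<alpha> t) a)"
  unfolding has_velocity_def
proof (intro conjI ballI tvec_of_in_tangent_space c)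
  fix d assume "d \<in> charts_at A (\<alpha> t)"
  then have d: "d \<in> A" "\<alpha> t \<in> cdom d" by (auto simp: charts_at_def)
  have "((\<lambda>s. transition c d ((crd c \<circ> \<alpha>) s)) has_vector_derivative jacobian c d (\<alpha> t) a) (at t)"
    by (rule vector_derivative_composition[where c="crd c \<circ> \<alpha>" and t=t, OF _ a])
       (use jacobian_has_derivative[OF c(1) d(1) c(2) d(2)] in simp)
  moreover have "\<forall>\<^sub>F s in nhds t. transition c d ((crd c \<circ> \<alpha>) s) = (crd d \<circ> \<alpha>) s"
    using chart_eventually_in[OF chart[OF c(1)] cont c(2)]
    by eventually_elim (simp add: transition_crd c)
  ultimately have "((crd d \<circ> \<alpha>) has_vector_derivative jacobian c d (\<alpha> t) a) (at t)"
    using has_vector_derivative_cong_ev[where f="\<lambda>s. transition c d ((crd c \<circ> \<alpha>) s)" and g="crd d \<circ> \<alpha>" and x=t and S=UNIV]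
      by (simp add: transition_crd c)
  then show "((crd d \<circ> \<alpha>) has_vector_derivative tvec_of A c (\<alpha> t) a d) (at t)"
    using d by (simp add: tvec_of_def charts_at_def)
qed

section \<open>Covariance of the geodesic equation\<close>

lemma metric_form_transition:
  "c \<in> A \<Longrightarrow> d \<in> A \<Longrightarrow> x \<in> cdom c \<Longrightarrow> x \<in> cdom d \<Longrightarrow>
    metric_form A g c x a b = metric_form A g d x (jacobian c d x a) (jacobian c d x b)"
  by (simp add: metric_form_def tvec_of_jacobian)

lemma metric_form:
  assumes "c \<in> A" "x \<in> cdom c"
  shows metric_form_bilinear: "bilinear (metric_form A g c x)"
    and metric_form_sym: "metric_form A g c x a b = metric_form A g c x b a"
    and metric_form_nondegenerate: "(\<And>b. metric_form A g c x a b = 0) \<Longrightarrow> a = 0"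
  using assms semi_riemannian unfolding semi_riemannian_def charts_at_def by blast+

lemma metric_form_matrix:
  assumes c: "c \<in> A" "x \<in> cdom c"
  shows "metric_form A g c x a b = a \<bullet> (metric_matrix A g c (crd c x) *v b)"
proof -
  let ?m = "metric_form A g c x"
  have l: "linear (\<lambda>a. ?m a b)" "linear (\<lambda>b. ?m a b)" for a b
    using metric_form_bilinear[OF c] by (auto simp: bilinear_def)
  have "?m a b = (\<Sum>i\<in>UNIV. \<Sum>j\<in>UNIV. a $ i * (b $ j * ?m (axis i 1) (axis j 1)))"
    by (subst linear_axis_expansion[OF l(1)], subst linear_axis_expansion[OF l(2)])
       (simp add: sum_distrib_left)
  then show ?thesis
    by (simp add: inner_matrix_vector_mult metric_matrix_def chart[OF c(1)] c(2) mult_ac)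
qed

lemma metric_matrix_invertible:
  assumes c: "c \<in> A" "x \<in> cdom c"
  shows "invertible (metric_matrix A g c (crd c x))"
proof -
  have "b = 0" if "metric_matrix A g c (crd c x) *v b = 0" for b
    using that metric_form_matrix[OF c, of _ b] metric_form_sym[OF c, of b]
    by (intro metric_form_nondegenerate[OF c]) simp
  then show ?thesis
    using matrix_left_invertible_ker invertible_left_inverse by blast
qed

lemma metric_matrix_has_derivative:
  assumes c: "c \<in> A" "z \<in> crd c ` cdom c"
  shows "((\<lambda>w. metric_matrix A g c w $ i $ j) has_derivative
      frechet_derivative (\<lambda>w. metric_matrix A g c w $ i $ j) (at z)) (at z)"
proof -
  have "C11_on (crd c ` cdom c) (\<lambda>z. metric_matrix A g c z $ i $ j)"
    using semi_riemannian c by (simp add: semi_riemannian_def)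
  then have "(\<lambda>w. metric_matrix A g c w $ i $ j) differentiable at z"
    using c unfolding C11_on_def differentiable_def by blast
  then show ?thesis by (simp add: frechet_derivative_works)
qed

lemma metric_derivative_linear:
  "c \<in> A \<Longrightarrow> z \<in> crd c ` cdom c \<Longrightarrow>
    linear (frechet_derivative (\<lambda>w. metric_matrix A g c w $ i $ j) (at z))"
  using metric_matrix_has_derivative has_derivative_linear by blast

section \<open>Lipschitz regularity of the Christoffel symbols\<close>

lemma loc_lip_metric_partial:
  assumes c: "c \<in> A"
  shows "loc_lip (crd c ` cdom c) (\<lambda>z. partial k (\<lambda>w. metric_matrix A g c w $ i $ j) z)"
proof -
  have "C11_on (crd c ` cdom c) (\<lambda>z. metric_matrix A g c z $ i $ j)"
    using semi_riemannian c by (simp add: semi_riemannian_def)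
  then obtain G' where G': "\<forall>x\<in>crd c ` cdom c. ((\<lambda>z. metric_matrix A g c z $ i $ j) has_derivative blinfun_apply (G' x)) (at x)"
    and "loc_lip (crd c ` cdom c) G'"
    unfolding C11_on_def loc_lip_def by blast
  then have "loc_lip (crd c ` cdom c) (\<lambda>z. G' z (axis k 1))"
  proof (rule_tac loc_lip_compose[of _ G' UNIV "\<lambda>G. blinfun_apply G (axis k 1)"])
    have "1-lipschitz_on UNIV (\<lambda>G :: (real^'n) \<Rightarrow>\<^sub>L real. blinfun_apply G (axis k 1))"
    proof (rule lipschitz_onI)
      fix G K :: "(real^'n) \<Rightarrow>\<^sub>L real"
      show "dist (blinfun_apply G (axis k 1)) (blinfun_apply K (axis k 1)) \<le> 1 * dist G K"
        using norm_blinfun[of "G - K" "axis k 1"] by (simp add: dist_norm blinfun.diff_left)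
    qed simp
    then show "loc_lip UNIV (\<lambda>G :: (real^'n) \<Rightarrow>\<^sub>L real. blinfun_apply G (axis k 1))"
      by (rule lipschitz_imp_loc_lip)
  qed auto
  moreover have "partial k (\<lambda>w. metric_matrix A g c w $ i $ j) z = G' z (axis k 1)" if "z \<in> crd c ` cdom c" for z
    unfolding partial_def using frechet_derivative_at[OF G'[rule_format, OF that]] by simp
  ultimately show ?thesis using loc_lip_cong by (metis (no_types, lifting))
qed

text \<open>The Lipschitz derivative is bounded on a small ball. The ball is convex and can be
  chosen inside the chart image, so the mean value inequality applies.\<close>

lemma loc_lip_metric_matrix:
  assumes c: "c \<in> A"
  shows "loc_lip (crd c ` cdom c) (\<lambda>z. metric_matrix A g c z $ i $ j)"
  unfolding loc_lip_def
proof
  let ?f = "\<lambda>z. metric_matrix A g c z $ i $ j"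
  fix z assume z: "z \<in> crd c ` cdom c"
  have "C11_on (crd c ` cdom c) ?f"
    using semi_riemannian c by (simp add: semi_riemannian_def)
  then obtain G' where d: "\<forall>x\<in>crd c ` cdom c. (?f has_derivative blinfun_apply (G' x)) (at x)"
    and "loc_lip (crd c ` cdom c) G'"
    unfolding C11_on_def loc_lip_def by blast
  then obtain r L where r: "r > 0" and L: "L-lipschitz_on (crd c ` cdom c \<inter> ball z r) G'"
    using z unfolding loc_lip_def by blast
  obtain q where q: "q > 0" "ball z q \<subseteq> crd c ` cdom c"
    using chart_open_image[OF chart[OF c]] z open_contains_ball by blast
  let ?B = "ball z (min r q)"
  have b: "norm (G' w) \<le> norm (G' z) + L * r" if "w \<in> ?B" for w
    using lipschitz_on_bound_near[OF L z, of w] that q by auto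
  have "norm (?f u - ?f w) \<le> (norm (G' z) + L * r) * norm (u - w)" if "u \<in> ?B" "w \<in> ?B" for u w
  proof (rule differentiable_bound[OF convex_ball _ _ that, of ?f "\<lambda>x. blinfun_apply (G' x)"])
    fix x assume x: "x \<in> ?B"
    then have "x \<in> crd c ` cdom c" using q by auto
    then show "(?f has_derivative blinfun_apply (G' x)) (at x within ?B)"
      using d has_derivative_at_withinI by blast
    show "onorm (blinfun_apply (G' x)) \<le> norm (G' z) + L * r"
      using b[OF x] by (simp add: norm_blinfun.rep_eq)
  qed
  then have "(norm (G' z) + L * r)-lipschitz_on ?B ?f"
    using lipschitz_on_nonneg[OF L] r by (intro lipschitz_onI) (auto simp: dist_norm)
  then have "(norm (G' z) + L * r)-lipschitz_on (crd c ` cdom c \<inter> ?B) ?f"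
    by (rule lipschitz_on_subset) auto
  moreover have "min r q > 0" using r q by simp
  ultimately show "\<exists>r>0. \<exists>L. L-lipschitz_on (crd c ` cdom c \<inter> ball z r) ?f" by blast
qed

lemma loc_lip_christoffel:
  assumes c: "c \<in> A"
  shows "loc_lip (crd c ` cdom c) (christoffel A g c l i j)"
  unfolding christoffel_def
  by (intro loc_lip_mult loc_lip_const loc_lip_sum loc_lip_matrix_inv loc_lip_metric_matrix
      loc_lip_add loc_lip_diff loc_lip_metric_partial c)
     (use metric_matrix_invertible[OF c] in auto)

lemma loc_lip_spray:
  assumes c: "c \<in> A"
  shows "loc_lip (crd c ` cdom c \<times> UNIV) (spray A g c)"
proof (rule loc_lip_vec)
  fix l
  let ?S = "crd c ` cdom c \<times> (UNIV :: (real^'n) set)"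
  have f: "loc_lip ?S fst"
    by (rule lipschitz_imp_loc_lip[of 1], rule lipschitz_onI) (simp_all add: dist_fst_le)
  have s: "loc_lip ?S (\<lambda>p. snd p $ i)" for i
    by (rule lipschitz_imp_loc_lip[of 1], rule lipschitz_onI)
       (simp_all add: order_trans[OF dist_vec_nth_le dist_snd_le])
  show "loc_lip ?S (\<lambda>p. spray A g c p $ l)"
    unfolding spray_def
    by (simp, intro loc_lip_sum loc_lip_mult s loc_lip_compose[OF f loc_lip_christoffel[OF c]]) auto
qed

text \<open>This is the Euler--Lagrange form of the geodesic equation, whose covariance follows from the
  chain rule.\<close>

lemma metric_form_spray:
  assumes c: "c \<in> A" "x \<in> cdom c"
  shows "metric_form A g c x (spray A g c (crd c x, y)) a =
    metric_deriv A g c (crd c x) y y a - 1 / 2 * metric_deriv A g c (crd c x) a y y"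
proof -
  define z where "z = crd c x"
  define G where "G = metric_matrix A g c z"
  define D where "D = (\<lambda>i j. frechet_derivative (\<lambda>w. metric_matrix A g c w $ i $ j) (at z))"
  define P where "P = (\<lambda>k i j. D i j (axis k 1))"
  have z: "z \<in> crd c ` cdom c" using c by (simp add: z_def)
  have D: "frechet_derivative (\<lambda>w. metric_matrix A g c w $ i $ j) (at z) h = (\<Sum>k\<in>UNIV. P k i j * h $ k)" for i j h
    unfolding P_def D_def
    by (subst linear_axis_expansion[OF metric_derivative_linear[OF c(1) z]]) (simp add: mult.commute)
  \<comment> \<open>\<kappa> consists of the Christoffel symbols of the first kind contracted twice
    with \<open>y\<close>; multiplication by the metric matrix cancels its inverse in the symbols of
    the second kind.\<close>
  define \<kappa> where "\<kappa> = (\<chi> m. \<Sum>i\<in>UNIV. \<Sum>j\<in>UNIV. 1 / 2 * (P i j m + P j i m - P m i j) * y $ i * y $ j)"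
  have "spray A g c (z, y) = matrix_inv G *v \<kappa>"
  proof (rule vec_eq_iff[THEN iffD2], rule allI)
    fix l
    have "spray A g c (z, y) $ l = (\<Sum>i\<in>UNIV. \<Sum>j\<in>UNIV. \<Sum>m\<in>UNIV.
        matrix_inv G $ l $ m * (1 / 2 * (P i j m + P j i m - P m i j) * y $ i * y $ j))"
      unfolding spray_def christoffel_def partial_def P_def D_def G_def
      by (simp add: sum_distrib_left sum_distrib_right mult_ac)
    also have "\<dots> = (\<Sum>m\<in>UNIV. matrix_inv G $ l $ m * \<kappa> $ m)"
    proof -
      have "\<And>F :: 'n \<Rightarrow> 'n \<Rightarrow> 'n \<Rightarrow> real. (\<Sum>i\<in>UNIV. \<Sum>j\<in>UNIV. \<Sum>m\<in>UNIV. F i j m) = (\<Sum>i\<in>UNIV. \<Sum>m\<in>UNIV. \<Sum>j\<in>UNIV. F i j m)"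
        by (intro sum.cong refl sum.swap)
      also have "\<And>F :: 'n \<Rightarrow> 'n \<Rightarrow> 'n \<Rightarrow> real. (\<Sum>i\<in>UNIV. \<Sum>m\<in>UNIV. \<Sum>j\<in>UNIV. F i j m) = (\<Sum>m\<in>UNIV. \<Sum>i\<in>UNIV. \<Sum>j\<in>UNIV. F i j m)"
        by (rule sum.swap)
      finally show ?thesis unfolding \<kappa>_def by (simp only: vec_lambda_beta sum_distrib_left)
    qed
    finally show "spray A g c (z, y) $ l = (matrix_inv G *v \<kappa>) $ l" by (simp add: matrix_vector_mult_def)
  qed
  moreover have "G ** matrix_inv G = mat 1"
    using metric_matrix_invertible[OF c] unfolding G_def z_def invertible_def matrix_inv_def
    by (metis (mono_tags, lifting) someI_ex)
  ultimately have "G *v spray A g c (z, y) = \<kappa>" by (simp add: matrix_vector_mul_assoc)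
  then have "metric_form A g c x (spray A g c (z, y)) a = a \<bullet> \<kappa>"
    using metric_form_matrix[OF c] metric_form_sym[OF c] by (simp add: G_def z_def)
  also have "\<dots> = (\<Sum>m\<in>UNIV. \<Sum>i\<in>UNIV. \<Sum>j\<in>UNIV.
      1 / 2 * (P i j m * y $ i * y $ j * a $ m) + 1 / 2 * (P j i m * y $ i * y $ j * a $ m)
      - 1 / 2 * (P m i j * y $ i * y $ j * a $ m))"
    unfolding \<kappa>_def inner_vec_def by (simp add: sum_distrib_left algebra_simps)
  also have "\<dots> = 1 / 2 * (\<Sum>m\<in>UNIV. \<Sum>i\<in>UNIV. \<Sum>j\<in>UNIV. P i j m * y $ i * y $ j * a $ m)
      + 1 / 2 * (\<Sum>m\<in>UNIV. \<Sum>i\<in>UNIV. \<Sum>j\<in>UNIV. P j i m * y $ i * y $ j * a $ m)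
      - 1 / 2 * (\<Sum>m\<in>UNIV. \<Sum>i\<in>UNIV. \<Sum>j\<in>UNIV. P m i j * y $ i * y $ j * a $ m)"
    by (simp only: sum.distrib sum_subtractf sum_distrib_left)
  \<comment> \<open>The first two sums differ only by the names of \<open>i\<close> and
    \<open>j\<close>, so the two halves add up to the full coefficient of
    \<open>metric_deriv A g c z y y a\<close>.\<close>
  also have "(\<Sum>m\<in>UNIV. \<Sum>i\<in>UNIV. \<Sum>j\<in>UNIV. P i j m * y $ i * y $ j * a $ m) =
      metric_deriv A g c z y y a"
  proof -
    have "metric_deriv A g c z y y a = (\<Sum>j\<in>UNIV. \<Sum>m\<in>UNIV. \<Sum>i\<in>UNIV. P i j m * y $ i * y $ j * a $ m)"
      unfolding metric_deriv_def D by (simp add: sum_distrib_right)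
    also have "\<dots> = (\<Sum>m\<in>UNIV. \<Sum>j\<in>UNIV. \<Sum>i\<in>UNIV. P i j m * y $ i * y $ j * a $ m)" by (rule sum.swap)
    also have "\<dots> = (\<Sum>m\<in>UNIV. \<Sum>i\<in>UNIV. \<Sum>j\<in>UNIV. P i j m * y $ i * y $ j * a $ m)"
      by (intro sum.cong refl sum.swap)
    finally show ?thesis by simp
  qed
  also have "(\<Sum>m\<in>UNIV. \<Sum>i\<in>UNIV. \<Sum>j\<in>UNIV. P j i m * y $ i * y $ j * a $ m) =
      metric_deriv A g c z y y a"
  proof -
    have "metric_deriv A g c z y y a = (\<Sum>i\<in>UNIV. \<Sum>m\<in>UNIV. \<Sum>j\<in>UNIV. P j i m * y $ i * y $ j * a $ m)"
      unfolding metric_deriv_def D by (simp add: sum_distrib_right sum_distrib_left mult_ac)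
    also have "\<dots> = (\<Sum>m\<in>UNIV. \<Sum>i\<in>UNIV. \<Sum>j\<in>UNIV. P j i m * y $ i * y $ j * a $ m)" by (rule sum.swap)
    finally show ?thesis by simp
  qed
  also have "(\<Sum>m\<in>UNIV. \<Sum>i\<in>UNIV. \<Sum>j\<in>UNIV. P m i j * y $ i * y $ j * a $ m) =
      metric_deriv A g c z a y y"
  proof -
    have "metric_deriv A g c z a y y = (\<Sum>i\<in>UNIV. \<Sum>j\<in>UNIV. \<Sum>m\<in>UNIV. P m i j * y $ i * y $ j * a $ m)"
      unfolding metric_deriv_def D by (simp add: sum_distrib_right sum_distrib_left mult_ac)
    also have "\<dots> = (\<Sum>i\<in>UNIV. \<Sum>m\<in>UNIV. \<Sum>j\<in>UNIV. P m i j * y $ i * y $ j * a $ m)"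
      by (intro sum.cong refl sum.swap)
    also have "\<dots> = (\<Sum>m\<in>UNIV. \<Sum>i\<in>UNIV. \<Sum>j\<in>UNIV. P m i j * y $ i * y $ j * a $ m)" by (rule sum.swap)
    finally show ?thesis by simp
  qed
  finally show ?thesis by (simp add: z_def)
qed

text \<open>The invariance of the metric, g(a, b) in one chart against g(\<open>\<tau>' a\<close>,
  \<open>\<tau>' b\<close>) in the other, is differentiated with \<open>a\<close> and
  \<open>b\<close> held constant in the chart \<open>c\<close>. The transformed vectors vary with
  the point, which produces the two terms with \<open>\<tau>''\<close>.\<close>

lemma metric_deriv_transition:
  assumes c: "c \<in> A" "x \<in> cdom c" and d: "d \<in> A" "x \<in> cdom d"
    and \<tau>: "\<And>z. z \<in> crd c ` (cdom c \<inter> cdom d) \<Longrightarrow> (transition c d has_derivative blinfun_apply (\<tau>' z)) (at z)"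
      "\<And>z. z \<in> crd c ` (cdom c \<inter> cdom d) \<Longrightarrow> (\<tau>' has_derivative blinfun_apply (\<tau>'' z)) (at z)"
  shows "metric_deriv A g c (crd c x) h a b =
    metric_deriv A g d (crd d x) (\<tau>' (crd c x) h) (\<tau>' (crd c x) a) (\<tau>' (crd c x) b)
    + metric_form A g d x (\<tau>'' (crd c x) h a) (\<tau>' (crd c x) b)
    + metric_form A g d x (\<tau>' (crd c x) a) (\<tau>'' (crd c x) h b)"
proof -
  define z where "z = crd c x"
  let ?S = "crd c ` (cdom c \<inter> cdom d)"
  have S: "open ?S" "z \<in> ?S"
    using chart_open_image_Int[OF chart[OF c(1)] chart_open_dom[OF chart[OF d(1)]]] c d by (auto simp: z_def)
  have \<tau>z: "transition c d z = crd d x" using c by (simp add: z_def transition_crd)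
  define m where "m = (\<lambda>w. \<Sum>i\<in>UNIV. \<Sum>j\<in>UNIV. metric_matrix A g c w $ i $ j * a $ i * b $ j)"
  have md: "(m has_derivative (\<lambda>h. metric_deriv A g c z h a b)) (at z)"
    unfolding m_def metric_deriv_def
    using S(2) by (intro has_derivative_sum has_derivative_mult_left metric_matrix_has_derivative c) auto
  define n where "n = (\<lambda>w. \<Sum>i\<in>UNIV. \<Sum>j\<in>UNIV. metric_matrix A g d (transition c d w) $ i $ j *
      \<tau>' w a $ i * \<tau>' w b $ j)"
  have mn: "n w = m w" if w: "w \<in> ?S" for w
  proof -
    obtain u where u: "w = crd c u" "u \<in> cdom c" "u \<in> cdom d" using w by blast
    have "jacobian c d u = blinfun_apply (\<tau>' w)"
      using has_derivative_unique[OF jacobian_has_derivative[OF c(1) d(1) u(2,3)]] \<tau>(1)[OF w] u by metis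
    then show ?thesis
      using metric_form_transition[OF c(1) d(1) u(2,3), of a b] metric_form_matrix[OF c(1) u(2)]
        metric_form_matrix[OF d(1) u(3)] u c
      by (simp add: m_def n_def inner_matrix_vector_mult transition_crd)
  qed
  have "(n has_derivative (\<lambda>h. \<Sum>i\<in>UNIV. \<Sum>j\<in>UNIV.
      frechet_derivative (\<lambda>w. metric_matrix A g d w $ i $ j) (at (crd d x)) (\<tau>' z h) * \<tau>' z a $ i * \<tau>' z b $ j
      + metric_matrix A g d (crd d x) $ i $ j * (\<tau>'' z h a $ i) * \<tau>' z b $ j
      + metric_matrix A g d (crd d x) $ i $ j * \<tau>' z a $ i * (\<tau>'' z h b $ j))) (at z)"
    unfolding n_def
  proof (intro has_derivative_sum)
    fix i j
    have 1: "((\<lambda>w. metric_matrix A g d (transition c d w) $ i $ j) has_derivative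
       (\<lambda>h. frechet_derivative (\<lambda>w. metric_matrix A g d w $ i $ j) (at (crd d x)) (\<tau>' z h))) (at z)"
      using has_derivative_compose[OF \<tau>(1)[OF S(2)], of "\<lambda>w. metric_matrix A g d w $ i $ j"]
        metric_matrix_has_derivative[OF d(1), of "crd d x" i j] d \<tau>z by auto
    have 2: "((\<lambda>w. \<tau>' w u $ k) has_derivative (\<lambda>h. \<tau>'' z h u $ k)) (at z)" for u k
    proof -
      have "((\<lambda>w. \<tau>' w u) has_derivative (\<lambda>h. \<tau>'' z h u)) (at z)"
        using \<tau>(2)[OF S(2)] by (auto intro!: derivative_eq_intros)
      then show ?thesis by (rule bounded_linear.has_derivative[OF bounded_linear_vec_nth])
    qed
    show "((\<lambda>w. metric_matrix A g d (transition c d w) $ i $ j * \<tau>' w a $ i * \<tau>' w b $ j) has_derivative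
      (\<lambda>h. frechet_derivative (\<lambda>w. metric_matrix A g d w $ i $ j) (at (crd d x)) (\<tau>' z h) * \<tau>' z a $ i * \<tau>' z b $ j
      + metric_matrix A g d (crd d x) $ i $ j * (\<tau>'' z h a $ i) * \<tau>' z b $ j
      + metric_matrix A g d (crd d x) $ i $ j * \<tau>' z a $ i * (\<tau>'' z h b $ j))) (at z)"
      using has_derivative_mult[OF has_derivative_mult[OF 1 2[of a i]] 2[of b j]]
      by (rule has_derivative_eq_rhs) (simp add: fun_eq_iff \<tau>z algebra_simps)
  qed
  then have "(m has_derivative (\<lambda>h. \<Sum>i\<in>UNIV. \<Sum>j\<in>UNIV.
      frechet_derivative (\<lambda>w. metric_matrix A g d w $ i $ j) (at (crd d x)) (\<tau>' z h) * \<tau>' z a $ i * \<tau>' z b $ j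
      + metric_matrix A g d (crd d x) $ i $ j * (\<tau>'' z h a $ i) * \<tau>' z b $ j
      + metric_matrix A g d (crd d x) $ i $ j * \<tau>' z a $ i * (\<tau>'' z h b $ j))) (at z)"
    by (rule has_derivative_transform_within_open[OF _ S]) (rule mn)
  from fun_cong[OF has_derivative_unique[OF md this], of h]
  have "metric_deriv A g c z h a b = (\<Sum>i\<in>UNIV. \<Sum>j\<in>UNIV.
      frechet_derivative (\<lambda>w. metric_matrix A g d w $ i $ j) (at (crd d x)) (\<tau>' z h) * \<tau>' z a $ i * \<tau>' z b $ j
      + metric_matrix A g d (crd d x) $ i $ j * (\<tau>'' z h a $ i) * \<tau>' z b $ j
      + metric_matrix A g d (crd d x) $ i $ j * \<tau>' z a $ i * (\<tau>'' z h b $ j))"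
    .
  then show ?thesis
    unfolding metric_form_matrix[OF d] inner_matrix_vector_mult metric_deriv_def z_def
    by (simp add: sum.distrib)
qed

text \<open>Both sides are tested with the metric against a vector \<open>b\<close>, written as
  \<open>\<tau>' a\<close>, and the Euler-Lagrange form is transformed. The variation of
  \<open>y\<close> in the first term and of \<open>a\<close> in the second yield terms with
  \<open>\<tau>'' y a\<close> and \<open>\<tau>'' a y\<close>, which cancel by symmetry of second
  derivatives. Only \<open>\<tau>'' y y\<close> survives, and nondegeneracy removes the test
  vector.\<close>

lemma spray_transition:
  assumes c: "c \<in> A" "x \<in> cdom c" and d: "d \<in> A" "x \<in> cdom d"
    and \<tau>: "\<And>z. z \<in> crd c ` (cdom c \<inter> cdom d) \<Longrightarrow> (transition c d has_derivative blinfun_apply (\<tau>' z)) (at z)"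
      "\<And>z. z \<in> crd c ` (cdom c \<inter> cdom d) \<Longrightarrow> (\<tau>' has_derivative blinfun_apply (\<tau>'' z)) (at z)"
      "continuous_on (crd c ` (cdom c \<inter> cdom d)) \<tau>''"
  shows "spray A g d (crd d x, \<tau>' (crd c x) y) =
    \<tau>' (crd c x) (spray A g c (crd c x, y)) - \<tau>'' (crd c x) y y"
proof -
  define z where "z = crd c x"
  let ?S = "crd c ` (cdom c \<inter> cdom d)"
  have S: "open ?S" "z \<in> ?S"
    using chart_open_image_Int[OF chart[OF c(1)] chart_open_dom[OF chart[OF d(1)]]] c d by (auto simp: z_def)
  have J: "jacobian c d x = blinfun_apply (\<tau>' z)"
    using has_derivative_unique[OF jacobian_has_derivative[OF c(1) d(1) c(2) d(2)]] \<tau>(1)[OF S(2)]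
    by (metis z_def)
  let ?m = "metric_form A g d x"
  have lin: "?m (u + v) w = ?m u w + ?m v w" "?m (u - v) w = ?m u w - ?m v w" for u v w
    using metric_form_bilinear[OF d] by (simp_all add: bilinear_ladd bilinear_lsub)
  have "spray A g d (crd d x, \<tau>' z y) + \<tau>'' z y y - \<tau>' z (spray A g c (z, y)) = 0"
  proof (rule metric_form_nondegenerate[OF d])
    fix b
    define a where "a = jacobian d c x b"
    have b: "b = \<tau>' z a"
      using jacobian_chain[OF d c d, of b] jacobian_self[OF d, of b] by (simp add: a_def J)
    have sym: "\<tau>'' z a y = \<tau>'' z y a"
      by (rule second_derivative_symmetric[OF S \<tau>])
    have "?m (\<tau>' z (spray A g c (z, y))) b = metric_form A g c x (spray A g c (z, y)) a"
      by (simp add: b metric_form_transition[OF c(1) d(1) c(2) d(2)] J)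
    also have "\<dots> = metric_deriv A g c z y y a - 1 / 2 * metric_deriv A g c z a y y"
      using metric_form_spray[OF c, of y a] by (simp add: z_def)
    also have "\<dots> = metric_deriv A g d (crd d x) (\<tau>' z y) (\<tau>' z y) b
        - 1 / 2 * metric_deriv A g d (crd d x) b (\<tau>' z y) (\<tau>' z y) + ?m (\<tau>'' z y y) b"
      using metric_deriv_transition[OF c d \<tau>(1,2), of y y a] metric_deriv_transition[OF c d \<tau>(1,2), of a y y]
        metric_form_sym[OF d, of "\<tau>'' z y a" "\<tau>' z y"]
      by (simp add: z_def[symmetric] b sym add_divide_distrib diff_divide_distrib)
    also have "\<dots> = ?m (spray A g d (crd d x, \<tau>' z y)) b + ?m (\<tau>'' z y y) b"
      using metric_form_spray[OF d, of "\<tau>' z y" b] by simp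
    finally show "?m (spray A g d (crd d x, \<tau>' z y) + \<tau>'' z y y - \<tau>' z (spray A g c (z, y))) b = 0"
      by (simp add: lin)
  qed
  then show ?thesis by (simp add: z_def algebra_simps)
qed

end

section \<open>Geodesics\<close>

lemma isCont_eventually_in:
  assumes "isCont f t" "open X" "f t \<in> X"
  shows "\<forall>\<^sub>F s in nhds t. f s \<in> X"
  using assms unfolding isCont_def tendsto_at_iff_tendsto_nhds by (rule topological_tendstoD)

lemma spray_scaleR: "spray A g c (z, r *\<^sub>R y) = r\<^sup>2 *\<^sub>R spray A g c (z, y)"
  unfolding spray_def vec_eq_iff
  by (simp add: sum_distrib_left power2_eq_square mult_ac)

lemma geodesic_on_spray:
  "geodesic_on A g I \<gamma> \<longleftrightarrow> continuous_on I \<gamma> \<and>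
    (\<forall>c\<in>A. \<exists>y. \<forall>t\<in>I. \<gamma> t \<in> cdom c \<longrightarrow>
      ((crd c \<circ> \<gamma>) has_vector_derivative y t) (at t) \<and>
      (y has_vector_derivative - spray A g c (crd c (\<gamma> t), y t)) (at t))"
proof -
  have "(\<chi> l. - (\<Sum>i\<in>UNIV. \<Sum>j\<in>UNIV. christoffel A g c l i j z * y $ i * y $ j)) = - spray A g c (z, y)"
    for c z y
    by (simp add: spray_def vec_eq_iff)
  then show ?thesis unfolding geodesic_on_def by simp
qed

lemma has_vector_derivative_compose_mult:
  assumes "(f has_vector_derivative f') (at (r * t))"
  shows "((\<lambda>s. f (r * s)) has_vector_derivative r *\<^sub>R f') (at t)"
proof -
  have "((\<lambda>s. r * s) has_vector_derivative r) (at t)"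
    by (auto intro!: derivative_eq_intros)
  from vector_diff_chain_at[OF this, of f f'] assms show ?thesis by (simp add: o_def)
qed

text \<open>Applied to the difference of two geodesics in a chart: where they meet with different
  velocities, they separate at once.\<close>

lemma isolated_zero_of_nonzero_derivative:
  fixes f :: "real \<Rightarrow> 'a::real_normed_vector"
  assumes f: "(f has_vector_derivative f') (at t)" "f t = 0" "f' \<noteq> 0"
  shows "\<forall>\<^sub>F s in at t. f s \<noteq> 0"
proof -
  have "((\<lambda>s. (f s - f t) /\<^sub>R (s - t)) \<longlongrightarrow> f') (at t)"
  proof -
    have "((\<lambda>s. norm ((f s - f t) /\<^sub>R (s - t) - f')) \<longlongrightarrow> 0) (at t)"
    proof (rule Lim_transform_eventually)
      show "((\<lambda>s. norm (f s - f t - (s - t) *\<^sub>R f') / norm (s - t)) \<longlongrightarrow> 0) (at t)"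
        using f(1) unfolding has_vector_derivative_def has_derivative_iff_norm by simp
      show "\<forall>\<^sub>F s in at t. norm (f s - f t - (s - t) *\<^sub>R f') / norm (s - t) = norm ((f s - f t) /\<^sub>R (s - t) - f')"
        using eventually_neq_at_within[of t t UNIV]
      proof eventually_elim
        case (elim s)
        then have "(f s - f t) /\<^sub>R (s - t) - f' = (f s - f t - (s - t) *\<^sub>R f') /\<^sub>R (s - t)"
          by (simp add: scaleR_diff_right)
        then show ?case by (simp add: divide_inverse mult.commute)
      qed
    qed
    then show ?thesis using tendsto_norm_zero_iff LIM_zero_iff by blast
  qed
  then have "\<forall>\<^sub>F s in at t. (f s - f t) /\<^sub>R (s - t) \<noteq> 0"
    using f(3) tendsto_imp_eventually_ne by blast
  then show ?thesis using f(2) by (auto elim!: eventually_mono)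
qed

context semi_riemannian_manifold
begin

section \<open>From one chart to the whole atlas\<close>

lemma chart_curve_derivative:
  assumes c: "c \<in> A" and d: "d \<in> A"
    and \<tau>: "\<And>z. z \<in> crd c ` (cdom c \<inter> cdom d) \<Longrightarrow> (transition c d has_derivative blinfun_apply (\<tau>' z)) (at z)"
    and z: "z t \<in> crd c ` cdom c" "cinv c (z t) \<in> cdom d" "(z has_vector_derivative y) (at t)"
  shows "((crd d \<circ> (cinv c \<circ> z)) has_vector_derivative \<tau>' (z t) y) (at t)"
proof -
  have "z t \<in> crd c ` (cdom c \<inter> cdom d)"
    using z(1,2) unfolding chart_image_Int[OF chart[OF c]] by blast
  from vector_derivative_composition[where c=z and t=t, OF \<tau>[OF this] z(3)]
  show ?thesis by (simp add: transition_def o_def)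
qed

text \<open>The geodesic equation is demanded in every chart of the atlas. The chart velocity
  transforms by \<open>\<tau>'\<close>, and the term with \<open>\<tau>''\<close> from
  differentiating it is the one that \<open>spray_transition\<close> compensates.\<close>

lemma geodesic_of_chart_solution:
  assumes c: "c \<in> A"
    and sol: "\<And>t. t \<in> J \<Longrightarrow> z t \<in> crd c ` cdom c \<and> (z has_vector_derivative y t) (at t) \<and>
      (y has_vector_derivative - spray A g c (z t, y t)) (at t)"
  shows "geodesic_on A g J (cinv c \<circ> z)"
  unfolding geodesic_on_spray
proof (intro conjI ballI)
  have "continuous_on J z"
    using sol has_vector_derivative_continuous by (intro continuous_at_imp_continuous_on) blast
  then show "continuous_on J (cinv c \<circ> z)"
    using sol chart_continuous(2)[OF chart[OF c]]
    by (intro continuous_on_compose) (auto intro: continuous_on_subset)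
  fix d assume d: "d \<in> A"
  from C2_onE[OF transition_C2[OF c d]] obtain \<tau>' \<tau>''
    where \<tau>: "\<And>z. z \<in> crd c ` (cdom c \<inter> cdom d) \<Longrightarrow> (transition c d has_derivative blinfun_apply (\<tau>' z)) (at z)"
      "\<And>z. z \<in> crd c ` (cdom c \<inter> cdom d) \<Longrightarrow> (\<tau>' has_derivative blinfun_apply (\<tau>'' z)) (at z)"
      "continuous_on (crd c ` (cdom c \<inter> cdom d)) \<tau>''" by metis
  show "\<exists>w. \<forall>t\<in>J. (cinv c \<circ> z) t \<in> cdom d \<longrightarrow>
      ((crd d \<circ> (cinv c \<circ> z)) has_vector_derivative w t) (at t) \<and>
      (w has_vector_derivative - spray A g d (crd d ((cinv c \<circ> z) t), w t)) (at t)"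
  proof (intro exI[of _ "\<lambda>t. \<tau>' (z t) (y t)"] ballI impI conjI)
    fix t assume t: "t \<in> J" and "(cinv c \<circ> z) t \<in> cdom d"
    then have td: "cinv c (z t) \<in> cdom d" by simp
    have zt: "z t \<in> crd c ` cdom c" "(z has_vector_derivative y t) (at t)"
      "(y has_vector_derivative - spray A g c (z t, y t)) (at t)" using sol[OF t] by auto
    show "((crd d \<circ> (cinv c \<circ> z)) has_vector_derivative \<tau>' (z t) (y t)) (at t)"
      by (rule chart_curve_derivative[OF c d \<tau>(1) zt(1) td zt(2)])
    have xc: "cinv c (z t) \<in> cdom c" "crd c (cinv c (z t)) = z t"
      using zt chart_cinv_in[OF chart[OF c]] chart_crd_cinv[OF chart[OF c]] by auto
    have "z t \<in> crd c ` (cdom c \<inter> cdom d)"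
      using zt(1) td unfolding chart_image_Int[OF chart[OF c]] by blast
    from vector_derivative_composition[where c=z and t=t, OF \<tau>(2)[OF this] zt(2)]
    have "((\<lambda>s. \<tau>' (z s)) has_vector_derivative \<tau>'' (z t) (y t)) (at t)" .
    from has_vector_derivative_blinfun_apply[OF this zt(3)]
    have "((\<lambda>t. \<tau>' (z t) (y t)) has_vector_derivative
        \<tau>' (z t) (- spray A g c (z t, y t)) + \<tau>'' (z t) (y t) (y t)) (at t)" .
    then show "((\<lambda>t. \<tau>' (z t) (y t)) has_vector_derivative
        - spray A g d (crd d ((cinv c \<circ> z) t), \<tau>' (z t) (y t))) (at t)"
      using spray_transition[OF c xc(1) d td \<tau>, of "y t"] xc(2)
      by (simp add: blinfun.bilinear_simps)
  qed
qed

lemma C1_curve_of_chart_curve: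
  assumes c: "c \<in> A"
    and \<beta>: "\<And>t. t \<in> J \<Longrightarrow> \<beta> t \<in> crd c ` cdom c \<and> (\<beta> has_vector_derivative \<beta>' t) (at t)"
    and cont: "continuous_on J \<beta>'"
  shows "C1_curve_on A J (cinv c \<circ> \<beta>)"
  unfolding C1_curve_on_def
proof (intro conjI ballI)
  have \<beta>c: "continuous_on J \<beta>"
    using \<beta> has_vector_derivative_continuous by (intro continuous_at_imp_continuous_on) blast
  then show "continuous_on J (cinv c \<circ> \<beta>)"
    using \<beta> chart_continuous(2)[OF chart[OF c]]
    by (intro continuous_on_compose) (auto intro: continuous_on_subset)
  fix d assume d: "d \<in> A"
  from C2_onE[OF transition_C2[OF c d]] obtain \<tau>'
    where \<tau>: "\<And>z. z \<in> crd c ` (cdom c \<inter> cdom d) \<Longrightarrow> (transition c d has_derivative blinfun_apply (\<tau>' z)) (at z)"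
      "continuous_on (crd c ` (cdom c \<inter> cdom d)) \<tau>'" by metis
  let ?J = "{t \<in> J. (cinv c \<circ> \<beta>) t \<in> cdom d}"
  show "(crd d \<circ> (cinv c \<circ> \<beta>)) C1_differentiable_on ?J"
    unfolding C1_differentiable_on_def
  proof (intro exI[of _ "\<lambda>t. \<tau>' (\<beta> t) (\<beta>' t)"] conjI ballI)
    fix t assume "t \<in> ?J"
    then show "((crd d \<circ> (cinv c \<circ> \<beta>)) has_vector_derivative \<tau>' (\<beta> t) (\<beta>' t)) (at t)"
      using \<beta>[of t] by (intro chart_curve_derivative[OF c d \<tau>(1)]) auto
  next
    have "\<beta> ` ?J \<subseteq> crd c ` (cdom c \<inter> cdom d)"
      using \<beta> unfolding chart_image_Int[OF chart[OF c]] by auto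
    then have "continuous_on ?J (\<lambda>t. \<tau>' (\<beta> t))"
      using \<beta>c by (intro continuous_on_compose2[OF \<tau>(2)]) (auto intro: continuous_on_subset)
    then show "continuous_on ?J (\<lambda>t. \<tau>' (\<beta> t) (\<beta>' t))"
      using cont by (intro continuous_intros) (auto intro: continuous_on_subset)
  qed
qed

lemma velocity_of_chart_solution:
  assumes c: "c \<in> A" and z: "z t \<in> crd c ` cdom c" "(z has_vector_derivative a) (at t)"
  shows "has_velocity A (cinv c \<circ> z) t (tvec_of A c (cinv c (z t)) a)"
proof -
  note ch = chart[OF c]
  have in_c: "cinv c (z t) \<in> cdom c" using z chart_cinv_in[OF ch] by blast
  have zc: "isCont z t" using z(2) has_vector_derivative_continuous by blast
  have "isCont (cinv c) (z t)"
    using chart_continuous(2)[OF ch] chart_open_image[OF ch] z(1) continuous_on_eq_continuous_at by blast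
  then have cont: "isCont (cinv c \<circ> z) t" using zc by (intro continuous_at_compose)
  have "\<forall>\<^sub>F s in nhds t. z s \<in> crd c ` cdom c"
    using zc z(1) chart_open_image[OF ch] by (intro isCont_eventually_in)
  then have "\<forall>\<^sub>F s in nhds t. (crd c \<circ> (cinv c \<circ> z)) s = z s"
    by eventually_elim (simp add: chart_crd_cinv[OF ch])
  then have "((crd c \<circ> (cinv c \<circ> z)) has_vector_derivative a) (at t)"
    using has_vector_derivative_cong_ev[where f="crd c \<circ> (cinv c \<circ> z)" and g=z and x=t and S=UNIV] z
    by (simp add: chart_crd_cinv[OF ch])
  from velocity_of_chart_curve[OF c _ cont this] in_c show ?thesis by simp
qed

text \<open>The spray is homogeneous of degree two in the velocity, as is the second derivative
  under a change of the time scale. The case of a vanishing factor, a constant curve, is included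
  and is used at the start of a geodesic.\<close>

lemma geodesic_on_rescale:
  assumes \<gamma>: "geodesic_on A g I \<gamma>"
  shows "geodesic_on A g {t. r * t \<in> I} (\<lambda>t. \<gamma> (r * t))"
  unfolding geodesic_on_spray
proof (intro conjI ballI)
  show "continuous_on {t. r * t \<in> I} (\<lambda>t. \<gamma> (r * t))"
    using \<gamma> unfolding geodesic_on_def
    by (auto intro!: continuous_on_compose2[of I \<gamma>] continuous_intros)
  fix c assume "c \<in> A"
  then obtain y where y: "\<And>t. t \<in> I \<Longrightarrow> \<gamma> t \<in> cdom c \<Longrightarrow>
      ((crd c \<circ> \<gamma>) has_vector_derivative y t) (at t) \<and>
      (y has_vector_derivative - spray A g c (crd c (\<gamma> t), y t)) (at t)"
    using \<gamma> unfolding geodesic_on_spray by blast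
  show "\<exists>w. \<forall>t\<in>{t. r * t \<in> I}. \<gamma> (r * t) \<in> cdom c \<longrightarrow>
      ((crd c \<circ> (\<lambda>t. \<gamma> (r * t))) has_vector_derivative w t) (at t) \<and>
      (w has_vector_derivative - spray A g c (crd c (\<gamma> (r * t)), w t)) (at t)"
  proof (intro exI[of _ "\<lambda>t. r *\<^sub>R y (r * t)"] ballI impI)
    fix t assume "t \<in> {t. r * t \<in> I}" "\<gamma> (r * t) \<in> cdom c"
    then have Y: "((crd c \<circ> \<gamma>) has_vector_derivative y (r * t)) (at (r * t))"
      "(y has_vector_derivative - spray A g c (crd c (\<gamma> (r * t)), y (r * t))) (at (r * t))"
      using y by auto
    have "((\<lambda>s. r *\<^sub>R y (r * s)) has_vector_derivative
        r *\<^sub>R (r *\<^sub>R - spray A g c (crd c (\<gamma> (r * t)), y (r * t)))) (at t)"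
      by (rule bounded_linear.has_vector_derivative[OF bounded_linear_scaleR_right
            has_vector_derivative_compose_mult[OF Y(2)]])
    then show "((crd c \<circ> (\<lambda>t. \<gamma> (r * t))) has_vector_derivative r *\<^sub>R y (r * t)) (at t) \<and>
      ((\<lambda>t. r *\<^sub>R y (r * t)) has_vector_derivative - spray A g c (crd c (\<gamma> (r * t)), r *\<^sub>R y (r * t))) (at t)"
      using has_vector_derivative_compose_mult[OF Y(1)]
      by (simp add: o_def spray_scaleR power2_eq_square)
  qed
qed

lemma has_velocity_rescale:
  assumes "has_velocity A \<gamma> (r * t) v"
  shows "has_velocity A (\<lambda>t. \<gamma> (r * t)) t (\<lambda>d. r *\<^sub>R v d)"
  unfolding has_velocity_def
proof (intro conjI ballI)
  show "(\<lambda>d. r *\<^sub>R v d) \<in> tangent_space A (\<gamma> (r * t))"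
    using assms tangent_space_scaleR unfolding has_velocity_def by blast
  fix c assume "c \<in> charts_at A (\<gamma> (r * t))"
  then have "((crd c \<circ> \<gamma>) has_vector_derivative v c) (at (r * t))"
    using assms unfolding has_velocity_def by blast
  from has_vector_derivative_compose_mult[OF this]
  show "((crd c \<circ> (\<lambda>t. \<gamma> (r * t))) has_vector_derivative r *\<^sub>R v c) (at t)"
    by (simp add: o_def)
qed

text \<open>In the chart, the differences of positions and velocities form a vector \<open>w\<close>
  whose derivative is bounded by \<open>(1 + L) * norm (w t)\<close>: the first component of
  \<open>w'\<close> is the second one of \<open>w\<close>, and the second is controlled by the
  Lipschitz constant \<open>L\<close> of the spray. Gronwall's inequality then gives zero.\<close>

lemma geodesic_locally_unique:
  assumes \<gamma>1: "geodesic_on A g I \<gamma>1" and \<gamma>2: "geodesic_on A g I \<gamma>2"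
    and I: "open I" "t0 \<in> I" and eq: "\<gamma>1 t0 = \<gamma>2 t0"
    and c: "c \<in> A" "\<gamma>1 t0 \<in> cdom c"
    and v: "((crd c \<circ> \<gamma>1) has_vector_derivative v) (at t0)" "((crd c \<circ> \<gamma>2) has_vector_derivative v) (at t0)"
  shows "\<forall>\<^sub>F t in nhds t0. \<gamma>1 t = \<gamma>2 t"
proof -
  note ch = chart[OF c(1)]
  let ?S = "crd c ` cdom c \<times> (UNIV :: (real^'n) set)"
  have "\<exists>y. \<forall>t\<in>I. \<gamma> t \<in> cdom c \<longrightarrow>
      ((crd c \<circ> \<gamma>) has_vector_derivative y t) (at t) \<and>
      (y has_vector_derivative - spray A g c (crd c (\<gamma> t), y t)) (at t)"
    if "geodesic_on A g I \<gamma>" for \<gamma>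
    using that c unfolding geodesic_on_spray by blast
  with \<gamma>1 \<gamma>2 obtain y1 y2 where
    y1: "\<And>t. t \<in> I \<Longrightarrow> \<gamma>1 t \<in> cdom c \<Longrightarrow> ((crd c \<circ> \<gamma>1) has_vector_derivative y1 t) (at t) \<and>
      (y1 has_vector_derivative - spray A g c (crd c (\<gamma>1 t), y1 t)) (at t)" and
    y2: "\<And>t. t \<in> I \<Longrightarrow> \<gamma>2 t \<in> cdom c \<Longrightarrow> ((crd c \<circ> \<gamma>2) has_vector_derivative y2 t) (at t) \<and>
      (y2 has_vector_derivative - spray A g c (crd c (\<gamma>2 t), y2 t)) (at t)"
    by metis
  have yv: "y1 t0 = v" "y2 t0 = v"
    using y1[of t0] y2[of t0] I c eq v vector_derivative_unique_at by metis+
  define p0 where "p0 = (crd c (\<gamma>1 t0), v)"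
  have "p0 \<in> ?S" using c by (simp add: p0_def)
  then obtain r L where r: "r > 0" and L: "L-lipschitz_on (?S \<inter> ball p0 r) (spray A g c)"
    using loc_lip_spray[OF c(1)] unfolding loc_lip_def by blast
  have near: "\<forall>\<^sub>F t in nhds t0. t \<in> I \<and> \<gamma> t \<in> cdom c \<and> (crd c (\<gamma> t), y t) \<in> ball p0 r"
    if \<gamma>: "geodesic_on A g I \<gamma>" and y: "\<And>t. t \<in> I \<Longrightarrow> \<gamma> t \<in> cdom c \<Longrightarrow> ((crd c \<circ> \<gamma>) has_vector_derivative y t) (at t) \<and>
      (y has_vector_derivative - spray A g c (crd c (\<gamma> t), y t)) (at t)"
      and "\<gamma> t0 = \<gamma>1 t0" "y t0 = v" for \<gamma> y
  proof -
    have "isCont \<gamma> t0"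
      using \<gamma> I unfolding geodesic_on_def by (simp add: continuous_on_eq_continuous_at)
    then have 1: "\<forall>\<^sub>F t in nhds t0. \<gamma> t \<in> cdom c"
      using that c by (intro chart_eventually_in[OF ch]) auto
    have "((crd c \<circ> \<gamma>) has_vector_derivative y t0) (at t0)" "(y has_vector_derivative - spray A g c (crd c (\<gamma> t0), y t0)) (at t0)"
      using y[of t0] I c that by auto
    then have "isCont (crd c \<circ> \<gamma>) t0" "isCont y t0"
      using has_vector_derivative_continuous by blast+
    then have "isCont (\<lambda>t. ((crd c \<circ> \<gamma>) t, y t)) t0" by (rule continuous_Pair)
    moreover have "((crd c \<circ> \<gamma>) t0, y t0) = p0" using that by (simp add: p0_def)
    ultimately have "\<forall>\<^sub>F t in nhds t0. ((crd c \<circ> \<gamma>) t, y t) \<in> ball p0 r"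
      using r by (intro isCont_eventually_in) auto
    moreover have "\<forall>\<^sub>F t in nhds t0. t \<in> I" using I by (simp add: eventually_nhds_in_open)
    ultimately show ?thesis using 1 by eventually_elim simp
  qed
  have "\<forall>\<^sub>F t in nhds t0. t \<in> I \<and> (\<gamma>1 t \<in> cdom c \<and> (crd c (\<gamma>1 t), y1 t) \<in> ball p0 r) \<and>
      (\<gamma>2 t \<in> cdom c \<and> (crd c (\<gamma>2 t), y2 t) \<in> ball p0 r)"
  proof -
    have "\<forall>\<^sub>F t in nhds t0. t \<in> I \<and> \<gamma>1 t \<in> cdom c \<and> (crd c (\<gamma>1 t), y1 t) \<in> ball p0 r"
      by (rule near[OF \<gamma>1]) (use y1 yv in auto)
    moreover have "\<forall>\<^sub>F t in nhds t0. t \<in> I \<and> \<gamma>2 t \<in> cdom c \<and> (crd c (\<gamma>2 t), y2 t) \<in> ball p0 r"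
      by (rule near[OF \<gamma>2]) (use y2 yv eq in auto)
    ultimately show ?thesis by eventually_elim simp
  qed
  then obtain e where e: "e > 0" and E: "\<And>t. dist t t0 < e \<Longrightarrow> t \<in> I \<and> (\<gamma>1 t \<in> cdom c \<and> (crd c (\<gamma>1 t), y1 t) \<in> ball p0 r) \<and>
      (\<gamma>2 t \<in> cdom c \<and> (crd c (\<gamma>2 t), y2 t) \<in> ball p0 r)"
    unfolding eventually_nhds_metric by blast
  define z1 where "z1 = crd c \<circ> \<gamma>1"
  define z2 where "z2 = crd c \<circ> \<gamma>2"
  define w where "w = (\<lambda>t. (z1 t - z2 t, y1 t - y2 t))"
  define w' where "w' = (\<lambda>t. (y1 t - y2 t, - spray A g c (z1 t, y1 t) - (- spray A g c (z2 t, y2 t))))"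
  have ode: "(w has_vector_derivative w' t) (at t) \<and> norm (w' t) \<le> (1 + L) * norm (w t)"
    if "t \<in> {t0 - e<..<t0 + e}" for t
  proof -
    have "dist t t0 < e" using that by (simp add: dist_real_def abs_less_iff)
    note E = E[OF this]
    have D: "(z1 has_vector_derivative y1 t) (at t)" "(y1 has_vector_derivative - spray A g c (z1 t, y1 t)) (at t)"
      "(z2 has_vector_derivative y2 t) (at t)" "(y2 has_vector_derivative - spray A g c (z2 t, y2 t)) (at t)"
      using y1[of t] y2[of t] E by (auto simp: z1_def z2_def)
    have "(w has_vector_derivative w' t) (at t)"
      unfolding w_def w'_def
      by (intro has_vector_derivative_Pair has_vector_derivative_diff D)
    have "norm (spray A g c (z1 t, y1 t) - spray A g c (z2 t, y2 t)) \<le> L * norm ((z1 t, y1 t) - (z2 t, y2 t))"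
      using E by (intro lipschitz_on_normD[OF L]) (auto simp: z1_def z2_def)
    also have "(z1 t, y1 t) - (z2 t, y2 t) = w t" by (simp add: w_def)
    finally have "norm (- spray A g c (z1 t, y1 t) - (- spray A g c (z2 t, y2 t))) \<le> L * norm (w t)"
      by (simp add: norm_minus_commute)
    moreover have "norm (y1 t - y2 t) \<le> norm (w t)"
      unfolding w_def using norm_snd_le[of "y1 t - y2 t" "z1 t - z2 t"] by simp
    ultimately have "norm (w' t) \<le> (1 + L) * norm (w t)"
      unfolding w'_def using norm_Pair_le[of "y1 t - y2 t" "- spray A g c (z1 t, y1 t) - (- spray A g c (z2 t, y2 t))"]
      by (simp add: algebra_simps)
    with \<open>(w has_vector_derivative w' t) (at t)\<close> show ?thesis by blast
  qed
  have "w t0 = 0" using eq yv by (simp add: w_def z1_def z2_def zero_prod_def)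
  moreover have "t0 \<in> {t0 - e<..<t0 + e}" using e by simp
  ultimately have w0: "w t = 0" if "t \<in> {t0 - e<..<t0 + e}" for t
    using gronwall_zero[where w=w and w'=w' and L="1 + L"] ode that by blast
  show ?thesis
    unfolding eventually_nhds_metric
  proof (intro exI[of _ e] conjI e allI impI)
    fix t assume t: "dist t t0 < e"
    then have "w t = 0" by (intro w0) (simp add: dist_real_def abs_less_iff)
    then have "crd c (\<gamma>1 t) = crd c (\<gamma>2 t)" by (simp add: w_def z1_def z2_def zero_prod_def)
    then show "\<gamma>1 t = \<gamma>2 t" using E[OF t] chart_cinv_crd[OF ch] by metis
  qed
qed

section \<open>Global uniqueness and the exponential map\<close>

lemma geodesic_on_subset: "geodesic_on A g I \<gamma> \<Longrightarrow> J \<subseteq> I \<Longrightarrow> geodesic_on A g J \<gamma>"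
  unfolding geodesic_on_def by (meson continuous_on_subset subset_iff)

text \<open>A continuation argument on the connected set \<open>I\<close>. \<open>T\<close> requires
  agreement near the time, not only at it, and so is open. Its complement is open as well: curves at
  different points are kept apart by the Hausdorff property, and curves that meet at a time outside
  \<open>T\<close> do so with different velocities.\<close>

lemma geodesic_unique:
  assumes \<gamma>1: "geodesic_on A g I \<gamma>1" and \<gamma>2: "geodesic_on A g I \<gamma>2"
    and I: "open I" "connected I" "t0 \<in> I" and v: "has_velocity A \<gamma>1 t0 v" "has_velocity A \<gamma>2 t0 v"
    and eq: "\<gamma>1 t0 = \<gamma>2 t0" and t: "t \<in> I"
  shows "\<gamma>1 t = \<gamma>2 t"
proof -
  define T where "T = {t \<in> I. \<forall>\<^sub>F s in nhds t. \<gamma>1 s = \<gamma>2 s}"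
  have cont: "isCont \<gamma>1 s" "isCont \<gamma>2 s" if "s \<in> I" for s
    using \<gamma>1 \<gamma>2 I that unfolding geodesic_on_def by (auto simp: continuous_on_eq_continuous_at)
  have "open T"
  proof (subst open_subopen, intro ballI)
    fix s assume "s \<in> T"
    then obtain O' where "open O'" "s \<in> O'" "\<And>u. u \<in> O' \<Longrightarrow> \<gamma>1 u = \<gamma>2 u"
      unfolding T_def eventually_nhds by blast
    then show "\<exists>S. open S \<and> s \<in> S \<and> S \<subseteq> T"
      using I \<open>s \<in> T\<close> unfolding T_def eventually_nhds
      by (intro exI[of _ "O' \<inter> I"]) auto
  qed
  have "t0 \<in> T"
  proof -
    obtain c where c: "c \<in> A" "\<gamma>1 t0 \<in> cdom c" using charts_at_nonempty by blast
    then have "c \<in> charts_at A (\<gamma>1 t0)" "c \<in> charts_at A (\<gamma>2 t0)"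
      using eq by (auto simp: charts_at_def)
    then have "((crd c \<circ> \<gamma>1) has_vector_derivative v c) (at t0)" "((crd c \<circ> \<gamma>2) has_vector_derivative v c) (at t0)"
      using v unfolding has_velocity_def by blast+
    from geodesic_locally_unique[OF \<gamma>1 \<gamma>2 I(1,3) eq c this] show ?thesis
      using I(3) unfolding T_def by blast
  qed
  have "open (I - T)"
  proof (subst open_subopen, intro ballI)
    fix s assume s: "s \<in> I - T"
    have "\<forall>\<^sub>F u in nhds s. u \<notin> T"
    proof (cases "\<gamma>1 s = \<gamma>2 s")
      case False
      then obtain X Y where XY: "open X" "open Y" "\<gamma>1 s \<in> X" "\<gamma>2 s \<in> Y" "X \<inter> Y = {}"
        using hausdorff[OF False] by metis
      have "\<forall>\<^sub>F u in nhds s. \<gamma>1 u \<in> X" "\<forall>\<^sub>F u in nhds s. \<gamma>2 u \<in> Y"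
        using cont[of s] s XY isCont_eventually_in by blast+
      then show ?thesis
      proof eventually_elim
        case (elim u)
        then have "\<gamma>1 u \<noteq> \<gamma>2 u" using XY by auto
        then show ?case unfolding T_def using eventually_nhds_x_imp_x by blast
      qed
    next
      case True
      obtain c where c: "c \<in> A" "\<gamma>1 s \<in> cdom c" using charts_at_nonempty by blast
      obtain v1 v2 where v12: "((crd c \<circ> \<gamma>1) has_vector_derivative v1) (at s)" "((crd c \<circ> \<gamma>2) has_vector_derivative v2) (at s)"
        using \<gamma>1 \<gamma>2 c s True unfolding geodesic_on_spray by (metis DiffD1)
      \<comment> \<open>With equal velocities local uniqueness would put \<open>s\<close> into
        \<open>T\<close>. Different velocities make the meeting isolated, so no nearby time belongs
        to \<open>T\<close>.\<close>
      have "v1 \<noteq> v2"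
      proof
        assume "v1 = v2"
        then have "s \<in> T"
          using geodesic_locally_unique[OF \<gamma>1 \<gamma>2 I(1) _ True c v12(1)] v12 s unfolding T_def by blast
        then show False using s by simp
      qed
      then have "\<forall>\<^sub>F u in at s. (crd c \<circ> \<gamma>1) u - (crd c \<circ> \<gamma>2) u \<noteq> 0"
        using True by (intro isolated_zero_of_nonzero_derivative[OF has_vector_derivative_diff[OF v12]]) auto
      then have "\<forall>\<^sub>F u in at s. u \<notin> T"
      proof eventually_elim
        case (elim u)
        then have "\<gamma>1 u \<noteq> \<gamma>2 u" by auto
        then show ?case unfolding T_def using eventually_nhds_x_imp_x by blast
      qed
      then show ?thesis using s by (auto simp: eventually_at_filter elim: eventually_mono)
    qed
    then obtain O' where "open O'" "s \<in> O'" "\<And>u. u \<in> O' \<Longrightarrow> u \<notin> T"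
      unfolding eventually_nhds by blast
    then show "\<exists>S. open S \<and> s \<in> S \<and> S \<subseteq> I - T"
      using I s by (intro exI[of _ "O' \<inter> I"]) auto
  qed
  then have "I - T = {}"
    using connectedD[OF I(2) \<open>open T\<close>, of "I - T"] \<open>t0 \<in> T\<close> I(3) unfolding T_def by blast
  then have "t \<in> T" using t by blast
  then show ?thesis unfolding T_def using eventually_nhds_x_imp_x by blast
qed

text \<open>The definite description has a unique solution: two geodesics with the same initial
  velocity agree on the intersection of their intervals, which is again an interval and contains 0
  and 1.\<close>

lemma exp_map_eq:
  assumes "exp_reaches A g x v q"
  shows "exp_map A g x v = q"
  unfolding exp_map_def
proof (rule the_equality, rule assms)
  fix q' assume "exp_reaches A g x v q'"
  with assms obtain I J \<gamma> \<delta> where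
    \<gamma>: "open I" "is_interval I" "{0..1} \<subseteq> I" "geodesic_on A g I \<gamma>" "\<gamma> 0 = x" "has_velocity A \<gamma> 0 v" "\<gamma> 1 = q" and
    \<delta>: "open J" "is_interval J" "{0..1} \<subseteq> J" "geodesic_on A g J \<delta>" "\<delta> 0 = x" "has_velocity A \<delta> 0 v" "\<delta> 1 = q'"
    unfolding exp_reaches_def by metis
  have "connected (I \<inter> J)" using \<gamma>(2) \<delta>(2) is_interval_Int is_interval_connected by blast
  moreover have "0 \<in> I \<inter> J" "1 \<in> I \<inter> J" using \<gamma>(3) \<delta>(3) by auto
  moreover have "geodesic_on A g (I \<inter> J) \<gamma>" "geodesic_on A g (I \<inter> J) \<delta>"
    using \<gamma>(4) \<delta>(4) geodesic_on_subset by auto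
  ultimately have "\<gamma> 1 = \<delta> 1"
    using geodesic_unique[of "I \<inter> J" \<gamma> \<delta> 0 v 1] \<gamma> \<delta> by auto
  then show "q' = q" using \<gamma> \<delta> by simp
qed

end

section \<open>Convexity of level sets\<close>

text \<open>The sign of \<open>f\<close> is given only to the right of 0, where the exponential map
  is evaluated. A positive \<open>D\<close> would make \<open>f'\<close> positive there and let
  \<open>f\<close> rise above 0.\<close>

lemma second_derivative_nonpos:
  fixes f f' :: "real \<Rightarrow> real"
  assumes \<epsilon>: "\<epsilon> > 0" and f: "\<And>t. t \<in> {0..<\<epsilon>} \<Longrightarrow> (f has_real_derivative f' t) (at t)"
    and f': "(f' has_real_derivative D) (at 0)" and 0: "f 0 = 0" "f' 0 = 0"
    and nonpos: "\<And>t. t \<in> {0<..<\<epsilon>} \<Longrightarrow> f t \<le> 0"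
  shows "D \<le> 0"
proof (rule ccontr)
  assume "\<not> D \<le> 0"
  then obtain d where d: "d > 0" "\<And>h. 0 < h \<Longrightarrow> h < d \<Longrightarrow> f' 0 < f' (0 + h)"
    using DERIV_pos_inc_right[OF f'] by auto
  define t where "t = min d \<epsilon> / 2"
  have t: "0 < t" "t < d" "t < \<epsilon>" using d \<epsilon> by (auto simp: t_def)
  have "\<And>x. 0 \<le> x \<Longrightarrow> x \<le> t \<Longrightarrow> (f has_real_derivative f' x) (at x)" using t by (intro f) auto
  from MVT2[OF t(1) this] obtain z where z: "0 < z" "z < t" "f t - f 0 = (t - 0) * f' z" by blast
  have "f' z > 0" using d(2)[of z] z t 0 by simp
  then have "f t > 0" using z(3) t 0 by simp
  then show False using nonpos[of t] t by simp
qed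

section \<open>The Hessian and the tangent space in a chart\<close>

lemma blinfun_axis_expansion:
  fixes B :: "(real^'n) \<Rightarrow>\<^sub>L 'b::real_normed_vector"
  shows "blinfun_apply B a = (\<Sum>i\<in>UNIV. a $ i *\<^sub>R blinfun_apply B (axis i 1))"
  by (rule linear_axis_expansion) (simp add: blinfun.bounded_linear_right bounded_linear.linear)

text \<open>The right-hand side is the second derivative of \<open>\<phi>\<close> along the geodesic
  with velocity \<open>u\<close>, and it is also the difference of the two sides in the hypothesis
  \<open>conv\<close> of the analytic core.\<close>

lemma hessian_chart:
  assumes S: "open S" "crd c x \<in> S"
    and d: "\<And>z. z \<in> S \<Longrightarrow> ((\<phi> \<circ> cinv c) has_derivative blinfun_apply (F' z)) (at z)"
    and d2: "\<And>z. z \<in> S \<Longrightarrow> (F' has_derivative blinfun_apply (F'' z)) (at z)"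
  shows "hessian A g c \<phi> x u u = blinfun_apply (blinfun_apply (F'' (crd c x)) (u c)) (u c)
    - blinfun_apply (F' (crd c x)) (spray A g c (crd c x, u c))"
proof -
  define z where "z = crd c x"
  have z: "z \<in> S" using S by (simp add: z_def)
  have p: "partial l (\<phi> \<circ> cinv c) w = F' w (axis l 1)" if "w \<in> S" for w l
    unfolding partial_def using frechet_derivative_at[OF d[OF that]] by simp
  have pp: "partial i (partial j (\<phi> \<circ> cinv c)) z = F'' z (axis i 1) (axis j 1)" for i j
  proof -
    have "((\<lambda>w. F' w (axis j 1)) has_derivative (\<lambda>h. F'' z h (axis j 1))) (at z)"
      using d2[OF z] by (auto intro!: derivative_eq_intros)
    then have "(partial j (\<phi> \<circ> cinv c) has_derivative (\<lambda>h. F'' z h (axis j 1))) (at z)"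
      by (rule has_derivative_transform_within_open[OF _ S(1) z]) (simp add: p)
    then show ?thesis
      unfolding partial_def[of i] using frechet_derivative_at by metis
  qed
  have "F'' z (u c) (u c) = (\<Sum>j\<in>UNIV. u c $ j *\<^sub>R F'' z (u c) (axis j 1))"
    by (rule blinfun_axis_expansion)
  also have "\<dots> = (\<Sum>j\<in>UNIV. \<Sum>i\<in>UNIV. F'' z (axis i 1) (axis j 1) * u c $ i * u c $ j)"
    unfolding blinfun_axis_expansion[of "F'' z" "u c"]
    by (simp add: blinfun.sum_left blinfun.scaleR_left sum_distrib_left mult_ac)
  also have "\<dots> = (\<Sum>i\<in>UNIV. \<Sum>j\<in>UNIV. F'' z (axis i 1) (axis j 1) * u c $ i * u c $ j)"
    by (rule sum.swap)
  finally have 1: "(\<Sum>i\<in>UNIV. \<Sum>j\<in>UNIV. partial i (partial j (\<phi> \<circ> cinv c)) z * u c $ i * u c $ j) = F'' z (u c) (u c)"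
    by (simp add: pp)
  have "F' z (spray A g c (z, u c)) = (\<Sum>l\<in>UNIV. \<Sum>i\<in>UNIV. \<Sum>j\<in>UNIV.
      F' z (axis l 1) * christoffel A g c l i j z * u c $ i * u c $ j)"
    by (subst blinfun_axis_expansion) (simp add: spray_def sum_distrib_left sum_distrib_right mult_ac)
  also have "\<dots> = (\<Sum>i\<in>UNIV. \<Sum>l\<in>UNIV. \<Sum>j\<in>UNIV.
      F' z (axis l 1) * christoffel A g c l i j z * u c $ i * u c $ j)" by (rule sum.swap)
  also have "\<dots> = (\<Sum>i\<in>UNIV. \<Sum>j\<in>UNIV. \<Sum>l\<in>UNIV.
      F' z (axis l 1) * christoffel A g c l i j z * u c $ i * u c $ j)"
    by (intro sum.cong refl sum.swap)
  finally show ?thesis unfolding hessian_def z_def[symmetric] 1 by (simp add: p[OF z])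
qed

context semi_riemannian_manifold
begin

lemma defining_function_chart:
  assumes def: "defining_function A H U V \<phi>" and c: "c \<in> A"
  obtains F' F'' where "open (crd c ` (cdom c \<inter> V))"
    "\<And>z. z \<in> crd c ` (cdom c \<inter> V) \<Longrightarrow> ((\<phi> \<circ> cinv c) has_derivative blinfun_apply (F' z)) (at z)"
    "\<And>z. z \<in> crd c ` (cdom c \<inter> V) \<Longrightarrow> (F' has_derivative blinfun_apply (F'' z)) (at z)"
    "continuous_on (crd c ` (cdom c \<inter> V)) F'"
    "\<And>z. z \<in> crd c ` (cdom c \<inter> V) \<Longrightarrow> (\<phi> \<circ> cinv c) z = 0 \<Longrightarrow> F' z \<noteq> 0"
proof -
  let ?S = "crd c ` (cdom c \<inter> V)"
  note ch = chart[OF c]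
  have V: "open V" using def by (simp add: defining_function_def)
  have "C2_on ?S (\<phi> \<circ> cinv c)" using def c by (simp add: defining_function_def C2_function_on_def)
  from C2_onE[OF this] obtain F' F'' where
    F: "\<And>z. z \<in> ?S \<Longrightarrow> ((\<phi> \<circ> cinv c) has_derivative blinfun_apply (F' z)) (at z)"
    "\<And>z. z \<in> ?S \<Longrightarrow> (F' has_derivative blinfun_apply (F'' z)) (at z)"
    "continuous_on ?S F'" by metis
  show thesis
  proof (rule that[OF chart_open_image_Int[OF ch V] F])
    fix z assume z: "z \<in> ?S" "(\<phi> \<circ> cinv c) z = 0"
    then obtain x where x: "x \<in> cdom c" "x \<in> V" "z = crd c x" by blast
    then have "\<phi> x = 0" using z ch by simp
    moreover have "c \<in> charts_at A x" using c x by (simp add: charts_at_def)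
    ultimately have "frechet_derivative (\<phi> \<circ> cinv c) (at z) \<noteq> (\<lambda>_. 0)"
      using def x unfolding defining_function_def zero_regular_value_def by blast
    then have "blinfun_apply (F' z) \<noteq> (\<lambda>_. 0)"
      using frechet_derivative_at[OF F(1)[OF z(1)]] by simp
    then show "F' z \<noteq> 0" by (auto simp: zero_blinfun.rep_eq)
  qed
qed

text \<open>One inclusion differentiates the equation \<open>\<phi> = 0\<close> along a curve in
  \<open>H\<close>; the other builds a curve in the level set with the prescribed velocity, for
  which 0 has to be a regular value.\<close>

lemma hyper_tangent_space_level_set:
  assumes def: "defining_function A H U V \<phi>" and x: "x \<in> U" and c: "c \<in> A" "x \<in> cdom c"
    and F': "\<And>z. z \<in> crd c ` (cdom c \<inter> V) \<Longrightarrow> ((\<phi> \<circ> cinv c) has_derivative blinfun_apply (F' z)) (at z)"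
    and cont: "continuous_on (crd c ` (cdom c \<inter> V)) F'"
  shows "v \<in> hyper_tangent_space A H x \<longleftrightarrow> v \<in> tangent_space A x \<and> blinfun_apply (F' (crd c x)) (v c) = 0"
proof -
  let ?S = "crd c ` (cdom c \<inter> V)"
  note ch = chart[OF c(1)]
  have V: "open V" "U = V \<inter> H" "U = {x \<in> V. \<phi> x = 0}"
    using def unfolding defining_function_def by blast+
  have S: "open ?S" "crd c x \<in> ?S" using chart_open_image_Int[OF ch V(1)] x c V by auto
  have "\<phi> x = 0" using x V(3) by blast
  then have xF: "(\<phi> \<circ> cinv c) (crd c x) = 0" using c ch by simp
  show ?thesis
  proof
    assume "v \<in> hyper_tangent_space A H x"
    then obtain \<epsilon> \<alpha> where \<alpha>: "\<epsilon> > 0" "C1_curve_on A {-\<epsilon><..<\<epsilon>} \<alpha>" "\<alpha> ` {-\<epsilon><..<\<epsilon>} \<subseteq> H" "\<alpha> 0 = x" "has_velocity A \<alpha> 0 v"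
      unfolding hyper_tangent_space_def by blast
    have vT: "v \<in> tangent_space A x" using \<alpha> by (simp add: has_velocity_def)
    have "c \<in> charts_at A (\<alpha> 0)" using c \<alpha> by (simp add: charts_at_def)
    then have d: "((crd c \<circ> \<alpha>) has_vector_derivative v c) (at 0)"
      using \<alpha> unfolding has_velocity_def by blast
    have "((\<lambda>s. (\<phi> \<circ> cinv c) ((crd c \<circ> \<alpha>) s)) has_real_derivative F' (crd c x) (v c)) (at 0)"
      by (rule vector_derivative_of_real_composition[where c="crd c \<circ> \<alpha>" and t=0, OF _ d])
         (simp only: comp_apply[of "crd c" \<alpha>] \<alpha>(4) F'[OF S(2)])
    \<comment> \<open>The curve lies in \<open>H\<close>, but \<open>\<phi>\<close> is known to
      vanish on \<open>V \<inter> H\<close> only; continuity confines the curve to \<open>V\<close>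
      for short times.\<close>
    moreover have "\<forall>\<^sub>F s in nhds 0. (\<phi> \<circ> cinv c) ((crd c \<circ> \<alpha>) s) = 0"
    proof -
      have "isCont \<alpha> 0"
        using \<alpha>(1,2) unfolding C1_curve_on_def by (simp add: continuous_on_eq_continuous_at)
      then have "\<forall>\<^sub>F s in nhds 0. \<alpha> s \<in> cdom c" "\<forall>\<^sub>F s in nhds 0. \<alpha> s \<in> V"
        using isCont_eventually_in[where f=\<alpha> and t=0] chart_open_dom[OF ch] V(1) c(2) \<alpha>(4) x V(2) by auto
      moreover have "\<forall>\<^sub>F s in nhds 0. s \<in> {-\<epsilon><..<\<epsilon>}"
        using \<alpha>(1) by (intro eventually_nhds_in_open) auto
      ultimately show ?thesis
      proof eventually_elim
        case (elim s)
        then have "\<alpha> s \<in> U" using \<alpha>(3) V(2) by blast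
        then show ?case using elim V(3) ch by simp
      qed
    qed
    ultimately have "((\<lambda>_. 0) has_real_derivative F' (crd c x) (v c)) (at 0)"
      by (rule iffD1[OF DERIV_cong_ev[OF refl _ refl], rotated])
    then have "F' (crd c x) (v c) = 0" using DERIV_unique DERIV_const by blast
    with vT show "v \<in> tangent_space A x \<and> F' (crd c x) (v c) = 0" by blast
  next
    assume v: "v \<in> tangent_space A x \<and> F' (crd c x) (v c) = 0"
    have "F' (crd c x) \<noteq> 0"
    proof -
      have "c \<in> charts_at A x" using c by (simp add: charts_at_def)
      then have "frechet_derivative (\<phi> \<circ> cinv c) (at (crd c x)) \<noteq> (\<lambda>_. 0)"
        using def x V unfolding defining_function_def zero_regular_value_def by blast
      then show ?thesis
        using frechet_derivative_at[OF F'[OF S(2)]] by (auto simp: zero_blinfun.rep_eq)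
    qed
    from curve_in_level_set[OF S F' cont xF this, of "v c"] v
    obtain \<epsilon> \<beta> \<beta>' where \<epsilon>: "\<epsilon> > 0" and b: "\<beta> 0 = crd c x" "\<beta>' 0 = v c" "continuous_on {-\<epsilon><..<\<epsilon>} \<beta>'"
      and \<beta>: "\<And>t. t \<in> {-\<epsilon><..<\<epsilon>} \<Longrightarrow> \<beta> t \<in> ?S \<and> (\<phi> \<circ> cinv c) (\<beta> t) = 0 \<and> (\<beta> has_vector_derivative \<beta>' t) (at t)"
      by blast
    have \<beta>c: "\<beta> t \<in> crd c ` cdom c" if "t \<in> {-\<epsilon><..<\<epsilon>}" for t using \<beta>[OF that] by blast
    show "v \<in> hyper_tangent_space A H x"
      unfolding hyper_tangent_space_def
    proof (intro CollectI exI[of _ \<epsilon>] exI[of _ "cinv c \<circ> \<beta>"] conjI \<epsilon>)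
      show "C1_curve_on A {-\<epsilon><..<\<epsilon>} (cinv c \<circ> \<beta>)"
        using \<beta> \<beta>c b(3) by (intro C1_curve_of_chart_curve[OF c(1)]) auto
      show "(cinv c \<circ> \<beta>) ` {-\<epsilon><..<\<epsilon>} \<subseteq> H"
      proof (intro image_subsetI)
        fix t assume t: "t \<in> {-\<epsilon><..<\<epsilon>}"
        then have "cinv c (\<beta> t) \<in> V" "\<phi> (cinv c (\<beta> t)) = 0"
          using \<beta>[OF t] unfolding chart_image_Int[OF ch] by auto
        then have "cinv c (\<beta> t) \<in> U" using V(3) by blast
        then show "(cinv c \<circ> \<beta>) t \<in> H" using V(2) by simp
      qed
      show "(cinv c \<circ> \<beta>) 0 = x" using b c ch by simp
      have "0 \<in> {-\<epsilon><..<\<epsilon>}" using \<epsilon> by simp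
      then have "has_velocity A (cinv c \<circ> \<beta>) 0 (tvec_of A c (cinv c (\<beta> 0)) (v c))"
        using \<beta>[of 0] \<beta>c[of 0] b(2) by (intro velocity_of_chart_solution[OF c(1)]) auto
      then show "has_velocity A (cinv c \<circ> \<beta>) 0 v"
        using b c ch tangent_vector_eq[OF c] v by simp
    qed
  qed
qed

text \<open>In a chart, the Hessian condition becomes the hypothesis \<open>conv\<close> for the
  function \<open>\<sigma> * \<phi>\<close> and the spray. Picard-Lindelof supplies the geodesics on
  a time interval common to all small initial velocities, and rescaling brings them to time
  1.\<close>

lemma local_convexity_of_hessian:
  assumes def: "defining_function A H U V \<phi>"
    and hess: "\<And>x v c. x \<in> U \<Longrightarrow> v \<in> hyper_tangent_space A H x \<Longrightarrow> c \<in> charts_at A x \<Longrightarrow>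
      \<sigma> * hessian A g c \<phi> x v v \<le> 0"
    and \<sigma>: "\<sigma> \<noteq> 0" and x: "x \<in> U"
  shows "exp_locally_in A g H x {y \<in> V. \<sigma> * \<phi> y \<le> 0}"
proof -
  obtain c where c: "c \<in> A" "x \<in> cdom c" using charts_at_nonempty by blast
  note ch = chart[OF c(1)]
  let ?S = "crd c ` (cdom c \<inter> V)"
  have V: "open V" "U = V \<inter> H" "U = {x \<in> V. \<phi> x = 0}"
    using def unfolding defining_function_def by blast+
  from defining_function_chart[OF def c(1)] obtain F' F'' where S: "open ?S"
    and F: "\<And>z. z \<in> ?S \<Longrightarrow> ((\<phi> \<circ> cinv c) has_derivative blinfun_apply (F' z)) (at z)"
    and F2: "\<And>z. z \<in> ?S \<Longrightarrow> (F' has_derivative blinfun_apply (F'' z)) (at z)"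
    and F'c: "continuous_on ?S F'" and reg: "\<And>z. z \<in> ?S \<Longrightarrow> (\<phi> \<circ> cinv c) z = 0 \<Longrightarrow> F' z \<noteq> 0"
    by blast
  note T = hyper_tangent_space_level_set[OF def _ c(1) _ F F'c]
  define z0 where "z0 = crd c x"
  have "x \<in> V" "\<phi> x = 0" using x V(3) by blast+
  then have z0: "z0 \<in> ?S" "cinv c z0 = x" "(\<phi> \<circ> cinv c) z0 = 0" using c ch by (auto simp: z0_def)
  have sub: "?S \<subseteq> crd c ` cdom c" by blast
  have lipQ: "loc_lip (?S \<times> UNIV) (spray A g c)"
    by (rule loc_lip_subset[OF loc_lip_spray[OF c(1)]]) (use sub in blast)
  define G where "G = (\<lambda>z. \<sigma> * (\<phi> \<circ> cinv c) z)"
  define G' where "G' = (\<lambda>z. \<sigma> *\<^sub>R F' z)"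
  define G'' where "G'' = (\<lambda>z. \<sigma> *\<^sub>R F'' z)"
  have conv: "G'' z v v \<le> G' z (spray A g c (z, v))"
    if z: "z \<in> ?S" "G z = 0" "G' z v = 0" for z v
  proof -
    define y where "y = cinv c z"
    have y: "y \<in> cdom c" "y \<in> V" "crd c y = z"
      using z(1) ch chart_crd_cinv[OF ch] by (auto simp: y_def)
    have yU: "y \<in> U" using z(2) \<sigma> y V(3) by (simp add: G_def y_def)
    define u where "u = tvec_of A c y v"
    have u: "u \<in> tangent_space A y" "u c = v"
      using tvec_of_in_tangent_space tvec_of_self c(1) y by (auto simp: u_def)
    have "u \<in> hyper_tangent_space A H y"
      using T[OF yU y(1)] u z(3) \<sigma> y(3) by (auto simp: G'_def blinfun.scaleR_left)
    then have "\<sigma> * hessian A g c \<phi> y u u \<le> 0"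
      using hess[OF yU] c(1) y(1) by (simp add: charts_at_def)
    moreover have "hessian A g c \<phi> y u u = F'' z v v - F' z (spray A g c (z, v))"
      using hessian_chart[where c=c and x=y and \<phi>=\<phi> and F'=F' and F''=F'' and A=A and g=g and u=u, OF S _ F F2]
        z(1) y(3) u(2) by simp
    ultimately show ?thesis
      by (simp add: G'_def G''_def blinfun.scaleR_left right_diff_distrib)
  qed
  have dG: "\<And>z. z \<in> ?S \<Longrightarrow> (G has_derivative blinfun_apply (G' z)) (at z)"
    unfolding G_def G'_def
    by (rule has_derivative_eq_rhs[OF has_derivative_mult_right[OF F]]) (auto simp: fun_eq_iff blinfun.scaleR_left)
  have dG': "\<And>z. z \<in> ?S \<Longrightarrow> (G' has_derivative blinfun_apply (G'' z)) (at z)"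
    unfolding G'_def G''_def
    by (rule has_derivative_eq_rhs[OF has_derivative_scaleR_right[OF F2]]) (auto simp: fun_eq_iff blinfun.scaleR_left)
  have G0: "G z0 = 0" "G' z0 \<noteq> 0" using z0 reg \<sigma> by (auto simp: G_def G'_def)
  obtain R \<delta> where R: "R > 0" "\<delta> > 0" and core: "\<And>\<gamma> y \<epsilon> s. \<epsilon> \<le> \<delta> \<Longrightarrow>
      (\<And>t. t \<in> {-\<epsilon><..<\<epsilon>} \<Longrightarrow> (\<gamma> has_vector_derivative y t) (at t) \<and>
        (y has_vector_derivative - spray A g c (\<gamma> t, y t)) (at t) \<and> (\<gamma> t, y t) \<in> cball (z0, 0) R) \<Longrightarrow>
      \<gamma> 0 = z0 \<Longrightarrow> blinfun_apply (G' z0) (y 0) = 0 \<Longrightarrow> s \<in> {0..<\<epsilon>} \<Longrightarrow> G (\<gamma> s) \<le> 0"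
    using spray_curves_below_convex_level_set[OF S z0(1) dG dG' G0 lipQ conv] by blast
  obtain q L where q: "q > 0" and L: "L-lipschitz_on (?S \<times> UNIV \<inter> ball (z0, 0) q) (spray A g c)"
    using lipQ z0(1) unfolding loc_lip_def by (meson SigmaI UNIV_I)
  obtain rS where rS: "rS > 0" "ball z0 rS \<subseteq> ?S" using S z0(1) open_contains_ball by blast
  \<comment> \<open>In this ball of phase space the analytic core applies, the spray is Lipschitz,
    and positions stay in the chart image of \<open>V\<close>.\<close>
  define P where "P = Min {R, q / 2, rS / 2}"
  have P: "P > 0" "P \<le> R" "P < q" "P < rS" using R q rS by (auto simp: P_def)
  have cb: "fst p \<in> ?S" if "p \<in> cball (z0, 0) P" for p
    using that dist_fst_le[of "(z0, 0)" p] P rS by (auto intro!: subsetD[OF rS(2)])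
  define f where "f = (\<lambda>p. (snd p, - spray A g c p))"
  have "L-lipschitz_on (cball (z0, 0) P) (spray A g c)"
    by (rule lipschitz_on_subset[OF L]) (use cb P in \<open>auto simp: subset_iff mem_Times_iff\<close>)
  then have "L-lipschitz_on (cball (z0, 0) P) (\<lambda>p. - spray A g c p)" by simp
  moreover have "1-lipschitz_on (cball (z0, 0) P) (snd :: (real^'n) \<times> (real^'n) \<Rightarrow> real^'n)"
    by (rule lipschitz_onI) (simp_all add: dist_snd_le)
  ultimately obtain L' where fL: "L'-lipschitz_on (cball (z0, 0) P) f"
    unfolding f_def using lipschitz_on_Pair by blast
  obtain \<delta>1 where \<delta>1: "\<delta>1 > 0" and pl: "\<And>x1. x1 \<in> cball (z0, 0) (P / 2) \<Longrightarrow> \<exists>u. u 0 = x1 \<and>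
      (\<forall>t\<in>{-\<delta>1<..<\<delta>1}. u t \<in> cball (z0, 0) P \<and> (u has_vector_derivative f (u t)) (at t))"
    using picard_lindelof_uniform[OF P(1) fL] by blast
  define \<epsilon> where "\<epsilon> = min \<delta> \<delta>1"
  have \<epsilon>: "\<epsilon> > 0" "\<epsilon> \<le> \<delta>" "\<epsilon> \<le> \<delta>1" using R \<delta>1 by (auto simp: \<epsilon>_def)
  \<comment> \<open>Half of the available time is mapped to time 1, so that the rescaled geodesic
    lives on the open interval from -2 to 2, which contains \<open>{0..1}\<close>.\<close>
  define a where "a = \<epsilon> / 2"
  have a: "a > 0" "a < \<epsilon>" using \<epsilon> by (auto simp: a_def)
  \<comment> \<open>A vector \<open>v\<close> is realised by the solution with velocity
    \<open>v / a\<close> followed up to time \<open>a\<close>. The bound on \<open>v c\<close> puts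
    its initial data into the half ball required by Picard-Lindelof.\<close>
  define N where "N = {v \<in> hyper_tangent_space A H x. norm (v c) < a * P / 2}"
  have key: "\<exists>q. exp_reaches A g x v q \<and> q \<in> {y \<in> V. \<sigma> * \<phi> y \<le> 0}" if v: "v \<in> N" for v
  proof -
    have vT: "v \<in> tangent_space A x" "F' z0 (v c) = 0" "norm (v c) < a * P / 2"
      using v T[OF x c(2)] by (auto simp: N_def z0_def)
    define w where "w = (1 / a) *\<^sub>R v c"
    have "norm w \<le> P / 2"
      using vT(3) a by (simp add: w_def field_simps)
    then have "(z0, w) \<in> cball (z0, 0) (P / 2)" by (simp add: dist_Pair_Pair)
    from pl[OF this] obtain u where u: "u 0 = (z0, w)"
      "\<And>t. t \<in> {-\<delta>1<..<\<delta>1} \<Longrightarrow> u t \<in> cball (z0, 0) P \<and> (u has_vector_derivative f (u t)) (at t)" by blast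
    define z where "z = (\<lambda>t. fst (u t))"
    define y where "y = (\<lambda>t. snd (u t))"
    have sol: "z t \<in> ?S" "(z has_vector_derivative y t) (at t)"
      "(y has_vector_derivative - spray A g c (z t, y t)) (at t)" "(z t, y t) \<in> cball (z0, 0) R"
      if t: "t \<in> {-\<epsilon><..<\<epsilon>}" for t
    proof -
      have ut: "u t \<in> cball (z0, 0) P" "(u has_vector_derivative f (u t)) (at t)"
        using u(2)[of t] t \<epsilon> by auto
      show "z t \<in> ?S" using cb[OF ut(1)] by (simp add: z_def)
      show "(z has_vector_derivative y t) (at t)"
        using bounded_linear.has_vector_derivative[OF bounded_linear_fst ut(2)] by (simp add: z_def y_def f_def)
      show "(y has_vector_derivative - spray A g c (z t, y t)) (at t)"
        using bounded_linear.has_vector_derivative[OF bounded_linear_snd ut(2)] by (simp add: z_def y_def f_def)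
      show "(z t, y t) \<in> cball (z0, 0) R" using ut(1) P by (simp add: z_def y_def)
    qed
    have init: "z 0 = z0" "y 0 = w" using u(1) by (auto simp: z_def y_def)
    define \<gamma> where "\<gamma> = (\<lambda>t. (cinv c \<circ> z) (a * t))"
    have geo: "geodesic_on A g {t. a * t \<in> {-\<epsilon><..<\<epsilon>}} \<gamma>"
      unfolding \<gamma>_def
      by (intro geodesic_on_rescale geodesic_of_chart_solution[where y=y, OF c(1)]) (use sol sub in blast)
    have vel: "has_velocity A \<gamma> 0 v"
    proof -
      have "0 \<in> {-\<epsilon><..<\<epsilon>}" using \<epsilon> by simp
      then have "has_velocity A (cinv c \<circ> z) 0 (tvec_of A c x w)"
        using velocity_of_chart_solution[OF c(1), of z 0 w] sol[of 0] init sub z0 by auto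
      then have "has_velocity A \<gamma> 0 (\<lambda>d. a *\<^sub>R tvec_of A c x w d)"
        unfolding \<gamma>_def using has_velocity_rescale[of "cinv c \<circ> z" a 0] by simp
      moreover have "(\<lambda>d. a *\<^sub>R tvec_of A c x w d) = v"
      proof -
        have "(\<lambda>d. a *\<^sub>R tvec_of A c x w d) \<in> tangent_space A x"
          by (intro tangent_space_scaleR tvec_of_in_tangent_space c)
        moreover have "a *\<^sub>R tvec_of A c x w c = v c"
          using a tvec_of_self[OF c] by (simp add: w_def)
        ultimately show ?thesis using tangent_vector_eq[OF c] vT(1) by metis
      qed
      ultimately show ?thesis by simp
    qed
    have I: "{t. a * t \<in> {-\<epsilon><..<\<epsilon>}} = {-2<..<2}"
    proof -
      have "- \<epsilon> = a * (-2)" "\<epsilon> = a * 2" by (simp_all add: a_def)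
      then have "- \<epsilon> < a * t \<longleftrightarrow> -2 < t" "a * t < \<epsilon> \<longleftrightarrow> t < 2" for t
        using a(1) mult_less_cancel_left_pos by metis+
      then show ?thesis by auto
    qed
    have \<gamma>0: "\<gamma> 0 = x" using init z0 by (simp add: \<gamma>_def)
    have "exp_reaches A g x v (\<gamma> 1)"
      unfolding exp_reaches_def
      using geo vel \<gamma>0 unfolding I by (intro exI[of _ "{-2<..<2}"] exI[of _ \<gamma>]) auto
    moreover have "\<gamma> 1 \<in> V"
      using sol(1)[of a] a \<epsilon> unfolding chart_image_Int[OF ch] by (auto simp: \<gamma>_def)
    moreover have "\<sigma> * \<phi> (\<gamma> 1) \<le> 0"
    proof -
      have "G' z0 (y 0) = 0" using vT(2) by (simp add: init w_def G'_def blinfun.bilinear_simps)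
      then have "G (z a) \<le> 0"
        using core[OF \<epsilon>(2), of z y a] sol init a by auto
      then show ?thesis by (simp add: G_def \<gamma>_def)
    qed
    ultimately show ?thesis by blast
  qed
  show ?thesis
    unfolding exp_locally_in_def
  proof (intro exI[of _ N] conjI)
    show "N \<subseteq> exp_domain A g x" using key unfolding exp_domain_def by blast
    show "exp_map A g x ` N \<subseteq> {y \<in> V. \<sigma> * \<phi> y \<le> 0}"
      using key exp_map_eq by (metis (no_types, lifting) image_subsetI)
    \<comment> \<open>Only the component in the chart \<open>c\<close> is restricted, and evaluation
      at \<open>c\<close> is continuous in the product topology on tangent vectors.\<close>
    have "open {v :: ('m, 'n) tvec. norm (v c) < a * P / 2}"
      by (intro open_Collect_less continuous_intros continuous_on_product_coordinates)
    then have "openin (top_of_set (hyper_tangent_space A H x)) N"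
      unfolding N_def openin_open by (intro exI[of _ "{v. norm (v c) < a * P / 2}"]) auto
    moreover have "(\<lambda>_. 0) \<in> N"
    proof -
      have "(\<lambda>_. 0) \<in> tangent_space A x"
        using tangent_space_scaleR[OF tvec_of_in_tangent_space[OF c], of 0] by simp
      then show ?thesis using T[OF x c(2)] a P by (simp add: N_def)
    qed
    ultimately show "nhd_in (hyper_tangent_space A H x) (\<lambda>_. 0) N"
      unfolding nhd_in_def N_def by blast
  qed
qed

text \<open>Local convexity concerns only endpoints of geodesics at time 1. By rescaling, every
  point of a short geodesic is such an endpoint, so the whole arc stays on one side and its second
  derivative at 0 has a sign.\<close>

lemma hessian_of_local_convexity:
  assumes def: "defining_function A H U V \<phi>"
    and loc: "exp_locally_in A g H x {y \<in> V. \<sigma> * \<phi> y \<le> 0}"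
    and x: "x \<in> U" and v: "v \<in> hyper_tangent_space A H x" and cx: "c \<in> charts_at A x"
  shows "\<sigma> * hessian A g c \<phi> x v v \<le> 0"
proof -
  have c: "c \<in> A" "x \<in> cdom c" using cx by (auto simp: charts_at_def)
  note ch = chart[OF c(1)]
  let ?S = "crd c ` (cdom c \<inter> V)"
  have V: "open V" "U = V \<inter> H" "U = {x \<in> V. \<phi> x = 0}"
    using def unfolding defining_function_def by blast+
  from defining_function_chart[OF def c(1)] obtain F' F'' where S: "open ?S"
    and F: "\<And>z. z \<in> ?S \<Longrightarrow> ((\<phi> \<circ> cinv c) has_derivative blinfun_apply (F' z)) (at z)"
    and F2: "\<And>z. z \<in> ?S \<Longrightarrow> (F' has_derivative blinfun_apply (F'' z)) (at z)"
    and F'c: "continuous_on ?S F'"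
    by metis
  note T = hyper_tangent_space_level_set[OF def x c F F'c]
  have xS: "crd c x \<in> ?S" using c x V by blast
  have vT: "v \<in> tangent_space A x" "F' (crd c x) (v c) = 0" using v T by auto
  obtain N W where N: "N \<subseteq> exp_domain A g x" "exp_map A g x ` N \<subseteq> {y \<in> V. \<sigma> * \<phi> y \<le> 0}"
    and W: "openin (top_of_set (hyper_tangent_space A H x)) W" "(\<lambda>_. 0) \<in> W" "W \<subseteq> N"
    using loc unfolding exp_locally_in_def nhd_in_def by blast
  obtain X where X: "open X" "W = hyper_tangent_space A H x \<inter> X"
    using W(1) unfolding openin_open by blast
  \<comment> \<open>The ray through \<open>v\<close>. A neighbourhood \<open>N\<close> of 0 may fail
    to be star-shaped, so a whole segment of the ray is placed in it by continuity at 0.\<close>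
  define m where "m = (\<lambda>t d. t *\<^sub>R v d :: real^'n)"
  have mT: "m t \<in> hyper_tangent_space A H x" for t
    using T tangent_space_scaleR[OF vT(1)] vT(2) by (simp add: m_def blinfun.scaleR_right)
  have "continuous_on UNIV m"
    unfolding m_def by (intro continuous_on_coordinatewise_then_product continuous_intros)
  then have "\<forall>\<^sub>F t in nhds 0. m t \<in> X"
    using X W(2) by (intro isCont_eventually_in) (auto simp: continuous_on_eq_continuous_at m_def)
  then obtain e where e: "e > 0" "\<And>t. \<bar>t\<bar> < e \<Longrightarrow> m t \<in> X"
    unfolding eventually_nhds_metric by (auto simp: dist_real_def)
  define r where "r = e / 2"
  have r: "r > 0" using e by (simp add: r_def)
  have mN: "m t \<in> N" if "t \<in> {0..r}" for t
    using e that mT X W(3) by (auto simp: r_def)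
  obtain I \<gamma> where I: "open I" "is_interval I" "{0..1} \<subseteq> I" and geo: "geodesic_on A g I \<gamma>"
    and \<gamma>0: "\<gamma> 0 = x" and vel: "has_velocity A \<gamma> 0 (m r)"
    using mN[of r] N(1) r unfolding exp_domain_def exp_reaches_def by auto
  have below: "\<gamma> t \<in> V \<and> \<sigma> * \<phi> (\<gamma> t) \<le> 0" if t: "t \<in> {0..1}" for t
  proof -
    \<comment> \<open>Running the geodesic at speed \<open>t\<close> makes \<open>\<gamma> t\<close>
      its point at time 1; its initial velocity is again on the segment of the ray inside
      \<open>N\<close>.\<close>
    have "exp_reaches A g x (m (t * r)) (\<gamma> t)"
      unfolding exp_reaches_def
    proof (intro exI[of _ "{s. t * s \<in> I}"] exI[of _ "\<lambda>s. \<gamma> (t * s)"] conjI)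
      show "open {s. t * s \<in> I}"
        using I(1) continuous_open_vimage[of I "\<lambda>s. t * s"] by (auto simp: vimage_def intro!: continuous_intros)
      show "is_interval {s. t * s \<in> I}"
      proof (rule is_interval_1[THEN iffD2], intro ballI allI impI)
        fix p q s assume *: "p \<in> {s. t * s \<in> I}" "q \<in> {s. t * s \<in> I}" "p \<le> s \<and> s \<le> q"
        then have "t * p \<le> t * s" "t * s \<le> t * q" using t by (auto intro: mult_left_mono)
        then show "s \<in> {s. t * s \<in> I}" using * I(2) unfolding is_interval_1 by blast
      qed
      show "{0..1} \<subseteq> {s. t * s \<in> I}"
        using t I(3) by (auto simp: subset_iff mult_le_one)
      show "geodesic_on A g {s. t * s \<in> I} (\<lambda>s. \<gamma> (t * s))" by (rule geodesic_on_rescale[OF geo])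
      show "\<gamma> (t * 0) = x" using \<gamma>0 by simp
      show "has_velocity A (\<lambda>s. \<gamma> (t * s)) 0 (m (t * r))"
        using has_velocity_rescale[of \<gamma> t 0 "m r"] vel by (simp add: m_def)
      show "\<gamma> (t * 1) = \<gamma> t" by simp
    qed
    then have "exp_map A g x (m (t * r)) = \<gamma> t" by (rule exp_map_eq)
    moreover have "m (t * r) \<in> N" using t r by (intro mN) (auto intro: mult_left_le_one_le)
    ultimately show ?thesis using N(2) by (metis (mono_tags, lifting) image_subset_iff mem_Collect_eq)
  qed
  obtain y where y: "\<And>t. t \<in> I \<Longrightarrow> \<gamma> t \<in> cdom c \<Longrightarrow> ((crd c \<circ> \<gamma>) has_vector_derivative y t) (at t) \<and>
      (y has_vector_derivative - spray A g c (crd c (\<gamma> t), y t)) (at t)"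
    using geo c unfolding geodesic_on_spray by blast
  have 0: "0 \<in> I" using I by auto
  have "((crd c \<circ> \<gamma>) has_vector_derivative m r c) (at 0)"
    using vel \<gamma>0 cx unfolding has_velocity_def by blast
  then have y0: "y 0 = r *\<^sub>R v c"
    using y[OF 0] \<gamma>0 c vector_derivative_unique_at by (metis m_def)
  have "isCont \<gamma> 0"
    using geo I(1) 0 unfolding geodesic_on_def by (simp add: continuous_on_eq_continuous_at)
  then have "\<forall>\<^sub>F t in nhds 0. \<gamma> t \<in> cdom c" "\<forall>\<^sub>F t in nhds 0. \<gamma> t \<in> V" "\<forall>\<^sub>F t in nhds 0. t \<in> I"
    using isCont_eventually_in[where f=\<gamma> and t=0] chart_open_dom[OF ch] V c \<gamma>0 x eventually_nhds_in_open[OF I(1) 0] by auto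
  then have "\<forall>\<^sub>F t in nhds 0. \<gamma> t \<in> cdom c \<and> \<gamma> t \<in> V \<and> t \<in> I" by eventually_elim simp
  then obtain h where h: "h > 0" "\<And>t. \<bar>t\<bar> < h \<Longrightarrow> \<gamma> t \<in> cdom c \<and> \<gamma> t \<in> V \<and> t \<in> I"
    unfolding eventually_nhds_metric by (auto simp: dist_real_def)
  define z where "z = crd c \<circ> \<gamma>"
  have zS: "z t \<in> ?S" if "\<bar>t\<bar> < h" for t using h(2)[OF that] by (auto simp: z_def)
  have zd: "(z has_vector_derivative y t) (at t)" "(y has_vector_derivative - spray A g c (z t, y t)) (at t)"
    if "\<bar>t\<bar> < h" for t using h(2)[OF that] y by (auto simp: z_def)
  have z0: "z 0 = crd c x" using \<gamma>0 by (simp add: z_def)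
  define f where "f = (\<lambda>t. \<sigma> * (\<phi> \<circ> cinv c) (z t))"
  define f' where "f' = (\<lambda>t. \<sigma> * F' (z t) (y t))"
  have hess: "hessian A g c \<phi> x v v = F'' (crd c x) (v c) (v c) - F' (crd c x) (spray A g c (crd c x, v c))"
    by (rule hessian_chart[OF S xS F F2])
  have "\<sigma> * (r\<^sup>2 * hessian A g c \<phi> x v v) \<le> 0"
  proof (rule second_derivative_nonpos[where \<epsilon>="min h 1" and f=f and f'=f'])
    fix t assume "t \<in> {0..<min h 1}"
    then have t: "\<bar>t\<bar> < h" by auto
    show "(f has_real_derivative f' t) (at t)"
      unfolding f_def f'_def
      by (intro DERIV_cmult vector_derivative_of_real_composition[where c=z and t=t, OF F[OF zS[OF t]] zd(1)[OF t]])
  next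
    have h0: "\<bar>0::real\<bar> < h" using h by simp
    have "((\<lambda>t. F' (z t)) has_vector_derivative F'' (z 0) (y 0)) (at 0)"
      by (rule vector_derivative_composition[where c=z and t=0, OF F2[OF zS[OF h0]] zd(1)[OF h0]])
    from has_vector_derivative_blinfun_apply[OF this zd(2)[OF h0]]
    have "((\<lambda>t. F' (z t) (y t)) has_real_derivative F' (z 0) (- spray A g c (z 0, y 0)) + F'' (z 0) (y 0) (y 0)) (at 0)"
      unfolding has_real_derivative_iff_has_vector_derivative .
    moreover have "F' (z 0) (- spray A g c (z 0, y 0)) + F'' (z 0) (y 0) (y 0) = r\<^sup>2 * hessian A g c \<phi> x v v"
      unfolding hess z0 y0
      by (simp add: spray_scaleR blinfun.bilinear_simps power2_eq_square algebra_simps)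
    ultimately show "(f' has_real_derivative \<sigma> * (r\<^sup>2 * hessian A g c \<phi> x v v)) (at 0)"
      unfolding f'_def by (metis DERIV_cmult)
  next
    have "\<phi> x = 0" using x V(3) by blast
    then show "f 0 = 0" using c ch by (simp add: f_def z0)
    show "f' 0 = 0" using vT by (simp add: f'_def z0 y0 blinfun.scaleR_right)
    fix t assume t: "t \<in> {0<..<min h 1}"
    then show "f t \<le> 0"
      using below[of t] h(2)[of t] ch by (simp add: f_def z_def)
  qed (use h in auto)
  then have "r\<^sup>2 * (\<sigma> * hessian A g c \<phi> x v v) \<le> 0" by (simp add: mult.left_commute)
  then show ?thesis using r by (simp add: mult_le_0_iff)
qed

end

theorem theorem3p6:
  fixes A :: "('m::t2_space, 'n::finite) chart set"
    and g :: "('m, 'n) metric"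
    and H U :: "'m set"
    and p :: 'm
  assumes "semi_riemannian A g"
    and "C2_hypersurface A H"
    and "p \<in> H"
    and "nhd_in H p U"
  shows "infinitesimally_convex A g H U \<longleftrightarrow> locally_convex A g H U"
proof -
  interpret semi_riemannian_manifold A g by unfold_locales (rule assms(1))
  \<comment> \<open>The equivalence holds for each fixed pair of \<open>V\<close> and
    \<open>\<phi>\<close>, so the existential quantifiers in both notions of convexity can be
    matched with the same witnesses. With \<sigma> = -1 it covers the opposite side.\<close>
  have iff: "(\<forall>x\<in>U. \<forall>v\<in>hyper_tangent_space A H x. \<forall>c\<in>charts_at A x. \<sigma> * hessian A g c \<phi> x v v \<le> 0) \<longleftrightarrow>
      (\<forall>x\<in>U. exp_locally_in A g H x {y \<in> V. \<sigma> * \<phi> y \<le> 0})"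
    if "defining_function A H U V \<phi>" "\<sigma> \<noteq> 0" for V \<phi> \<sigma>
    using local_convexity_of_hessian[OF that(1) _ that(2)] hessian_of_local_convexity[OF that(1)]
    by blast
  show ?thesis
    unfolding infinitesimally_convex_def locally_convex_def
    using iff[where \<sigma>=1] iff[where \<sigma>="-1"] by (simp cong: conj_cong)
qed

end
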